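(* Under the standing assumptions on the control data $(A,\widehat f,\widehat\lambda,\widehat\ell,\widehat h)$ listed in the context, the value function $\widehat v:[0,T]\times\mathbb{R}^d\to\mathbb{R}$, $$\widehat v(s,\xi):=\inf_{a\in\mathcal{A}}\Big[\int_s^T e^{-\int_s^t\widehat\lambda(r,\phi^{s,\xi,a}(r),a(r))\,dr}\,\widehat\ell(t,\phi^{s,\xi,a}(t),a(t))\,dt+e^{-\int_s^T\widehat\lambda(r,\phi^{s,\xi,a}(r),a(r))\,dr}\,\widehat h(\phi^{s,\xi,a}(T))\Big],$$ is the unique minimax $C_{\widehat f}$-solution of $$-\tfrac{\partial}{\partial t}\widehat u(t,\xi)-\widehat H\big(t,\xi,\widehat u(t,\xi),\tfrac{\partial}{\partial\xi}\widehat u(t,\xi)\big)=0,\ (t,\xi)\in(0,T)\times\mathbb{R}^d,\qquad \widehat u(T,\xi)=\widehat h(\xi),\ \xi\in\mathbb{R}^d,$$ where $\widehat H(t,\xi,y,z):=\inf_{a\in A}[\widehat\ell(t,\xi,a)+\widehat f(t,\xi,a)\cdot z-\widehat\lambda(t,\xi,a)\,y]$ for $(t,\xi,y,z)\in[0,T]\times\mathbb{R}^d\times\mathbb{R}\times\mathbb{R}^d$.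
   Context: Fix $T>0$ and $d\in\mathbb{N}$. $A$ is a non-empty subset of a Polish space and is the countable union of compact metrizable subsets of $A$. $\mathcal{A}$ is the set of all Borel measurable functions from $[0,T]$ to $A$. With $\mathbb{R}_+=[0,\infty)$, the data are $\widehat f:[0,T]\times\mathbb{R}^d\times A\to\mathbb{R}^d$, $\widehat\lambda:[0,T]\times\mathbb{R}^d\times A\to\mathbb{R}_+$, $\widehat\ell:[0,T]\times\mathbb{R}^d\times A\to\mathbb{R}$, $\widehat h:\mathbb{R}^d\to\mathbb{R}$, with the following standing assumptions: (i) for a.e. $t\in[0,T]$ the map $(\xi,a)\mapsto(\widehat f,\widehat\lambda,\widehat\ell)(t,\xi,a)$ is continuous on $\mathbb{R}^d\times A$; (ii) for all $(\xi,a)$ the map $t\mapsto(\widehat f,\widehat\lambda,\widehat\ell)(t,\xi,a)$ is Borel measurable; (iii) there are constants $C_{\widehat f},C_{\widehat\lambda}\ge0$ such that for a.e. $t\in(0,T)$ and all $\xi\in\mathbb{R}^d$: $\sup_{a\in A}(|\widehat f(t,\xi,a)|+|\widehat\ell(t,\xi,a)|)\le C_{\widehat f}(1+|\xi|)$ and $\sup_{a\in A}|\widehat\lambda(t,\xi,a)|\le C_{\widehat\lambda}$; (iv) there is a constant $L_{\widehat f}\ge0$ such that for a.e. $t\in(0,T)$ and all $\xi,\tilde\xi\in\mathbb{R}^d$: $\sup_{a\in A}(|\widehat f(t,\xi,a)-\widehat f(t,\tilde\xi,a)|+|\widehat\ell(t,\xi,a)-\widehat\ell(t,\tilde\xi,a)|+|\widehat\lambda(t,\xi,a)-\widehat\lambda(t,\tilde\xi,a)|)+|\widehat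 h(\xi)-\widehat h(\tilde\xi)|\le L_{\widehat f}|\xi-\tilde\xi|$. For $(s,\xi,a)\in[0,T)\times\mathbb{R}^d\times\mathcal{A}$, $\phi^{s,\xi,a}:[s,T]\to\mathbb{R}^d$ is the (absolutely continuous) solution of $(\phi^{s,\xi,a})'(t)=\widehat f(t,\phi^{s,\xi,a}(t),a(t))$ a.e. on $(s,T)$, $\phi^{s,\xi,a}(s)=\xi$; for $s=T$, $\phi^{T,\xi,a}(T)=\xi$, so that $\widehat v(T,\xi)=\widehat h(\xi)$. Path sets. For $L\ge0$, $s_0\in[0,T)$, $\xi\in\mathbb{R}^d$, $y_0\in\mathbb{R}$, $z\in\mathbb{R}^d$: $\widehat{\mathcal X}^L(s_0,\xi)$ is the set of absolutely continuous $x:[s_0,T]\to\mathbb{R}^d$ with $x(s_0)=\xi$ and $|x'(t)|\le L(1+\sup_{s_0\le s\le t}|x(s)|)$ a.e. on $(s_0,T)$; $\widehat{\mathcal Y}^L(s_0,\xi,y_0,z)$ is the set of $(x,y)\in\widehat{\mathcal X}^L(s_0,\xi)\times C([s_0,T])$ with $y(t)=y_0+\int_{s_0}^t[x'(s)\cdot z-\widehat H(s,x(s),y(s),z)]\,ds$ on $[s_0,T]$. Minimax solutions. Let $L\ge0$ and $\widehat u:[0,T]\times\mathbb{R}^d\to\mathbb{R}$. - $\widehat u$ is a minimax $L$-supersolution if it is lower semicontinuous, $\widehat u(T,\cdot)\ge\widehat h$, and for every $(s_0,\xi,z)\in[0,T)\times\mathbb{R}^d\times\mathbb{R}^d$ and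 every $y_0\ge\widehat u(s_0,\xi)$ there is $(x,y)\in\widehat{\mathcal Y}^L(s_0,\xi,y_0,z)$ with $y(t)\ge\widehat u(t,x(t))$ for each $t\in[s_0,T]$. - $\widehat u$ is a minimax $L$-subsolution if it is upper semicontinuous, $\widehat u(T,\cdot)\le\widehat h$, and for every $(s_0,\xi,z)\in[0,T)\times\mathbb{R}^d\times\mathbb{R}^d$ and every $y_0\le\widehat u(s_0,\xi)$ there is $(x,y)\in\widehat{\mathcal Y}^L(s_0,\xi,y_0,z)$ with $y(t)\le\widehat u(t,x(t))$ for each $t\in[s_0,T]$. - $\widehat u$ is a minimax $L$-solution if it is both. *)

theory Defs
  imports "HOL-Analysis.Analysis"
begin

text \<open>
  Functions on \<open>[s, T]\<close> or on \<open>[0, T] \<times> \<real>\<^sup>d\<close> are total HOL functions of which only the values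
  on the stated domain are ever used.  Integrals and null sets refer to the completed measure
  \<^const>\<open>lebesgue\<close>, since the integrands below are controlled only up to an arbitrary
  subset of a null set of times.
\<close>

definition absolutely_continuous_on_interval ::
    "real \<Rightarrow> real \<Rightarrow> (real \<Rightarrow> 'a::real_normed_vector) \<Rightarrow> bool" where
  "absolutely_continuous_on_interval a b x \<longleftrightarrow>
     (\<forall>\<epsilon>>0. \<exists>\<delta>>0. \<forall>(n::nat) \<alpha> \<beta>.
        (\<forall>i<n. a \<le> \<alpha> i \<and> \<alpha> i \<le> \<beta> i \<and> \<beta> i \<le> b) \<longrightarrow>
        disjoint_family_on (\<lambda>i. {\<alpha> i<..<\<beta> i}) {..<n} \<longrightarrow>
        (\<Sum>i<n. \<beta> i - \<alpha> i) < \<delta> \<longrightarrow>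
        (\<Sum>i<n. norm (x (\<beta> i) - x (\<alpha> i))) < \<epsilon>)"

definition lower_semicontinuous_on :: "'a::topological_space set \<Rightarrow> ('a \<Rightarrow> real) \<Rightarrow> bool" where
  "lower_semicontinuous_on S u \<longleftrightarrow>
     (\<forall>p\<in>S. \<forall>c<u p. eventually (\<lambda>q. c < u q) (at p within S))"

definition upper_semicontinuous_on :: "'a::topological_space set \<Rightarrow> ('a \<Rightarrow> real) \<Rightarrow> bool" where
  "upper_semicontinuous_on S u \<longleftrightarrow>
     (\<forall>p\<in>S. \<forall>c>u p. eventually (\<lambda>q. u q < c) (at p within S))"


subsection \<open>The control problem\<close>

definition controls :: "real \<Rightarrow> 'p::topological_space set \<Rightarrow> (real \<Rightarrow> 'p) set" where
  "controls T A = measurable (restrict_space borel {0..T}) (restrict_space borel A)"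

text \<open>The solution of the controlled equation is unique on \<open>[s, T]\<close> only; requiring
  it to be \<^const>\<open>extensional\<close> makes the definite description meaningful.\<close>

definition trajectory ::
    "real \<Rightarrow> (real \<Rightarrow> 'a::euclidean_space \<Rightarrow> 'p \<Rightarrow> 'a) \<Rightarrow> real \<Rightarrow> 'a \<Rightarrow> (real \<Rightarrow> 'p) \<Rightarrow> real \<Rightarrow> 'a" where
  "trajectory T f s \<xi> a = (THE x. x \<in> extensional {s..T} \<and>
     absolutely_continuous_on_interval s T x \<and> x s = \<xi> \<and>
     (AE t in lebesgue. t \<in> {s<..<T} \<longrightarrow> (x has_vector_derivative f t (x t) (a t)) (at t)))"

definition discount ::
    "(real \<Rightarrow> 'a \<Rightarrow> 'p \<Rightarrow> real) \<Rightarrow> (real \<Rightarrow> 'a) \<Rightarrow> (real \<Rightarrow> 'p) \<Rightarrow> real \<Rightarrow> real \<Rightarrow> real" where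
  "discount lam x a s t = exp (- (LINT r:{s..t}|lebesgue. lam r (x r) (a r)))"

definition cost ::
    "real \<Rightarrow> (real \<Rightarrow> 'a::euclidean_space \<Rightarrow> 'p \<Rightarrow> 'a) \<Rightarrow> (real \<Rightarrow> 'a \<Rightarrow> 'p \<Rightarrow> real) \<Rightarrow>
     (real \<Rightarrow> 'a \<Rightarrow> 'p \<Rightarrow> real) \<Rightarrow> ('a \<Rightarrow> real) \<Rightarrow> real \<Rightarrow> 'a \<Rightarrow> (real \<Rightarrow> 'p) \<Rightarrow> real" where
  "cost T f lam ell h s \<xi> a =
     (let x = trajectory T f s \<xi> a in
        (LINT t:{s..T}|lebesgue. discount lam x a s t * ell t (x t) (a t))
        + discount lam x a s T * h (x T))"

definition value_function ::
    "real \<Rightarrow> 'p::topological_space set \<Rightarrow> (real \<Rightarrow> 'a::euclidean_space \<Rightarrow> 'p \<Rightarrow> 'a) \<Rightarrow>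
     (real \<Rightarrow> 'a \<Rightarrow> 'p \<Rightarrow> real) \<Rightarrow> (real \<Rightarrow> 'a \<Rightarrow> 'p \<Rightarrow> real) \<Rightarrow> ('a \<Rightarrow> real) \<Rightarrow> real \<Rightarrow> 'a \<Rightarrow> real" where
  "value_function T A f lam ell h s \<xi> = (INF a\<in>controls T A. cost T f lam ell h s \<xi> a)"

text \<open>The growth bounds on the data hold for almost every \<open>t\<close> only, so on a null set of
  times the infimum may be over a set unbounded below and its value there is unspecified.
  The Hamiltonian is used only under a time integral.\<close>

definition hamiltonian ::
    "'p set \<Rightarrow> (real \<Rightarrow> 'a::euclidean_space \<Rightarrow> 'p \<Rightarrow> 'a) \<Rightarrow> (real \<Rightarrow> 'a \<Rightarrow> 'p \<Rightarrow> real) \<Rightarrow>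
     (real \<Rightarrow> 'a \<Rightarrow> 'p \<Rightarrow> real) \<Rightarrow> real \<Rightarrow> 'a \<Rightarrow> real \<Rightarrow> 'a \<Rightarrow> real" where
  "hamiltonian A f lam ell t \<xi> y z = (INF a\<in>A. ell t \<xi> a + f t \<xi> a \<bullet> z - lam t \<xi> a * y)"


subsection \<open>Minimax solutions of \<open>- \<partial>\<^sub>t u - H(t, \<xi>, u, \<partial>\<^sub>\<xi> u) = 0\<close>, \<open>u(T, \<cdot>) = h\<close>\<close>

definition path_set :: "real \<Rightarrow> real \<Rightarrow> real \<Rightarrow> 'a::euclidean_space \<Rightarrow> (real \<Rightarrow> 'a) set" where
  "path_set T L s0 \<xi> = {x. absolutely_continuous_on_interval s0 T x \<and> x s0 = \<xi> \<and>
     (AE t in lebesgue. t \<in> {s0<..<T} \<longrightarrow>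
        x differentiable (at t) \<and>
        norm (vector_derivative x (at t)) \<le> L * (1 + (SUP s\<in>{s0..t}. norm (x s))))}"

text \<open>Integrability is stated because \<^const>\<open>set_lebesgue_integral\<close> is \<open>0\<close> on
  non-integrable functions.\<close>

definition path_pair_set ::
    "real \<Rightarrow> (real \<Rightarrow> 'a::euclidean_space \<Rightarrow> real \<Rightarrow> 'a \<Rightarrow> real) \<Rightarrow> real \<Rightarrow> real \<Rightarrow> 'a \<Rightarrow> real \<Rightarrow> 'a \<Rightarrow>
     ((real \<Rightarrow> 'a) \<times> (real \<Rightarrow> real)) set" where
  "path_pair_set T H L s0 \<xi> y0 z = {(x, y). x \<in> path_set T L s0 \<xi> \<and> continuous_on {s0..T} y \<and>
     set_integrable lebesgue {s0..T} (\<lambda>s. vector_derivative x (at s) \<bullet> z - H s (x s) (y s) z) \<and>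
     (\<forall>t\<in>{s0..T}. y t = y0 +
        (LINT s:{s0..t}|lebesgue. vector_derivative x (at s) \<bullet> z - H s (x s) (y s) z))}"

definition minimax_supersolution ::
    "real \<Rightarrow> (real \<Rightarrow> 'a::euclidean_space \<Rightarrow> real \<Rightarrow> 'a \<Rightarrow> real) \<Rightarrow> ('a \<Rightarrow> real) \<Rightarrow> real \<Rightarrow>
     (real \<Rightarrow> 'a \<Rightarrow> real) \<Rightarrow> bool" where
  "minimax_supersolution T H h L u \<longleftrightarrow>
     lower_semicontinuous_on ({0..T} \<times> UNIV) (\<lambda>(t, \<xi>). u t \<xi>) \<and>
     (\<forall>\<xi>. u T \<xi> \<ge> h \<xi>) \<and>
     (\<forall>s0\<in>{0..<T}. \<forall>\<xi> z. \<forall>y0\<ge>u s0 \<xi>.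
        \<exists>(x, y)\<in>path_pair_set T H L s0 \<xi> y0 z. \<forall>t\<in>{s0..T}. y t \<ge> u t (x t))"

definition minimax_subsolution ::
    "real \<Rightarrow> (real \<Rightarrow> 'a::euclidean_space \<Rightarrow> real \<Rightarrow> 'a \<Rightarrow> real) \<Rightarrow> ('a \<Rightarrow> real) \<Rightarrow> real \<Rightarrow>
     (real \<Rightarrow> 'a \<Rightarrow> real) \<Rightarrow> bool" where
  "minimax_subsolution T H h L u \<longleftrightarrow>
     upper_semicontinuous_on ({0..T} \<times> UNIV) (\<lambda>(t, \<xi>). u t \<xi>) \<and>
     (\<forall>\<xi>. u T \<xi> \<le> h \<xi>) \<and>
     (\<forall>s0\<in>{0..<T}. \<forall>\<xi> z. \<forall>y0\<le>u s0 \<xi>.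
        \<exists>(x, y)\<in>path_pair_set T H L s0 \<xi> y0 z. \<forall>t\<in>{s0..T}. y t \<le> u t (x t))"

definition minimax_solution ::
    "real \<Rightarrow> (real \<Rightarrow> 'a::euclidean_space \<Rightarrow> real \<Rightarrow> 'a \<Rightarrow> real) \<Rightarrow> ('a \<Rightarrow> real) \<Rightarrow> real \<Rightarrow>
     (real \<Rightarrow> 'a \<Rightarrow> real) \<Rightarrow> bool" where
  "minimax_solution T H h L u \<longleftrightarrow>
     minimax_supersolution T H h L u \<and> minimax_subsolution T H h L u"

end

theory Submission
  imports Defs "HOL-Complex_Analysis.Great_Picard"
begin

text \<open>
  The characteristics of the equation are the pairs \<open>(x, y)\<close> in the path sets, and everything
  rests on reading the equation along them.

  Existence. For a control \<open>a\<close> with trajectory \<open>x\<close>, let \<open>y\<close> solve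
  \<open>y' = x' \<bullet> z - H(t, x, y, z)\<close>. Then running cost plus discounted \<open>y\<close> has derivative equal to
  the discount factor times the gap between \<open>ell + f \<bullet> z - lam y\<close> at \<open>a(t)\<close> and its infimum
  \<open>H\<close> (lemma \<open>discounted_characteristic\<close>). The gap is never negative, so for a nearly optimal
  control the dynamic programming principle keeps \<open>y\<close> above the value function along \<open>x\<close>, up to a
  small error. If instead the control nearly attains the infimum at almost every time
  (lemma \<open>near_minimizing_control\<close>), then \<open>y\<close> stays below the value function, again up to a small
  error. Characteristics from a fixed starting point form a compact set
  (lemma \<open>path_pair_compact\<close>, by Arzela and Ascoli), and the value function is continuous, so
  the errors disappear in the limit. The controls do not converge; only the paths do, which is why
  the path sets ask for nothing but a bound on the speed. The limit of trajectories is only known to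
  be Lipschitz, hence the need for the almost everywhere differentiability of Lipschitz functions.

  Uniqueness. Let \<open>w\<close> be a subsolution and \<open>u\<close> a supersolution, both continuous. Start from two
  copies of the same point and move them along a characteristic of \<open>w\<close> and one of \<open>u\<close> with the
  common vector \<open>z\<close> equal to the gradient of a quadratic penalty on the distance of the copies,
  readjusting \<open>z\<close> on a fine time grid. Since \<open>H\<close> is Lipschitz in the state and nonincreasing in
  \<open>y\<close>, the quantity \<open>w(t, x) - u(t, x')\<close> minus the penalty hardly decreases
  (lemma \<open>doubled_characteristics_step\<close>), while at time \<open>T\<close> it is at most a small number because
  the terminal datum is Lipschitz. Hence \<open>w \<le> u\<close> (theorem \<open>minimax_comparison\<close>); two solutions
  compared in both directions coincide.

  The hypotheses hold at almost every time only. The value function and the path sets are defined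
  through integrals over time and equations at almost every time, so the data may first be set to
  \<open>0\<close> on a Borel null set; the locale \<open>control_data\<close> collects what then holds at all times.
\<close>

section \<open>The fundamental theorem of calculus for absolutely continuous functions\<close>

lemma AE_lebesgue_iff_negligible: "(AE t in lebesgue. P t) \<longleftrightarrow> negligible {t. \<not> P t}"
  by (auto simp: eventually_ae_filter negligible_iff_null_sets[symmetric] intro: negligible_subset)

text \<open>
  Tagged divisions are sets, so the definition of absolute continuity, which speaks of
  enumerated families of intervals, is transferred to arbitrary finite index sets.
\<close>

lemma absolutely_continuous_finite_family:
  fixes x :: "real \<Rightarrow> 'a::real_normed_vector"
  assumes ac: "absolutely_continuous_on_interval a b x" and "\<epsilon> > 0"
  shows "\<exists>\<delta>>0. \<forall>S l u. finite S \<longrightarrow> (\<forall>i\<in>S. a \<le> l i \<and> l i \<le> u i \<and> u i \<le> b) \<longrightarrow>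
     disjoint_family_on (\<lambda>i. {l i<..<u i}) S \<longrightarrow> (\<Sum>i\<in>S. u i - l i) < \<delta> \<longrightarrow>
     (\<Sum>i\<in>(S::'i set). norm (x (u i) - x (l i))) < \<epsilon>"
proof -
  obtain \<delta> where "\<delta> > 0" and \<delta>: "\<And>(n::nat) \<alpha> \<beta>.
        (\<forall>i<n. a \<le> \<alpha> i \<and> \<alpha> i \<le> \<beta> i \<and> \<beta> i \<le> b) \<Longrightarrow>
        disjoint_family_on (\<lambda>i. {\<alpha> i<..<\<beta> i}) {..<n} \<Longrightarrow>
        (\<Sum>i<n. \<beta> i - \<alpha> i) < \<delta> \<Longrightarrow>
        (\<Sum>i<n. norm (x (\<beta> i) - x (\<alpha> i))) < \<epsilon>"
    using ac \<open>\<epsilon> > 0\<close> unfolding absolutely_continuous_on_interval_def by meson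
  show ?thesis
  proof (intro exI[of _ \<delta>] conjI allI impI \<open>\<delta> > 0\<close>)
    fix S :: "'i set" and l u
    assume fin: "finite S" and bds: "\<forall>i\<in>S. a \<le> l i \<and> l i \<le> u i \<and> u i \<le> b"
      and disj: "disjoint_family_on (\<lambda>i. {l i<..<u i}) S" and sm: "(\<Sum>i\<in>S. u i - l i) < \<delta>"
    obtain p where p: "bij_betw p {..<card S} S"
      using ex_bij_betw_nat_finite[OF fin] by (auto simp: atLeast0LessThan)
    have inS: "p i \<in> S" if "i < card S" for i
      using p that by (auto simp: bij_betw_def)
    have "disjoint_family_on (\<lambda>i. {(l \<circ> p) i<..<(u \<circ> p) i}) {..<card S}"
      using disj p unfolding disjoint_family_on_def bij_betw_def inj_on_def
      by (metis comp_apply inS lessThan_iff)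
    moreover have "(\<Sum>i<card S. (u \<circ> p) i - (l \<circ> p) i) < \<delta>"
      using sum.reindex_bij_betw[OF p, of "\<lambda>i. u i - l i"] sm by simp
    ultimately have "(\<Sum>i<card S. norm (x ((u \<circ> p) i) - x ((l \<circ> p) i))) < \<epsilon>"
      using bds inS by (intro \<delta>) auto
    then show "(\<Sum>i\<in>S. norm (x (u i) - x (l i))) < \<epsilon>"
      using sum.reindex_bij_betw[OF p, of "\<lambda>i. norm (x (u i) - x (l i))"] by simp
  qed
qed

text \<open>
  A Henstock argument. The gauge is chosen from the derivative at the good times, and from an
  open neighbourhood of small measure at the exceptional null set of times. In a fine tagged
  division the intervals tagged by exceptional times then have small total length, so that absolute
  continuity makes the corresponding increments of \<open>x\<close> small.
\<close>

theorem absolutely_continuous_has_integral: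
  fixes x g :: "real \<Rightarrow> 'a::banach"
  assumes "a \<le> b" and ac: "absolutely_continuous_on_interval a b x"
    and deriv: "AE t in lebesgue. t \<in> {a<..<b} \<longrightarrow> (x has_vector_derivative g t) (at t)"
  shows "(g has_integral (x b - x a)) {a..b}"
proof -
  define N where "N = {t. \<not> (t \<in> {a<..<b} \<longrightarrow> (x has_vector_derivative g t) (at t))} \<union> {a,b}"
  have negN: "negligible N"
    using deriv unfolding N_def AE_lebesgue_iff_negligible by (intro negligible_Un) auto
  define g0 where "g0 t = (if t \<in> N then 0 else g t)" for t
  have "(g0 has_integral (x b - x a)) {a..b}"
    unfolding has_integral_real
  proof (intro allI impI)
    fix e :: real assume "e > 0"
    \<comment> \<open>half of \<open>e\<close> spread over the length; the \<open>+ 1\<close> covers \<open>a = b\<close>\<close>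
    define e' where "e' = e / (2 * (b - a + 1))"
    have "e' > 0" using \<open>e > 0\<close> \<open>a \<le> b\<close> by (simp add: e'_def)
    have e'': "e' * (b - a) < e / 2"
      using \<open>e > 0\<close> \<open>a \<le> b\<close> by (simp add: e'_def field_simps)
    obtain \<delta> where "\<delta> > 0" and \<delta>: "\<And>S l u. finite S \<Longrightarrow> (\<forall>i\<in>S. a \<le> l i \<and> l i \<le> u i \<and> u i \<le> b) \<Longrightarrow>
     disjoint_family_on (\<lambda>i. {l i<..<u i}) S \<Longrightarrow> (\<Sum>i\<in>S. u i - l i) < \<delta> \<Longrightarrow>
     (\<Sum>i\<in>(S::(real \<times> real set) set). norm (x (u i) - x (l i))) < e / 2"
      using absolutely_continuous_finite_family[OF ac, of "e / 2", where ?'i = "real \<times> real set"]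
        \<open>e > 0\<close> by (meson half_gt_zero)
    have "N \<in> sets lebesgue" using negN by (simp add: negligible_iff_null_sets null_setsD2)
    then obtain U where U: "open U" "N \<subseteq> U" "(U - N) \<in> lmeasurable" "emeasure lebesgue (U - N) < ennreal \<delta>"
      using sets_lebesgue_outer_open[OF _ \<open>\<delta> > 0\<close>] by metis
    have UN: "U = (U - N) \<union> N" using U by auto
    have Ulm: "U \<in> lmeasurable"
      using U(3) negN UN by (metis fmeasurable.Un negligible_imp_measurable)
    have Ume: "measure lebesgue U < \<delta>"
    proof -
      have "emeasure lebesgue U = emeasure lebesgue (U - N)"
        using negN U by (intro emeasure_Diff_null_set[symmetric]) (auto simp: negligible_iff_null_sets)
      then have "emeasure lebesgue U < ennreal \<delta>" using U(4) by simp
      then show ?thesis using Ulm \<open>\<delta> > 0\<close> by (simp add: emeasure_eq_measure2 ennreal_less_iff)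
    qed
    have "\<exists>d>0. \<forall>u v. u \<le> t \<and> t \<le> v \<and> {u..v} \<subseteq> ball t d \<longrightarrow>
              norm ((v - u) *\<^sub>R g t - (x v - x u)) \<le> e' * (v - u)" if "t \<in> {a<..<b} - N" for t
    proof -
      have "(x has_derivative (\<lambda>h. h *\<^sub>R g t)) (at t)"
        using that by (auto simp: N_def has_vector_derivative_def)
      then obtain d where "d > 0" and d: "\<And>y. norm (y - t) < d \<Longrightarrow> norm (x y - x t - (y - t) *\<^sub>R g t) \<le> e' * norm (y - t)"
        using \<open>e' > 0\<close> unfolding has_derivative_at_alt by meson
      show ?thesis
      proof (intro exI[of _ d] conjI allI impI \<open>d > 0\<close>)
        fix u v assume uv: "u \<le> t \<and> t \<le> v \<and> {u..v} \<subseteq> ball t d"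
        then have "u \<in> {u..v}" "v \<in> {u..v}" by auto
        then have "u \<in> ball t d" "v \<in> ball t d" using uv by blast+
        then have n: "norm (x u - x t - (u - t) *\<^sub>R g t) \<le> e' * norm (u - t)"
          "norm (x v - x t - (v - t) *\<^sub>R g t) \<le> e' * norm (v - t)"
          by (auto intro!: d[unfolded real_norm_def] simp: dist_norm)
        have "(v - u) *\<^sub>R g t - (x v - x u) =
           (x u - x t - (u - t) *\<^sub>R g t) - (x v - x t - (v - t) *\<^sub>R g t)"
          by (simp add: algebra_simps)
        then have "norm ((v - u) *\<^sub>R g t - (x v - x u))
            \<le> norm (x u - x t - (u - t) *\<^sub>R g t) + norm (x v - x t - (v - t) *\<^sub>R g t)"
          by (simp only: norm_triangle_ineq4)
        also have "\<dots> \<le> e' * norm (u - t) + e' * norm (v - t)" using n by (rule add_mono)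
        also have "\<dots> = e' * (v - u)"
          using uv abs_of_nonpos[of "u - t"] abs_of_nonneg[of "v - t"] by (simp add: algebra_simps)
        finally show "norm ((v - u) *\<^sub>R g t - (x v - x u)) \<le> e' * (v - u)" .
      qed
    qed
    then obtain d where d: "\<And>t. t \<in> {a<..<b} - N \<Longrightarrow> d t > 0"
      "\<And>t u v. t \<in> {a<..<b} - N \<Longrightarrow> u \<le> t \<Longrightarrow> t \<le> v \<Longrightarrow> {u..v} \<subseteq> ball t (d t) \<Longrightarrow>
              norm ((v - u) *\<^sub>R g t - (x v - x u)) \<le> e' * (v - u)"
      by metis
    define \<gamma> where "\<gamma> t = (if t \<in> N then U else if t \<in> {a<..<b} then ball t (d t) else ball t 1)" for t
    have gauge: "gauge \<gamma>"
      using U d(1) by (auto simp: gauge_def \<gamma>_def)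
    have fine: "norm ((\<Sum>(t,K)\<in>D. measure lborel K *\<^sub>R g0 t) - (x b - x a)) < e"
      if D: "D tagged_division_of {a..b}" "\<gamma> fine D" for D
    proof -
      have fin: "finite D" using D(1) by auto
      have KD: "\<exists>u v. K = {u..v} \<and> u \<le> t \<and> t \<le> v \<and> a \<le> u \<and> v \<le> b \<and> Sup K = v \<and> Inf K = u \<and> measure lborel K = v - u"
        if tK: "(t,K) \<in> D" for t K
      proof -
        obtain u v where K: "K = {u..v}" using tagged_division_ofD(4)[OF D(1) tK] by auto
        moreover have "t \<in> K" "K \<subseteq> {a..b}" using tagged_division_ofD(2,3)[OF D(1) tK] by auto
        ultimately show ?thesis by (intro exI[of _ u] exI[of _ v]) auto
      qed
      have fineD: "K \<subseteq> \<gamma> t" if "(t,K) \<in> D" for t K using D(2) that by (auto simp: fine_def)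
      define D1 where "D1 = {p \<in> D. fst p \<in> N}"
      define D2 where "D2 = {p \<in> D. fst p \<notin> N}"
      have DD: "D = D1 \<union> D2" "D1 \<inter> D2 = {}" "finite D1" "finite D2"
        using fin by (auto simp: D1_def D2_def)
      let ?t = "\<lambda>(t,K). measure lborel K *\<^sub>R g0 t - (x (Sup K) - x (Inf K))"
      have split: "(\<Sum>(t,K)\<in>D. measure lborel K *\<^sub>R g0 t) - (x b - x a) = (\<Sum>p\<in>D1. ?t p) + (\<Sum>p\<in>D2. ?t p)"
        unfolding additive_tagged_division_1[OF \<open>a \<le> b\<close> D(1), symmetric] sum_subtractf[symmetric]
        using DD by (simp add: sum.union_disjoint split_def)
      have "norm (\<Sum>p\<in>D2. ?t p) \<le> (\<Sum>p\<in>D2. e' * measure lborel (snd p))"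
      proof (rule sum_norm_le)
        fix p assume "p \<in> D2"
        then obtain t K where p: "p = (t,K)" "(t,K) \<in> D" "t \<notin> N" by (cases p) (auto simp: D2_def)
        obtain u v where uv: "K = {u..v}" "u \<le> t" "t \<le> v" "a \<le> u" "v \<le> b" "Sup K = v" "Inf K = u" "measure lborel K = v - u"
          using KD[OF p(2)] by blast
        have "t \<in> {a..b}" "t \<noteq> a" "t \<noteq> b" using uv p by (auto simp: N_def)
        then have t: "t \<in> {a<..<b} - N" using p by auto
        have "{u..v} \<subseteq> ball t (d t)" using fineD[OF p(2)] t uv by (auto simp: \<gamma>_def)
        from d(2)[OF t uv(2,3) this] show "norm (?t p) \<le> e' * measure lborel (snd p)"
          using p uv by (simp add: g0_def)
      qed
      also have "\<dots> = e' * (\<Sum>p\<in>D2. measure lborel (snd p))" by (simp add: sum_distrib_left)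
      also have "\<dots> \<le> e' * (\<Sum>p\<in>D. measure lborel (snd p))"
        using \<open>e' > 0\<close> fin by (intro mult_left_mono sum_mono2) (auto simp: D2_def)
      also have "(\<Sum>p\<in>D. measure lborel (snd p)) = b - a"
        using additive_content_tagged_division[of D a b] D(1) \<open>a \<le> b\<close> by (simp add: split_def)
      finally have n2: "norm (\<Sum>p\<in>D2. ?t p) < e / 2" using e'' by simp
      have "norm (\<Sum>p\<in>D1. ?t p) \<le> (\<Sum>p\<in>D1. norm (x (Sup (snd p)) - x (Inf (snd p))))"
      proof (rule sum_norm_le)
        fix p assume "p \<in> D1"
        then have "g0 (fst p) = 0" by (auto simp: D1_def g0_def)
        then show "norm (?t p) \<le> norm (x (Sup (snd p)) - x (Inf (snd p)))"
          by (simp add: split_def norm_minus_commute)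
      qed
      also have "\<dots> < e / 2"
      proof (rule \<delta>[OF \<open>finite D1\<close>])
        show "\<forall>i\<in>D1. a \<le> Inf (snd i) \<and> Inf (snd i) \<le> Sup (snd i) \<and> Sup (snd i) \<le> b"
          using KD by (fastforce simp: D1_def)
        have int: "{Inf K<..<Sup K} = interior K" if tK: "(t,K) \<in> D" for t K
        proof -
          obtain u v where "K = {u..v}" "Sup K = v" "Inf K = u" using KD[OF tK] by blast
          then have "K = {Inf K..Sup K}" by simp
          then have "interior K = interior {Inf K..Sup K}" by simp
          then show ?thesis by simp
        qed
        show disj: "disjoint_family_on (\<lambda>i. {Inf (snd i)<..<Sup (snd i)}) D1"
          unfolding disjoint_family_on_def
        proof (intro ballI impI)
          fix p q assume pq: "p \<in> D1" "q \<in> D1" "p \<noteq> q"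
          then have "(fst p, snd p) \<in> D" "(fst q, snd q) \<in> D" by (auto simp: D1_def)
          from tagged_division_ofD(5)[OF D(1) this] int[OF this(1)] int[OF this(2)] pq(3)
          show "{Inf (snd p)<..<Sup (snd p)} \<inter> {Inf (snd q)<..<Sup (snd q)} = {}"
            by (metis prod.collapse)
        qed
        have "(\<Sum>i\<in>D1. Sup (snd i) - Inf (snd i)) = (\<Sum>i\<in>D1. measure lebesgue {Inf (snd i)<..<Sup (snd i)})"
        proof (rule sum.cong[OF refl])
          fix i assume "i \<in> D1"
          then have "(fst i, snd i) \<in> D" by (auto simp: D1_def)
          from KD[OF this] show "Sup (snd i) - Inf (snd i) = measure lebesgue {Inf (snd i)<..<Sup (snd i)}"
            by auto
        qed
        also have "\<dots> = measure lebesgue (\<Union>i\<in>D1. {Inf (snd i)<..<Sup (snd i)})"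
          using disj \<open>finite D1\<close> emeasure_bounded_finite[OF bounded_box]
          by (intro measure_finite_Union[symmetric]) (auto simp: less_top simp flip: box_real)
        also have "\<dots> \<le> measure lebesgue U"
        proof (rule measure_mono_fmeasurable)
          show "(\<Union>i\<in>D1. {Inf (snd i)<..<Sup (snd i)}) \<subseteq> U"
          proof (intro UN_least)
            fix i assume "i \<in> D1"
            then have i: "(fst i, snd i) \<in> D" "fst i \<in> N" by (auto simp: D1_def)
            from KD[OF i(1)] fineD[OF i(1)] i(2) show "{Inf (snd i)<..<Sup (snd i)} \<subseteq> U"
              by (auto simp: \<gamma>_def)
          qed
        qed (use Ulm \<open>finite D1\<close> in auto)
        finally show "(\<Sum>i\<in>D1. Sup (snd i) - Inf (snd i)) < \<delta>" using Ume by simp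
      qed
      finally have "norm (\<Sum>p\<in>D1. ?t p) < e / 2" .
      with n2 show ?thesis unfolding split
        using norm_triangle_lt[of "\<Sum>p\<in>D1. ?t p" "\<Sum>p\<in>D2. ?t p" e] by linarith
    qed
    show "\<exists>\<gamma>. gauge \<gamma> \<and> (\<forall>D. D tagged_division_of {a..b} \<and> \<gamma> fine D \<longrightarrow>
        norm ((\<Sum>(x, k)\<in>D. measure lborel k *\<^sub>R g0 x) - (x b - x a)) < e)"
      by (intro exI[of _ \<gamma>] conjI allI impI gauge fine) (erule conjE, assumption)+
  qed
  then show ?thesis
    by (rule has_integral_spike[OF negN, rotated]) (auto simp: g0_def)
qed

section \<open>Lipschitz functions and their almost everywhere derivatives\<close>

lemma absolutely_continuous_on_subinterval:
  assumes "absolutely_continuous_on_interval a b x" "a \<le> c" "d \<le> b"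
  shows "absolutely_continuous_on_interval c d x"
  unfolding absolutely_continuous_on_interval_def
proof (intro allI impI)
  fix e :: real assume "e > 0"
  then obtain \<delta> where "\<delta> > 0" and \<delta>: "\<And>(n::nat) \<alpha> \<beta>.
        (\<forall>i<n. a \<le> \<alpha> i \<and> \<alpha> i \<le> \<beta> i \<and> \<beta> i \<le> b) \<Longrightarrow>
        disjoint_family_on (\<lambda>i. {\<alpha> i<..<\<beta> i}) {..<n} \<Longrightarrow>
        (\<Sum>i<n. \<beta> i - \<alpha> i) < \<delta> \<Longrightarrow>
        (\<Sum>i<n. norm (x (\<beta> i) - x (\<alpha> i))) < e"
    using assms(1) unfolding absolutely_continuous_on_interval_def by meson
  show "\<exists>\<delta>>0. \<forall>(n::nat) \<alpha> \<beta>.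
        (\<forall>i<n. c \<le> \<alpha> i \<and> \<alpha> i \<le> \<beta> i \<and> \<beta> i \<le> d) \<longrightarrow>
        disjoint_family_on (\<lambda>i. {\<alpha> i<..<\<beta> i}) {..<n} \<longrightarrow>
        (\<Sum>i<n. \<beta> i - \<alpha> i) < \<delta> \<longrightarrow>
        (\<Sum>i<n. norm (x (\<beta> i) - x (\<alpha> i))) < e"
    by (intro exI[of _ \<delta>] conjI \<open>\<delta> > 0\<close> allI impI \<delta>)
      (use assms(2,3) in \<open>auto intro: order_trans\<close>)
qed

lemma lipschitz_imp_absolutely_continuous:
  fixes x :: "real \<Rightarrow> 'a::real_normed_vector"
  assumes "K-lipschitz_on {a..b} x"
  shows "absolutely_continuous_on_interval a b x"
  unfolding absolutely_continuous_on_interval_def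
proof (intro allI impI)
  fix e :: real assume "e > 0"
  have "K \<ge> 0" using assms by (rule lipschitz_on_nonneg)
  show "\<exists>\<delta>>0. \<forall>(n::nat) \<alpha> \<beta>.
        (\<forall>i<n. a \<le> \<alpha> i \<and> \<alpha> i \<le> \<beta> i \<and> \<beta> i \<le> b) \<longrightarrow>
        disjoint_family_on (\<lambda>i. {\<alpha> i<..<\<beta> i}) {..<n} \<longrightarrow>
        (\<Sum>i<n. \<beta> i - \<alpha> i) < \<delta> \<longrightarrow>
        (\<Sum>i<n. norm (x (\<beta> i) - x (\<alpha> i))) < e"
  proof (intro exI[of _ "e / (K+1)"] conjI allI impI)
    show "e / (K + 1) > 0" using \<open>e > 0\<close> \<open>K \<ge> 0\<close> by simp
    fix n :: nat and \<alpha> \<beta>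
    assume 1: "\<forall>i<n. a \<le> \<alpha> i \<and> \<alpha> i \<le> \<beta> i \<and> \<beta> i \<le> b" and 2: "(\<Sum>i<n. \<beta> i - \<alpha> i) < e / (K + 1)"
    have "(\<Sum>i<n. norm (x (\<beta> i) - x (\<alpha> i))) \<le> (\<Sum>i<n. (K+1) * (\<beta> i - \<alpha> i))"
    proof (rule sum_mono)
      fix i assume "i \<in> {..<n}"
      then have i: "a \<le> \<alpha> i" "\<alpha> i \<le> \<beta> i" "\<beta> i \<le> b" using 1 by auto
      have "norm (x (\<beta> i) - x (\<alpha> i)) \<le> K * norm (\<beta> i - \<alpha> i)"
        using i by (intro lipschitz_on_normD[OF assms]) auto
      also have "\<dots> \<le> (K+1) * (\<beta> i - \<alpha> i)" using i by (simp add: algebra_simps)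
      finally show "norm (x (\<beta> i) - x (\<alpha> i)) \<le> (K+1) * (\<beta> i - \<alpha> i)" .
    qed
    also have "\<dots> = (K+1) * (\<Sum>i<n. \<beta> i - \<alpha> i)" by (simp add: sum_distrib_left)
    also have "\<dots> < e" using 2 \<open>K \<ge> 0\<close> by (simp add: pos_less_divide_eq mult.commute)
    finally show "(\<Sum>i<n. norm (x (\<beta> i) - x (\<alpha> i))) < e" .
  qed
qed

lemma absolutely_continuous_imp_continuous_on:
  fixes x :: "real \<Rightarrow> 'a::real_normed_vector"
  assumes "absolutely_continuous_on_interval a b x"
  shows "continuous_on {a..b} x"
  unfolding continuous_on_iff
proof (intro ballI allI impI)
  fix t and e :: real assume t: "t \<in> {a..b}" and "e > 0"
  obtain \<delta> where "\<delta> > 0" and \<delta>: "\<And>S l u. finite S \<Longrightarrow> (\<forall>i\<in>S. a \<le> l i \<and> l i \<le> u i \<and> u i \<le> b) \<Longrightarrow>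
     disjoint_family_on (\<lambda>i. {l i<..<u i}) S \<Longrightarrow> (\<Sum>i\<in>S. u i - l i) < \<delta> \<Longrightarrow>
     (\<Sum>i\<in>(S::unit set). norm (x (u i) - x (l i))) < e"
    using absolutely_continuous_finite_family[OF assms \<open>e > 0\<close>, where ?'i = unit] by meson
  show "\<exists>d>0. \<forall>x'\<in>{a..b}. dist x' t < d \<longrightarrow> dist (x x') (x t) < e"
  proof (intro exI[of _ \<delta>] conjI ballI impI \<open>\<delta> > 0\<close>)
    fix s assume s: "s \<in> {a..b}" "dist s t < \<delta>"
    have "(\<Sum>i\<in>{()}. norm (x (max s t) - x (min s t))) < e"
      by (rule \<delta>) (use s t in \<open>auto simp: dist_real_def disjoint_family_on_def\<close>)
    then show "dist (x s) (x t) < e"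
      by (auto simp: dist_norm max_def min_def norm_minus_commute split: if_splits)
  qed
qed

text \<open>
  All integrands of the control problem are bounded, so every path and every accumulated cost is
  Lipschitz. Working with Lipschitz functions and a given almost everywhere derivative, instead of
  integrals, lets the product and chain rules replace measurability arguments.
\<close>

definition lipschitz_primitive :: "real \<Rightarrow> real \<Rightarrow> (real \<Rightarrow> 'a::real_normed_vector) \<Rightarrow> (real \<Rightarrow> 'a) \<Rightarrow> bool" where
  "lipschitz_primitive a b x g \<longleftrightarrow> (\<exists>K. K-lipschitz_on {a..b} x) \<and>
     (AE t in lebesgue. t \<in> {a<..<b} \<longrightarrow> (x has_vector_derivative g t) (at t))"

lemma lipschitz_primitiveD:
  assumes "lipschitz_primitive a b x g"
  shows "\<exists>K. K-lipschitz_on {a..b} x"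
    "AE t in lebesgue. t \<in> {a<..<b} \<longrightarrow> (x has_vector_derivative g t) (at t)"
    "absolutely_continuous_on_interval a b x" "continuous_on {a..b} x"
  using assms unfolding lipschitz_primitive_def
  by (auto intro: lipschitz_imp_absolutely_continuous lipschitz_on_continuous_on)

lemma lipschitz_primitive_has_integral:
  fixes x g :: "real \<Rightarrow> 'a::banach"
  assumes "lipschitz_primitive a b x g" "a \<le> b"
  shows "(g has_integral (x b - x a)) {a..b}"
  using absolutely_continuous_has_integral[OF assms(2) lipschitz_primitiveD(3,2)[OF assms(1)]] .

lemma lipschitz_primitive_subinterval:
  assumes "lipschitz_primitive a b x g" "a \<le> c" "d \<le> b"
  shows "lipschitz_primitive c d x g"
proof -
  have sub: "{c..d} \<subseteq> {a..b}" using assms(2,3) by auto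
  have "AE t in lebesgue. t \<in> {c<..<d} \<longrightarrow> (x has_vector_derivative g t) (at t)"
    using lipschitz_primitiveD(2)[OF assms(1)] by eventually_elim (use assms(2,3) in auto)
  then show ?thesis
    using lipschitz_primitiveD(1)[OF assms(1)] lipschitz_on_subset[OF _ sub]
    unfolding lipschitz_primitive_def by blast
qed

lemma lipschitz_primitive_cong:
  assumes "lipschitz_primitive a b x g" "AE t in lebesgue. t \<in> {a<..<b} \<longrightarrow> g t = g' t"
  shows "lipschitz_primitive a b x g'"
proof -
  have "AE t in lebesgue. t \<in> {a<..<b} \<longrightarrow> (x has_vector_derivative g' t) (at t)"
    using lipschitz_primitiveD(2)[OF assms(1)] assms(2) by eventually_elim auto
  then show ?thesis using assms(1) unfolding lipschitz_primitive_def by auto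
qed

lemma lipschitz_primitive_transform:
  assumes "lipschitz_primitive a b x g" "\<And>t. t \<in> {a..b} \<Longrightarrow> x' t = x t"
  shows "lipschitz_primitive a b x' g"
proof -
  have "AE t in lebesgue. t \<in> {a<..<b} \<longrightarrow> (x' has_vector_derivative g t) (at t)"
    using lipschitz_primitiveD(2)[OF assms(1)]
  proof eventually_elim
    case (elim t)
    show ?case
    proof
      assume t: "t \<in> {a<..<b}"
      show "(x' has_vector_derivative g t) (at t)"
        by (rule has_vector_derivative_transform_within_open[of x "g t" t "{a<..<b}"])
          (use elim t assms(2) in auto)
    qed
  qed
  moreover have "\<exists>K. K-lipschitz_on {a..b} x'"
    using lipschitz_primitiveD(1)[OF assms(1)] assms(2) by (metis lipschitz_on_transform)
  ultimately show ?thesis unfolding lipschitz_primitive_def by auto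
qed

lemma lipschitz_primitive_const: "lipschitz_primitive a b (\<lambda>t. c) (\<lambda>t. 0)"
  unfolding lipschitz_primitive_def by (auto intro!: exI[of _ 0] lipschitz_onI)

lemma lipschitz_primitive_add:
  assumes "lipschitz_primitive a b x g" "lipschitz_primitive a b y k"
  shows "lipschitz_primitive a b (\<lambda>t. x t + y t) (\<lambda>t. g t + k t)"
  unfolding lipschitz_primitive_def
proof
  show "\<exists>K. K-lipschitz_on {a..b} (\<lambda>t. x t + y t)"
    using lipschitz_primitiveD(1)[OF assms(1)] lipschitz_primitiveD(1)[OF assms(2)] by (blast intro: lipschitz_on_add)
  show "AE t in lebesgue. t \<in> {a<..<b} \<longrightarrow> ((\<lambda>t. x t + y t) has_vector_derivative g t + k t) (at t)"
    using lipschitz_primitiveD(2)[OF assms(1)] lipschitz_primitiveD(2)[OF assms(2)]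
    by eventually_elim (auto intro: has_vector_derivative_add)
qed

lemma lipschitz_primitive_bilinear:
  assumes bl: "bounded_bilinear pr" and x: "lipschitz_primitive a b x g" and y: "lipschitz_primitive a b y k"
  shows "lipschitz_primitive a b (\<lambda>t. pr (x t) (y t)) (\<lambda>t. pr (x t) (k t) + pr (g t) (y t))"
  unfolding lipschitz_primitive_def
proof
  interpret bounded_bilinear pr by (rule bl)
  obtain K1 K2 where K: "K1-lipschitz_on {a..b} x" "K2-lipschitz_on {a..b} y"
    using lipschitz_primitiveD(1) x y by metis
  have K0: "K1 \<ge> 0" "K2 \<ge> 0" using K by (auto dest: lipschitz_on_nonneg)
  have "bounded (x ` {a..b})" "bounded (y ` {a..b})"
    using lipschitz_primitiveD(4)[OF x] lipschitz_primitiveD(4)[OF y]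
    by (auto intro!: compact_imp_bounded compact_continuous_image)
  then obtain M1 M2 where M: "\<And>t. t \<in> {a..b} \<Longrightarrow> norm (x t) \<le> M1" "\<And>t. t \<in> {a..b} \<Longrightarrow> norm (y t) \<le> M2"
    by (metis bounded_iff imageI)
  obtain C where C: "C > 0" "\<And>u v. norm (pr u v) \<le> norm u * norm v * C" using pos_bounded by blast
  have "(C * (\<bar>M1\<bar> * K2 + \<bar>M2\<bar> * K1))-lipschitz_on {a..b} (\<lambda>t. pr (x t) (y t))"
  proof (rule lipschitz_onI)
    fix s t assume st: "s \<in> {a..b}" "t \<in> {a..b}"
    have "pr (x s) (y s) - pr (x t) (y t) = pr (x s) (y s - y t) + pr (x s - x t) (y t)"
      by (simp add: diff_left diff_right)
    then have "norm (pr (x s) (y s) - pr (x t) (y t)) \<le> norm (x s) * norm (y s - y t) * C + norm (x s - x t) * norm (y t) * C"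
      using norm_triangle_ineq[of "pr (x s) (y s - y t)" "pr (x s - x t) (y t)"]
        C(2)[of "x s" "y s - y t"] C(2)[of "x s - x t" "y t"] by (simp only: norm_triangle_mono)
    also have "\<dots> \<le> \<bar>M1\<bar> * (K2 * norm (s - t)) * C + (K1 * norm (s - t)) * \<bar>M2\<bar> * C"
    proof -
      have "norm (x s) \<le> \<bar>M1\<bar>" "norm (y t) \<le> \<bar>M2\<bar>"
        using M(1)[OF st(1)] M(2)[OF st(2)] by auto
      then show ?thesis
        using K0 C(1) lipschitz_on_normD[OF K(1) st] lipschitz_on_normD[OF K(2) st]
        by (intro add_mono mult_mono order_refl mult_nonneg_nonneg) auto
    qed
    finally show "dist (pr (x s) (y s)) (pr (x t) (y t)) \<le> C * (\<bar>M1\<bar> * K2 + \<bar>M2\<bar> * K1) * dist s t"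
      by (simp add: dist_norm algebra_simps)
  qed (use C K0 in auto)
  then show "\<exists>K. K-lipschitz_on {a..b} (\<lambda>t. pr (x t) (y t))" by blast
  show "AE t in lebesgue. t \<in> {a<..<b} \<longrightarrow>
      ((\<lambda>t. pr (x t) (y t)) has_vector_derivative pr (x t) (k t) + pr (g t) (y t)) (at t)"
    using lipschitz_primitiveD(2)[OF x] lipschitz_primitiveD(2)[OF y]
    by eventually_elim (auto intro: has_vector_derivative)
qed

lemmas lipschitz_primitive_inner = lipschitz_primitive_bilinear[OF bounded_bilinear_inner]
lemmas lipschitz_primitive_mult = lipschitz_primitive_bilinear[OF bounded_bilinear_mult]
lemmas lipschitz_primitive_scaleR = lipschitz_primitive_bilinear[OF bounded_bilinear_scaleR]

lemma lipschitz_primitive_cmult: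
  fixes x :: "real \<Rightarrow> real"
  assumes "lipschitz_primitive a b x g"
  shows "lipschitz_primitive a b (\<lambda>t. c * x t) (\<lambda>t. c * g t)"
  using lipschitz_primitive_mult[OF lipschitz_primitive_const[of a b c] assms] by simp

lemma lipschitz_primitive_cscaleR:
  assumes "lipschitz_primitive a b x g"
  shows "lipschitz_primitive a b (\<lambda>t. c *\<^sub>R x t) (\<lambda>t. c *\<^sub>R g t)"
  using lipschitz_primitive_scaleR[OF lipschitz_primitive_const[of a b c] assms] by simp

lemma lipschitz_primitive_diff:
  assumes "lipschitz_primitive a b x g" "lipschitz_primitive a b y k"
  shows "lipschitz_primitive a b (\<lambda>t. x t - y t) (\<lambda>t. g t - k t)"
  using lipschitz_primitive_add[OF assms(1) lipschitz_primitive_cscaleR[OF assms(2), of "-1"]] by simp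

lemma lipschitz_primitive_inner_const:
  assumes "lipschitz_primitive a b x g"
  shows "lipschitz_primitive a b (\<lambda>t. x t \<bullet> z) (\<lambda>t. g t \<bullet> z)"
  using lipschitz_primitive_inner[OF assms lipschitz_primitive_const[of a b z]] by simp

lemma lipschitz_primitive_norm_sq:
  assumes "lipschitz_primitive a b x g"
  shows "lipschitz_primitive a b (\<lambda>t. (norm (x t))\<^sup>2) (\<lambda>t. 2 * (x t \<bullet> g t))"
proof -
  have "x t \<bullet> g t + g t \<bullet> x t = 2 * (x t \<bullet> g t)" for t by (simp add: inner_commute)
  then show ?thesis
    using lipschitz_primitive_inner[OF assms assms] by (simp add: dot_square_norm)
qed

lemma lipschitz_primitive_exp:
  fixes x :: "real \<Rightarrow> real"
  assumes "lipschitz_primitive a b x g"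
  shows "lipschitz_primitive a b (\<lambda>t. exp (x t)) (\<lambda>t. exp (x t) * g t)"
  unfolding lipschitz_primitive_def
proof
  obtain K where K: "K-lipschitz_on {a..b} x" using lipschitz_primitiveD(1)[OF assms] by blast
  have "bounded (x ` {a..b})"
    using lipschitz_primitiveD(4)[OF assms] by (auto intro!: compact_imp_bounded compact_continuous_image)
  then obtain M where "\<forall>y\<in>x ` {a..b}. norm y \<le> M" by (auto simp: bounded_iff)
  then have M: "x ` {a..b} \<subseteq> {-M..M}" by (force simp: abs_le_iff)
  have "(exp M)-lipschitz_on {-M..M} (exp :: real \<Rightarrow> real)"
  proof (rule lipschitz_on_leI)
    fix u v assume uv: "u \<in> {-M..M}" "v \<in> {-M..M}" "u \<le> v"
    have "exp v - exp u = exp v * (1 - exp (u - v))" by (simp add: exp_diff right_diff_distrib)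
    also have "\<dots> \<le> exp M * (v - u)"
    proof (rule mult_mono)
      show "1 - exp (u - v) \<le> v - u" using exp_ge_add_one_self[of "u - v"] by linarith
    qed (use uv in auto)
    finally show "dist (exp u) (exp v) \<le> exp M * dist u v" using uv by (simp add: dist_real_def)
  qed simp
  then have "(exp M)-lipschitz_on (x ` {a..b}) (exp :: real \<Rightarrow> real)" using M by (rule lipschitz_on_subset)
  from lipschitz_on_compose2[OF K this] show "\<exists>K. K-lipschitz_on {a..b} (\<lambda>t. exp (x t))" by blast
  show "AE t in lebesgue. t \<in> {a<..<b} \<longrightarrow> ((\<lambda>t. exp (x t)) has_vector_derivative exp (x t) * g t) (at t)"
    using lipschitz_primitiveD(2)[OF assms]
    by eventually_elim
      (auto simp: has_real_derivative_iff_has_vector_derivative[symmetric] intro!: derivative_eq_intros)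
qed

lemma lipschitz_primitive_linear: "lipschitz_primitive a b (\<lambda>t. c * (t - d)) (\<lambda>t. c)" for c :: real
proof -
  have "lipschitz_primitive a b (\<lambda>t. t - d) (\<lambda>t. 1)"
    unfolding lipschitz_primitive_def
    by (auto intro!: exI[of _ 1] lipschitz_onI derivative_eq_intros AE_I2 simp: dist_real_def)
  from lipschitz_primitive_cmult[OF this, of c] show ?thesis by simp
qed

text \<open>
  The comparison principle behind the estimates along paths; by the fundamental theorem of
  calculus it is the nonnegativity of an integral.
\<close>

lemma lipschitz_primitive_mono:
  fixes x :: "real \<Rightarrow> real"
  assumes x: "lipschitz_primitive a b x g" and "a \<le> b"
    and nonneg: "AE t in lebesgue. t \<in> {a<..<b} \<longrightarrow> g t \<ge> 0"
  shows "x a \<le> x b"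
proof -
  define N where "N = {t. \<not> (t \<in> {a<..<b} \<longrightarrow> g t \<ge> 0)} \<union> {a,b}"
  have negN: "negligible N"
    using nonneg unfolding N_def AE_lebesgue_iff_negligible by (intro negligible_Un) auto
  have "((\<lambda>t. if t \<in> N then 0 else g t) has_integral (x b - x a)) {a..b}"
    by (rule has_integral_spike[OF negN _ lipschitz_primitive_has_integral[OF x \<open>a \<le> b\<close>]]) auto
  then have "0 \<le> x b - x a"
    by (rule has_integral_nonneg) (auto simp: N_def not_le)
  then show ?thesis by simp
qed

lemma lipschitz_primitive_le:
  fixes x y :: "real \<Rightarrow> real"
  assumes "lipschitz_primitive a b x g" "lipschitz_primitive a b y k" "a \<le> b"
    and "AE t in lebesgue. t \<in> {a<..<b} \<longrightarrow> g t \<le> k t"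
  shows "x b - x a \<le> y b - y a"
proof -
  have "AE t in lebesgue. t \<in> {a<..<b} \<longrightarrow> k t - g t \<ge> 0"
    using assms(4) by eventually_elim auto
  from lipschitz_primitive_mono[OF lipschitz_primitive_diff[OF assms(2,1)] assms(3) this]
  show ?thesis by simp
qed

text \<open>
  Reduced to the scalar case by testing \<open>x\<close> against the direction \<open>x b - x a\<close>.
\<close>

lemma lipschitz_primitive_norm_le:
  fixes x :: "real \<Rightarrow> 'a::real_inner" and G :: "real \<Rightarrow> real"
  assumes x: "lipschitz_primitive a b x g" and G: "lipschitz_primitive a b G k" and "a \<le> b"
    and le: "AE t in lebesgue. t \<in> {a<..<b} \<longrightarrow> norm (g t) \<le> k t"
  shows "norm (x b - x a) \<le> G b - G a"
proof (cases "x b = x a")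
  case True
  have "AE t in lebesgue. t \<in> {a<..<b} \<longrightarrow> 0 \<le> k t"
    using le by eventually_elim (auto intro: order_trans[OF norm_ge_zero])
  from lipschitz_primitive_mono[OF G \<open>a \<le> b\<close> this] True show ?thesis by simp
next
  case False
  define e where "e = x b - x a"
  have "AE t in lebesgue. t \<in> {a<..<b} \<longrightarrow> g t \<bullet> e \<le> norm e * k t"
    using le
  proof eventually_elim
    case (elim t)
    have "g t \<bullet> e \<le> norm (g t) * norm e" by (rule norm_cauchy_schwarz)
    moreover have "norm (g t) * norm e \<le> norm e * k t" if "t \<in> {a<..<b}"
      using elim that by (auto simp: mult.commute[of "norm e"] intro: mult_right_mono)
    ultimately show ?case by (auto intro: order_trans)
  qed
  from lipschitz_primitive_le[OF lipschitz_primitive_inner_const[OF x] lipschitz_primitive_cmult[OF G] \<open>a \<le> b\<close> this]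
  have "e \<bullet> e \<le> norm e * (G b - G a)"
    by (simp add: e_def inner_diff_left right_diff_distrib)
  then have "norm e * norm e \<le> norm e * (G b - G a)"
    by (simp add: dot_square_norm power2_eq_square)
  then show ?thesis using False by (simp add: e_def)
qed

lemma bounded_derivative_imp_lipschitz_on:
  fixes x g :: "real \<Rightarrow> 'a::banach"
  assumes ac: "absolutely_continuous_on_interval a b x" and "M \<ge> 0"
    and deriv: "AE t in lebesgue. t \<in> {a<..<b} \<longrightarrow> (x has_vector_derivative g t) (at t)"
    and bd: "AE t in lebesgue. t \<in> {a<..<b} \<longrightarrow> norm (g t) \<le> M"
  shows "M-lipschitz_on {a..b} x"
proof (rule lipschitz_on_leI)
  fix c d assume cd: "c \<in> {a..b}" "d \<in> {a..b}" "c \<le> d"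
  define N where "N = {t. \<not> (t \<in> {a<..<b} \<longrightarrow> norm (g t) \<le> M)} \<union> {a,b}"
  have negN: "negligible N"
    using bd unfolding N_def AE_lebesgue_iff_negligible by (intro negligible_Un) auto
  have "(g has_integral (x d - x c)) {c..d}"
    by (rule absolutely_continuous_has_integral[OF cd(3) absolutely_continuous_on_subinterval[OF ac]])
      (use cd deriv in \<open>auto elim!: eventually_mono\<close>)
  then have "((\<lambda>t. if t \<in> N then 0 else g t) has_integral (x d - x c)) {c..d}"
    by (rule has_integral_spike[OF negN, rotated]) auto
  then have "norm (x d - x c) \<le> M * measure lborel {c..d}"
    by (rule has_integral_bound_real[OF \<open>M \<ge> 0\<close> finite.emptyI]) (use cd \<open>M \<ge> 0\<close> in \<open>auto simp: N_def\<close>)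
  then show "dist (x c) (x d) \<le> M * dist c d"
    using cd by (simp add: dist_norm norm_minus_commute)
qed (rule \<open>M \<ge> 0\<close>)

section \<open>Lebesgue differentiation of indefinite integrals\<close>

text \<open>
  Almost everywhere convergence of the averages over \<open>[x, x + h]\<close> with \<open>h > 0\<close> gives the
  derivative from the right; applied to the reflected function it gives the derivative from the left.
\<close>

theorem AE_has_vector_derivative_integral:
  fixes g :: "real \<Rightarrow> 'a::euclidean_space"
  assumes int: "g integrable_on {a..b}"
  shows "AE t in lebesgue. t \<in> {a<..<b} \<longrightarrow> ((\<lambda>t. integral {a..t} g) has_vector_derivative g t) (at t)"
proof -
  \<comment> \<open>extension by \<open>0\<close>, since the averages are formed over intervals anywhere on the line\<close>
  define G where "G t = (if t \<in> {a..b} then g t else 0)" for t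
  have Gint: "G integrable_on cbox c d" for c d
  proof -
    have "G integrable_on UNIV"
      using int integrable_restrict_UNIV[of "{a..b}" g] unfolding G_def by simp
    then show ?thesis by (rule integrable_on_subcbox) auto
  qed
  have G'int: "(\<lambda>t. G (-t)) integrable_on cbox c d" for c d
    using Gint[of "-d" "-c"] integrable_reflect[of G "-c" "-d"] by simp
  obtain N1 where N1: "negligible N1"
    "\<And>x e. x \<notin> N1 \<Longrightarrow> 0 < e \<Longrightarrow> \<exists>d>0. \<forall>h. 0 < h \<and> h < d \<longrightarrow>
        norm (integral (cbox x (x + h *\<^sub>R One)) G /\<^sub>R h ^ DIM(real) - G x) < e"
    using integrable_ccontinuous_explicit[of G, OF Gint] by metis
  obtain N2 where N2: "negligible N2"
    "\<And>x e. x \<notin> N2 \<Longrightarrow> 0 < e \<Longrightarrow> \<exists>d>0. \<forall>h. 0 < h \<and> h < d \<longrightarrow>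
        norm (integral (cbox x (x + h *\<^sub>R One)) (\<lambda>t. G (-t)) /\<^sub>R h ^ DIM(real) - G (-x)) < e"
    using integrable_ccontinuous_explicit[of "\<lambda>t. G (-t)", OF G'int] by metis
  have neg: "negligible (N1 \<union> uminus ` N2)"
    using N1(1) N2(1)
    by (intro negligible_Un negligible_differentiable_image_negligible)
      (auto intro!: differentiable_on_minus differentiable_on_ident)
  have "((\<lambda>t. integral {a..t} g) has_vector_derivative g t) (at t)"
    if t: "t \<in> {a<..<b}" "t \<notin> N1 \<union> uminus ` N2" for t
    unfolding has_vector_derivative_def has_derivative_at_alt
  proof (intro conjI allI impI)
    show "bounded_linear (\<lambda>h. h *\<^sub>R g t)" by (rule bounded_linear_scaleR_left)
    fix e :: real assume "e > 0"
    have Gt: "G t = g t" using t by (simp add: G_def)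
    have tN2: "- t \<notin> N2" using t(2) by force
    obtain d1 where d1: "d1 > 0" "\<And>h. 0 < h \<Longrightarrow> h < d1 \<Longrightarrow> norm (integral {t..t + h} G /\<^sub>R h - g t) < e"
      using N1(2)[of t e] t(2) \<open>e > 0\<close> Gt by auto
    obtain d2 where d2: "d2 > 0" "\<And>h. 0 < h \<Longrightarrow> h < d2 \<Longrightarrow> norm (integral {-t..-t + h} (\<lambda>t. G (-t)) /\<^sub>R h - g t) < e"
      using N2(2)[OF tN2 \<open>e > 0\<close>] Gt by auto
    define d where "d = Min {d1, d2, t - a, b - t}"
    have d: "d > 0" "d \<le> d1" "d \<le> d2" "d \<le> t - a" "d \<le> b - t"
      using d1(1) d2(1) t(1) by (auto simp: d_def)
    have key: "norm (integral {c..c+h} g - h *\<^sub>R g t) \<le> e * h"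
      if h: "0 < h" "h < d" and c: "c = t \<or> c = t - h" for c h
    proof -
      have sub: "{c..c+h} \<subseteq> {a..b}" using h c d by auto
      have eq: "integral {c..c+h} g = integral {c..c+h} G"
        by (rule integral_cong) (use sub in \<open>auto simp: G_def\<close>)
      have "norm (integral {c..c+h} G /\<^sub>R h - g t) < e"
      proof (cases "c = t")
        case True then show ?thesis using d1(2)[of h] h d by simp
      next
        case False
        then have c: "c = t - h" using c by simp
        have "integral {-t..-t + h} (\<lambda>t. G (-t)) = integral {c..c+h} G"
          using Henstock_Kurzweil_Integration.integral_reflect_real[of "t" "c" G] c by simp
        then show ?thesis using d2(2)[of h] h d by simp
      qed
      then have "h * norm (integral {c..c+h} G /\<^sub>R h - g t) \<le> h * e"
        using h by (intro mult_left_mono) auto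
      moreover have "h * norm (integral {c..c+h} G /\<^sub>R h - g t) = norm (h *\<^sub>R (integral {c..c+h} G /\<^sub>R h - g t))"
        using h by simp
      moreover have "h *\<^sub>R (integral {c..c+h} G /\<^sub>R h - g t) = integral {c..c+h} G - h *\<^sub>R g t"
        using h by (simp add: scaleR_diff_right)
      ultimately show ?thesis by (simp add: eq mult.commute)
    qed
    show "\<exists>d>0. \<forall>y. norm (y - t) < d \<longrightarrow>
        norm (integral {a..y} g - integral {a..t} g - (y - t) *\<^sub>R g t) \<le> e * norm (y - t)"
    proof (intro exI[of _ d] conjI allI impI d(1))
      fix y assume y: "norm (y - t) < d"
      then have yd: "\<bar>y - t\<bar> < d" by simp
      consider "y = t" | "t < y" | "y < t" by linarith
      then show "norm (integral {a..y} g - integral {a..t} g - (y - t) *\<^sub>R g t) \<le> e * norm (y - t)"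
      proof cases
        case 1 then show ?thesis by simp
      next
        case 2
        have "g integrable_on {a..y}" by (rule integrable_subinterval_real[OF int]) (use yd d in auto)
        then have "integral {a..t} g + integral {t..y} g = integral {a..y} g"
          by (intro Henstock_Kurzweil_Integration.integral_combine) (use 2 t in auto)
        then have "integral {a..y} g - integral {a..t} g = integral {t..y} g" by (simp add: algebra_simps)
        then show ?thesis using key[of "y - t" t] 2 yd by simp
      next
        case 3
        have "g integrable_on {a..t}" by (rule integrable_subinterval_real[OF int]) (use t in auto)
        then have "integral {a..y} g + integral {y..t} g = integral {a..t} g"
          by (intro Henstock_Kurzweil_Integration.integral_combine) (use 3 yd d in auto)
        then have "integral {a..y} g - integral {a..t} g - (y - t) *\<^sub>R g t = - (integral {y..t} g - (t - y) *\<^sub>R g t)"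
          by (simp add: algebra_simps)
        then have "norm (integral {a..y} g - integral {a..t} g - (y - t) *\<^sub>R g t) = norm (integral {y..t} g - (t - y) *\<^sub>R g t)"
          by (simp only: norm_minus_cancel)
        then show ?thesis using key[of "t - y" y] 3 yd by simp
      qed
    qed
  qed
  then have "{t. \<not> (t \<in> {a<..<b} \<longrightarrow> ((\<lambda>t. integral {a..t} g) has_vector_derivative g t) (at t))} \<subseteq> N1 \<union> uminus ` N2"
    by blast
  with neg show ?thesis unfolding AE_lebesgue_iff_negligible by (rule negligible_subset)
qed

lemma lipschitz_primitive_integral:
  fixes g :: "real \<Rightarrow> 'a::euclidean_space"
  assumes int: "set_integrable lebesgue {a..b} g"
    and bd: "AE t in lebesgue. t \<in> {a<..<b} \<longrightarrow> norm (g t) \<le> M" and "M \<ge> 0"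
  shows "lipschitz_primitive a b (\<lambda>t. LINT r:{a..t}|lebesgue. g r) g"
proof -
  have io: "g integrable_on {a..b}" using set_lebesgue_integral_eq_integral(1)[OF int] .
  define N where "N = {t. \<not> (t \<in> {a<..<b} \<longrightarrow> norm (g t) \<le> M)} \<union> {a,b}"
  have negN: "negligible N"
    using bd unfolding N_def AE_lebesgue_iff_negligible by (intro negligible_Un) auto
  have "M-lipschitz_on {a..b} (\<lambda>t. integral {a..t} g)"
  proof (rule lipschitz_on_leI[OF _ \<open>M \<ge> 0\<close>])
    fix c d assume cd: "c \<in> {a..b}" "d \<in> {a..b}" "c \<le> d"
    have "g integrable_on {a..d}" by (rule integrable_subinterval_real[OF io]) (use cd in auto)
    then have eq: "integral {a..c} g + integral {c..d} g = integral {a..d} g"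
      by (intro Henstock_Kurzweil_Integration.integral_combine) (use cd in auto)
    have "g integrable_on {c..d}" by (rule integrable_subinterval_real[OF io]) (use cd in auto)
    then have "((\<lambda>t. if t \<in> N then 0 else g t) has_integral integral {c..d} g) {c..d}"
      by (intro has_integral_spike[OF negN _ integrable_integral]) auto
    then have "norm (integral {c..d} g) \<le> M * measure lborel {c..d}"
      by (rule has_integral_bound_real[OF \<open>M \<ge> 0\<close> finite.emptyI]) (use cd \<open>M \<ge> 0\<close> in \<open>auto simp: N_def\<close>)
    moreover have "dist (integral {a..c} g) (integral {a..d} g) = norm (integral {c..d} g)"
      unfolding eq[symmetric] by (simp add: dist_norm)
    ultimately show "dist (integral {a..c} g) (integral {a..d} g) \<le> M * dist c d"
      using cd by (simp add: dist_real_def)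
  qed
  with AE_has_vector_derivative_integral[OF io]
  have lp: "lipschitz_primitive a b (\<lambda>t. integral {a..t} g) g" unfolding lipschitz_primitive_def by blast
  show ?thesis
  proof (rule lipschitz_primitive_transform[OF lp])
    fix t assume "t \<in> {a..b}"
    then have "set_integrable lebesgue {a..t} g" by (intro set_integrable_subset[OF int]) auto
    then show "(LINT r:{a..t}|lebesgue. g r) = integral {a..t} g" by (rule set_lebesgue_integral_eq_integral(2))
  qed
qed

lemma set_integrable_bounded:
  fixes g :: "real \<Rightarrow> 'a::euclidean_space"
  assumes g: "g \<in> borel_measurable (lebesgue_on {a..b})"
    and bd: "AE t in lebesgue. t \<in> {a<..<b} \<longrightarrow> norm (g t) \<le> M"
  shows "set_integrable lebesgue {a..b} g"
  unfolding set_integrable_def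
proof (rule Bochner_Integration.integrable_bound)
  show "integrable lebesgue (\<lambda>t. indicator {a..b} t * \<bar>M\<bar>)"
    by (intro integrable_mult_left integrable_real_indicator) (auto simp: emeasure_lborel_Icc_eq)
  have "(\<lambda>t. if t \<in> {a..b} then g t else 0) \<in> borel_measurable lebesgue"
    using g by (intro borel_measurable_if_I) auto
  then show "(\<lambda>t. indicator {a..b} t *\<^sub>R g t) \<in> borel_measurable lebesgue"
    by (rule measurable_cong[THEN iffD1, rotated]) auto
  have "AE t in lebesgue. t \<noteq> a \<and> t \<noteq> b"
    unfolding AE_lebesgue_iff_negligible by (rule negligible_subset[of "{a,b}"]) auto
  with bd show "AE t in lebesgue. norm (indicator {a..b} t *\<^sub>R g t) \<le> norm (indicator {a..b} t * \<bar>M\<bar>)"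
    by eventually_elim (auto simp: indicator_def)
qed

text \<open>
  Only difference quotients from the left enter. This matters for limits of paths, whose speed
  is bounded in terms of the past of the path.
\<close>

lemma has_vector_derivative_norm_le_left:
  assumes der: "(x has_vector_derivative g) (at t)" and "s < t"
    and le: "\<And>r. r \<in> {s..t} \<Longrightarrow> norm (x r - x t) \<le> K * norm (r - t)"
  shows "norm g \<le> K"
proof (rule field_le_epsilon)
  fix e :: real assume "e > 0"
  have "(x has_derivative (\<lambda>h. h *\<^sub>R g)) (at t)" using der by (simp add: has_vector_derivative_def)
  then obtain d where "d > 0" and d: "\<And>y. norm (y - t) < d \<Longrightarrow> norm (x y - x t - (y - t) *\<^sub>R g) \<le> e * norm (y - t)"
    using \<open>e > 0\<close> unfolding has_derivative_at_alt by meson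
  define h where "h = min (d/2) (t - s)"
  have h: "h > 0" "h < d" "s \<le> t - h" using \<open>d > 0\<close> \<open>s < t\<close> by (auto simp: h_def)
  have "(- h) *\<^sub>R g = (x (t-h) - x t) - (x (t-h) - x t - (t - h - t) *\<^sub>R g)" by simp
  then have "norm ((- h) *\<^sub>R g) \<le> norm (x (t-h) - x t) + norm (x (t-h) - x t - (t - h - t) *\<^sub>R g)"
    by (metis norm_triangle_ineq4)
  also have "\<dots> \<le> K * norm (t - h - t) + e * norm (t - h - t)"
    using h by (intro add_mono d le) auto
  finally have "h * norm g \<le> h * (K + e)" using h by (simp add: algebra_simps)
  then show "norm g \<le> K + e" using h by simp
qed

lemma lipschitz_primitive_derivative_bound:
  assumes x: "lipschitz_primitive a b x g" and K: "K-lipschitz_on {a..b} x"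
  shows "AE t in lebesgue. t \<in> {a<..<b} \<longrightarrow> norm (g t) \<le> K"
  using lipschitz_primitiveD(2)[OF x]
proof eventually_elim
  case (elim t)
  show ?case
  proof
    assume t: "t \<in> {a<..<b}"
    show "norm (g t) \<le> K"
    proof (rule has_vector_derivative_norm_le_left[of x _ t a])
      show "norm (x r - x t) \<le> K * norm (r - t)" if "r \<in> {a..t}" for r
        using that t by (intro lipschitz_on_normD[OF K]) auto
    qed (use elim t in auto)
  qed
qed

lemma lipschitz_primitive_set_integrable:
  fixes x g :: "real \<Rightarrow> 'a::euclidean_space"
  assumes x: "lipschitz_primitive a b x g" and "a \<le> b"
  shows "set_integrable lebesgue {a..b} g" "(LINT r:{a..b}|lebesgue. g r) = x b - x a"
proof -
  obtain K where K: "K-lipschitz_on {a..b} x" using lipschitz_primitiveD(1)[OF x] by blast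
  have hi: "(g has_integral (x b - x a)) {a..b}" by (rule lipschitz_primitive_has_integral[OF x \<open>a \<le> b\<close>])
  show si: "set_integrable lebesgue {a..b} g"
    using hi lipschitz_primitive_derivative_bound[OF x K]
    by (intro set_integrable_bounded integrable_imp_measurable) (auto simp: integrable_on_def)
  show "(LINT r:{a..b}|lebesgue. g r) = x b - x a"
    using set_lebesgue_integral_eq_integral(2)[OF si] hi by (simp add: integral_unique)
qed

section \<open>Almost everywhere differentiability of Lipschitz functions\<close>

text \<open>
  For a \<open>K\<close>-Lipschitz \<open>x\<close>, both \<open>K t + x(t)\<close> and \<open>K t - x(t)\<close> are nondecreasing and their sum
  is linear; with the argument frozen outside \<open>[a, b]\<close> they are functions \<open>F1\<close>, \<open>F2\<close> as below. On
  half-open intervals the two Stieltjes measures therefore add up to a multiple of Lebesgue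
  measure, and a Dynkin argument extends this to all Borel sets. In particular each of them
  is absolutely continuous.
\<close>

lemma interval_measures_sum:
  fixes F1 F2 :: "real \<Rightarrow> real"
  assumes mono: "mono F1" "mono F2" and cont: "continuous_on UNIV F1" "continuous_on UNIV F2"
    and "a \<le> b" "K \<ge> 0"
    and sum: "\<And>t. F1 t + F2 t = K * max a (min b t)"
    and B: "B \<in> sets borel"
  shows "emeasure (interval_measure F1) B + emeasure (interval_measure F2) B
     = K * emeasure lborel (B \<inter> {a<..b})"
proof -
  have em: "emeasure (interval_measure F1) {c<..d} = F1 d - F1 c"
      "emeasure (interval_measure F2) {c<..d} = F2 d - F2 c" if "c \<le> d" for c d
  proof -
    have right: "continuous (at_right t) F1" "continuous (at_right t) F2" for t
      using cont by (auto simp: continuous_on_eq_continuous_at intro: continuous_at_imp_continuous_within)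
    show "emeasure (interval_measure F1) {c<..d} = F1 d - F1 c"
      by (rule emeasure_interval_measure_Ioc[OF that monoD[OF mono(1)] right(1)])
    show "emeasure (interval_measure F2) {c<..d} = F2 d - F2 c"
      by (rule emeasure_interval_measure_Ioc[OF that monoD[OF mono(2)] right(2)])
  qed
  let ?P = "\<lambda>B. emeasure (interval_measure F1) B + emeasure (interval_measure F2) B = K * emeasure lborel (B \<inter> {a<..b})"
  have basic: "?P {c<..d}" for c d
  proof (cases "c \<le> d")
    case True
    have "F1 c \<le> F1 d" "F2 c \<le> F2 d" using True mono by (auto intro: monoD)
    then have "emeasure (interval_measure F1) {c<..d} + emeasure (interval_measure F2) {c<..d}
       = ennreal ((F1 d + F2 d) - (F1 c + F2 c))"
      using True by (simp add: em ennreal_plus[symmetric] del: ennreal_plus)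
    also have "(F1 d + F2 d) - (F1 c + F2 c) = K * (max a (min b d) - max a (min b c))"
      by (simp add: sum right_diff_distrib)
    also have "{c<..d} \<inter> {a<..b} = {max a (min b c)<..max a (min b d)}"
      using True \<open>a \<le> b\<close> by (auto simp: max_def min_def)
    moreover have "max a (min b c) \<le> max a (min b d)" using True by auto
    ultimately show ?thesis
      using \<open>K \<ge> 0\<close> by (simp add: ennreal_mult)
  qed auto
  have univ: "?P UNIV"
  proof -
    have U: "(\<Union>n::nat. {-real n<..real n}) = UNIV"
    proof -
      have "\<exists>n::nat. - real n < x \<and> x \<le> real n" for x :: real
      proof -
        obtain n :: nat where "\<bar>x\<bar> < n" using reals_Archimedean2 by blast
        then show ?thesis by (intro exI[of _ n]) auto
      qed
      then show ?thesis by auto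
    qed
    have inc: "incseq (\<lambda>n::nat. {-real n<..real n})" by (auto simp: incseq_def)
    have "(\<lambda>n. emeasure (interval_measure F1) {-real n<..real n}) \<longlonglongrightarrow> emeasure (interval_measure F1) UNIV"
      "(\<lambda>n. emeasure (interval_measure F2) {-real n<..real n}) \<longlonglongrightarrow> emeasure (interval_measure F2) UNIV"
      using Lim_emeasure_incseq[OF _ inc, of "interval_measure F1"] Lim_emeasure_incseq[OF _ inc, of "interval_measure F2"]
      unfolding U by (simp_all add: image_subset_iff)
    then have l1: "(\<lambda>n. emeasure (interval_measure F1) {-real n<..real n} + emeasure (interval_measure F2) {-real n<..real n})
      \<longlonglongrightarrow> emeasure (interval_measure F1) UNIV + emeasure (interval_measure F2) UNIV"
      by (intro tendsto_add) auto
    obtain m :: nat where m: "\<bar>a\<bar> + \<bar>b\<bar> < m" using reals_Archimedean2 by blast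
    have "eventually (\<lambda>n. emeasure (interval_measure F1) {-real n<..real n} + emeasure (interval_measure F2) {-real n<..real n}
       = K * emeasure lborel (UNIV \<inter> {a<..b})) sequentially"
      using eventually_ge_at_top[of m]
    proof eventually_elim
      case (elim n)
      then have "{-real n<..real n} \<inter> {a<..b} = UNIV \<inter> {a<..b}" using m by auto
      then show ?case using basic[of "-real n" "real n"] by simp
    qed
    then have "(\<lambda>n. emeasure (interval_measure F1) {-real n<..real n} + emeasure (interval_measure F2) {-real n<..real n})
      \<longlonglongrightarrow> K * emeasure lborel (UNIV \<inter> {a<..b})"
      by (rule tendsto_eventually)
    from LIMSEQ_unique[OF l1 this] show ?thesis .
  qed
  have fin: "K * emeasure lborel (A \<inter> {a<..b}) < top" for A
  proof -
    have "emeasure lborel (A \<inter> {a<..b}) < top"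
      by (rule emeasure_bounded_finite[unfolded infinity_ennreal_def]) (auto intro: bounded_subset[of "{a..b}"])
    then show ?thesis by (simp add: ennreal_mult_less_top)
  qed
  have Bs: "B \<in> sigma_sets UNIV (range (\<lambda>(a, b). {a <.. b::real}))"
    using B by (subst (asm) borel_sigma_sets_Ioc) (simp add: sets_measure_of)
  have "Int_stable (range (\<lambda>(a, b). {a <.. b::real}))"
  proof (rule Int_stableI)
    fix A B :: "real set" assume "A \<in> range (\<lambda>(a, b). {a <.. b})" "B \<in> range (\<lambda>(a, b). {a <.. b})"
    then obtain c d c' d' where "A = {c<..d}" "B = {c'<..d'}" by auto
    then have "A \<inter> B = (\<lambda>(a, b). {a <.. b}) (max c c', min d d')" by auto
    then show "A \<inter> B \<in> range (\<lambda>(a, b). {a <.. b})" by (rule range_eqI)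
  qed
  moreover have "range (\<lambda>(a, b). {a <.. b::real}) \<subseteq> Pow UNIV" by simp
  ultimately show ?thesis using Bs
  proof (induction rule: sigma_sets_induct_disjoint)
    case (compl A)
    have A: "A \<in> sets borel" using compl(1) by (subst borel_sigma_sets_Ioc) (simp add: sets_measure_of)
    let ?m1 = "interval_measure F1" and ?m2 = "interval_measure F2"
    have f: "emeasure ?m1 UNIV + emeasure ?m2 UNIV < top" unfolding univ by (rule fin)
    then have f12: "emeasure ?m1 A \<noteq> top" "emeasure ?m2 A \<noteq> top"
      using emeasure_space[of ?m1 A] emeasure_space[of ?m2 A]
      by (auto simp: ennreal_add_eq_top less_top top_unique)
    have add: "emeasure ?m1 A + emeasure ?m1 (UNIV - A) = emeasure ?m1 UNIV"
       "emeasure ?m2 A + emeasure ?m2 (UNIV - A) = emeasure ?m2 UNIV"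
       "emeasure lborel (A \<inter> {a<..b}) + emeasure lborel ((UNIV - A) \<inter> {a<..b}) = emeasure lborel (UNIV \<inter> {a<..b})"
    proof -
      show "emeasure ?m1 A + emeasure ?m1 (UNIV - A) = emeasure ?m1 UNIV"
        "emeasure ?m2 A + emeasure ?m2 (UNIV - A) = emeasure ?m2 UNIV"
        using A by (simp_all add: plus_emeasure)
      have "(A \<inter> {a<..b}) \<union> ((UNIV - A) \<inter> {a<..b}) = UNIV \<inter> {a<..b}" by auto
      then show "emeasure lborel (A \<inter> {a<..b}) + emeasure lborel ((UNIV - A) \<inter> {a<..b}) = emeasure lborel (UNIV \<inter> {a<..b})"
        using A by (subst plus_emeasure) auto
    qed
    have "(emeasure ?m1 A + emeasure ?m2 A) + (emeasure ?m1 (UNIV - A) + emeasure ?m2 (UNIV - A))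
      = emeasure ?m1 UNIV + emeasure ?m2 UNIV"
      unfolding add[symmetric] by (simp add: algebra_simps)
    also have "\<dots> = K * emeasure lborel (A \<inter> {a<..b}) + K * emeasure lborel ((UNIV - A) \<inter> {a<..b})"
      unfolding univ add(3)[symmetric] by (simp add: distrib_left)
    finally show ?case unfolding compl(2) using fin[of A] by (auto simp: ennreal_add_left_cancel)
  next
    case (union A)
    have A: "A i \<in> sets borel" for i
      using union(2) by (subst borel_sigma_sets_Ioc) (auto simp: sets_measure_of)
    have d2: "disjoint_family (\<lambda>i. A i \<inter> {a<..b})"
      using union(1) by (auto simp: disjoint_family_on_def)
    have "emeasure (interval_measure F1) (\<Union>i. A i) + emeasure (interval_measure F2) (\<Union>i. A i)
      = (\<Sum>i. emeasure (interval_measure F1) (A i)) + (\<Sum>i. emeasure (interval_measure F2) (A i))"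
      using suminf_emeasure[of A "interval_measure F1"] suminf_emeasure[of A "interval_measure F2"] union(1) A
      by (simp add: image_subset_iff)
    also have "\<dots> = (\<Sum>i. K * emeasure lborel (A i \<inter> {a<..b}))"
      by (subst suminf_add) (auto simp: union(3))
    also have "\<dots> = K * emeasure lborel ((\<Union>i. A i) \<inter> {a<..b})"
      using suminf_emeasure[of "\<lambda>i. A i \<inter> {a<..b}" lborel] d2 A
      by (simp add: image_subset_iff ennreal_suminf_cmult)
    finally show ?case .
  qed (use basic in auto)
qed

text \<open>
  The Stieltjes measure of \<open>K t + x(t)\<close> has a Radon-Nikodym density; so this function is an
  indefinite integral, and Lebesgue differentiation applies.
\<close>

lemma lipschitz_AE_differentiable_real:
  fixes x :: "real \<Rightarrow> real"
  assumes x: "K-lipschitz_on {a..b} x" and "a \<le> b"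
  shows "AE t in lebesgue. t \<in> {a<..<b} \<longrightarrow> x differentiable (at t)"
proof -
  have "K \<ge> 0" using x by (rule lipschitz_on_nonneg)
  \<comment> \<open>freezing the argument outside \<open>[a, b]\<close> makes the Stieltjes measures finite\<close>
  define \<tau> where "\<tau> t = max a (min b t)" for t
  have \<tau>: "\<tau> t \<in> {a..b}" for t using \<open>a \<le> b\<close> by (auto simp: \<tau>_def)
  have \<tau>mono: "\<tau> s \<le> \<tau> t" if "s \<le> t" for s t using that by (auto simp: \<tau>_def)
  have \<tau>id: "\<tau> t = t" if "t \<in> {a..b}" for t using that by (auto simp: \<tau>_def)
  have \<tau>c: "continuous_on UNIV \<tau>" unfolding \<tau>_def by (intro continuous_intros)
  have x\<tau>c: "continuous_on UNIV (\<lambda>t. x (\<tau> t))"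
    by (rule continuous_on_compose2[OF lipschitz_on_continuous_on[OF x] \<tau>c]) (use \<tau> in auto)
  have xd: "\<bar>x (\<tau> t) - x (\<tau> s)\<bar> \<le> K * (\<tau> t - \<tau> s)" if "s \<le> t" for s t
    using lipschitz_on_normD[OF x \<tau> \<tau>, of t s] \<tau>mono[OF that] by simp
  define F1 where "F1 t = K * \<tau> t + x (\<tau> t)" for t
  define F2 where "F2 t = K * \<tau> t - x (\<tau> t)" for t
  have mono: "mono F1" "mono F2"
  proof -
    have "F1 s \<le> F1 t \<and> F2 s \<le> F2 t" if "s \<le> t" for s t
      using xd[OF that] by (auto simp: F1_def F2_def right_diff_distrib abs_le_iff)
    then show "mono F1" "mono F2" by (auto intro: monoI)
  qed
  have cont: "continuous_on UNIV F1" "continuous_on UNIV F2"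
    unfolding F1_def F2_def by (intro continuous_intros \<tau>c x\<tau>c)+
  have sum: "F1 t + F2 t = (2*K) * max a (min b t)" for t by (simp add: F1_def F2_def \<tau>_def)
  let ?M = "interval_measure F1"
  have "absolutely_continuous lborel ?M"
    unfolding absolutely_continuous_def
  proof
    fix B :: "real set" assume B: "B \<in> null_sets lborel"
    then have Bb: "B \<in> sets borel" by (auto simp: null_sets_def)
    have "emeasure lborel (B \<inter> {a<..b}) = 0"
      using B by (intro null_setsD1 null_set_Int2) auto
    then have "emeasure ?M B = 0"
      using interval_measures_sum[OF mono cont \<open>a \<le> b\<close> _ sum Bb] \<open>K \<ge> 0\<close> by simp
    then show "B \<in> null_sets ?M" using Bb by (auto simp: null_sets_def)
  qed
  then obtain \<rho> where \<rho>[measurable]: "\<rho> \<in> borel_measurable lborel" and dens: "density lborel \<rho> = ?M"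
    using sigma_finite_measure.Radon_Nikodym[OF sigma_finite_lborel, of ?M] by auto
  have em: "(\<integral>\<^sup>+u. \<rho> u * indicator {a..t} u \<partial>lborel) = ennreal (F1 t - F1 a)" if "t \<in> {a..b}" for t
  proof -
    have "(\<integral>\<^sup>+u. \<rho> u * indicator {a..t} u \<partial>lborel) = emeasure ?M {a..t}"
      unfolding dens[symmetric] by (subst emeasure_density) auto
    also have "\<dots> = F1 t - F1 a"
      using that by (intro emeasure_interval_measure_Icc monoD[OF mono(1)] cont(1)) auto
    finally show ?thesis .
  qed
  define r where "r u = enn2real (\<rho> u)" for u
  have [measurable]: "r \<in> borel_measurable lborel" unfolding r_def by measurable
  have "AE u in lborel. \<rho> u * indicator {a..b} u \<noteq> \<infinity>"
    by (rule nn_integral_PInf_AE) (use em[of b] \<open>a \<le> b\<close> in auto)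
  then have AEr: "AE u in lborel. u \<in> {a..b} \<longrightarrow> \<rho> u = ennreal (r u)"
    by eventually_elim (auto simp: r_def less_top)
  have ri: "(r has_integral (F1 t - F1 a)) {a..t}" if t: "t \<in> {a..b}" for t
  proof -
    have "(\<integral>\<^sup>+u. ennreal (r u * indicator {a..t} u) \<partial>lborel) = (\<integral>\<^sup>+u. \<rho> u * indicator {a..t} u \<partial>lborel)"
      by (rule nn_integral_cong_AE, use AEr in eventually_elim) (use t in \<open>auto simp: indicator_def\<close>)
    then have "(\<integral>\<^sup>+u. ennreal (r u * indicator {a..t} u) \<partial>lborel) = ennreal (F1 t - F1 a)"
      using em[OF t] by simp
    then have "((\<lambda>u. r u * indicator {a..t} u) has_integral (F1 t - F1 a)) UNIV"
      using t monoD[OF mono(1), of a t]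
      by (intro nn_integral_has_integral) (auto simp: r_def)
    moreover have "(\<lambda>u. r u * indicator {a..t} u) = (\<lambda>u. if u \<in> {a..t} then r u else 0)"
      by (auto simp: indicator_def)
    ultimately show ?thesis by (simp only: has_integral_restrict_UNIV)
  qed
  have rint: "r integrable_on {a..b}" using ri[of b] \<open>a \<le> b\<close> by (auto simp: integrable_on_def)
  show ?thesis using AE_has_vector_derivative_integral[OF rint]
  proof eventually_elim
    case (elim t)
    show ?case
    proof
      assume t: "t \<in> {a<..<b}"
      have "((\<lambda>t. integral {a..t} r + F1 a - K * t) has_vector_derivative (r t + 0 - K * 1)) (at t)"
        using elim t by (intro derivative_intros has_vector_derivative_diff has_vector_derivative_add
            has_vector_derivative_mult_right has_vector_derivative_id) auto
      then have "(x has_vector_derivative (r t + 0 - K * 1)) (at t)"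
      proof (rule has_vector_derivative_transform_within_open[of _ _ _ "{a<..<b}"])
        fix u assume "u \<in> {a<..<b}"
        then have u: "u \<in> {a..b}" by auto
        show "integral {a..u} r + F1 a - K * u = x u"
          using integral_unique[OF ri[OF u]] by (simp add: F1_def \<tau>id[OF u])
      qed (use t in auto)
      then show "x differentiable (at t)" by (rule differentiableI_vector)
    qed
  qed
qed

theorem lipschitz_has_primitive:
  fixes x :: "real \<Rightarrow> 'a::euclidean_space"
  assumes x: "K-lipschitz_on {a..b} x" and "a \<le> b"
  shows "lipschitz_primitive a b x (\<lambda>t. vector_derivative x (at t))"
proof -
  have "AE t in lebesgue. \<forall>i\<in>Basis. t \<in> {a<..<b} \<longrightarrow> (\<lambda>t. x t \<bullet> i) differentiable (at t)"
  proof (rule AE_finite_allI[OF finite_Basis])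
    fix i :: 'a assume i: "i \<in> Basis"
    have "K-lipschitz_on {a..b} (\<lambda>t. x t \<bullet> i)"
    proof (rule lipschitz_onI)
      fix s t assume "s \<in> {a..b}" "t \<in> {a..b}"
      then have "norm (x s - x t) \<le> K * norm (s - t)" by (rule lipschitz_on_normD[OF x])
      then show "dist (x s \<bullet> i) (x t \<bullet> i) \<le> K * dist s t"
        using Basis_le_norm[OF i, of "x s - x t"] by (simp add: dist_norm inner_diff_left)
    qed (rule lipschitz_on_nonneg[OF x])
    then show "AE t in lebesgue. t \<in> {a<..<b} \<longrightarrow> (\<lambda>t. x t \<bullet> i) differentiable (at t)"
      by (rule lipschitz_AE_differentiable_real[OF _ \<open>a \<le> b\<close>])
  qed
  then have "AE t in lebesgue. t \<in> {a<..<b} \<longrightarrow> (x has_vector_derivative vector_derivative x (at t)) (at t)"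
  proof eventually_elim
    case (elim t)
    then have "t \<in> {a<..<b} \<longrightarrow> x differentiable (at t)"
      by (subst differentiable_componentwise_within) auto
    then show ?case by (simp add: vector_derivative_works)
  qed
  with x show ?thesis unfolding lipschitz_primitive_def by blast
qed

section \<open>Measurability along paths, and ordinary differential equations\<close>

text \<open>
  \<open>g\<close> is the pointwise limit of countably valued measurable functions with values in \<open>S\<close>, namely
  the first points of a countable dense subset of \<open>S\<close> that come close to \<open>g\<close>. For such functions
  the claim is immediate, and continuity in the second argument passes to the limit. Keeping the
  approximations inside \<open>S\<close> is what makes this work with continuity on \<open>S\<close> alone.
\<close>

lemma borel_measurable_caratheodory:
  fixes F :: "'m \<Rightarrow> 'x::{metric_space, second_countable_topology} \<Rightarrow> 'b::metric_space"
  assumes meas: "\<And>p. p \<in> S \<Longrightarrow> (\<lambda>t. F t p) \<in> borel_measurable M"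
    and cont: "\<And>t. t \<in> space M \<Longrightarrow> continuous_on S (F t)"
    and g[measurable]: "g \<in> borel_measurable M" and gS: "\<And>t. t \<in> space M \<Longrightarrow> g t \<in> S"
  shows "(\<lambda>t. F t (g t)) \<in> borel_measurable M"
proof (cases "S = {}")
  case True
  then have "space M = {}" using gS by auto
  then show ?thesis by (simp add: measurable_def)
next
  case False
  obtain D where D: "countable D" "D \<subseteq> S" "S \<subseteq> closure D" using separable by blast
  have "D \<noteq> {}" using False D by auto
  define d where "d = from_nat_into D"
  have dD: "d k \<in> D" for k unfolding d_def by (rule from_nat_into[OF \<open>D \<noteq> {}\<close>])
  define k where "k n t = (LEAST j. dist (d j) (g t) < 1 / real (Suc n))" for n t
  have kmeas: "k n \<in> measurable M (count_space UNIV)" for n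
    unfolding k_def by measurable
  have kdist: "dist (d (k n t)) (g t) < 1 / real (Suc n)" if "t \<in> space M" for n t
  proof -
    have "g t \<in> closure D" using D(3) gS[OF that] by auto
    moreover have "1 / real (Suc n) > 0" by simp
    ultimately obtain p where p: "p \<in> D" "dist p (g t) < 1 / real (Suc n)"
      using closure_approachable[THEN iffD1, rule_format] by blast
    then obtain j where "p = d j" using from_nat_into_surj[OF D(1) p(1)] unfolding d_def by blast
    then have "dist (d j) (g t) < 1 / real (Suc n)" using p(2) by simp
    then show ?thesis unfolding k_def by (rule LeastI)
  qed
  show ?thesis
  proof (rule borel_measurable_LIMSEQ_metric)
    fix n show "(\<lambda>t. F t (d (k n t))) \<in> borel_measurable M"
      by (rule measurable_compose_countable[OF meas kmeas]) (use dD D(2) in auto)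
  next
    fix t assume t: "t \<in> space M"
    have "(\<lambda>n. d (k n t)) \<longlonglongrightarrow> g t"
    proof (rule tendstoI)
      fix e :: real assume "e > 0"
      then obtain m where m: "1 / real (Suc m) < e" using nat_approx_posE by (metis of_nat_Suc)
      show "eventually (\<lambda>n. dist (d (k n t)) (g t) < e) sequentially"
        using eventually_ge_at_top[of m]
      proof eventually_elim
        case (elim n)
        then have "1 / real (Suc n) \<le> 1 / real (Suc m)" by (simp add: divide_simps)
        then show ?case using kdist[OF t, of n] m by linarith
      qed
    qed
    then show "(\<lambda>n. F t (d (k n t))) \<longlonglongrightarrow> F t (g t)"
      by (rule continuous_on_tendsto_compose[OF cont[OF t]])
        (use gS[OF t] dD D(2) in \<open>auto intro!: always_eventually\<close>)
  qed
qed

lemma borel_measurable_lebesgue_on_if_borel: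
  fixes g :: "'m::euclidean_space \<Rightarrow> 'a::topological_space"
  assumes "g \<in> borel_measurable (restrict_space borel S)"
  shows "g \<in> borel_measurable (lebesgue_on S)"
proof (rule measurableI)
  fix A :: "'a set" assume "A \<in> sets borel"
  then have "g -` A \<inter> S \<in> sets (restrict_space borel S)"
    using measurable_sets[OF assms(1)] by (simp add: space_restrict_space)
  then show "g -` A \<inter> space (lebesgue_on S) \<in> sets (lebesgue_on S)"
    by (auto simp: sets_restrict_space)
qed auto

text \<open>
  The function \<open>exp (- 2 L (t - a)) |x(t) - y(t)|\<^sup>2\<close> has nonpositive derivative.
\<close>

lemma ode_stability:
  fixes x y :: "real \<Rightarrow> 'a::real_inner"
  assumes x: "lipschitz_primitive a b x g" and y: "lipschitz_primitive a b y k" and "a \<le> b"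
    and le: "AE t in lebesgue. t \<in> {a<..<b} \<longrightarrow> norm (g t - k t) \<le> L * norm (x t - y t)"
  shows "norm (x b - y b) \<le> exp (L * (b - a)) * norm (x a - y a)"
proof -
  let ?w = "\<lambda>t. exp (-2 * L * (t - a)) * (norm (x t - y t))\<^sup>2"
  let ?w' = "\<lambda>t. exp (-2 * L * (t - a)) * (2 * ((x t - y t) \<bullet> (g t - k t))) + (exp (-2 * L * (t - a)) * (-2 * L)) * (norm (x t - y t))\<^sup>2"
  have w: "lipschitz_primitive a b ?w ?w'"
    by (intro lipschitz_primitive_mult lipschitz_primitive_norm_sq lipschitz_primitive_diff x y
        lipschitz_primitive_exp lipschitz_primitive_linear)
  have "AE t in lebesgue. t \<in> {a<..<b} \<longrightarrow> ?w' t \<le> 0"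
    using le
  proof eventually_elim
    case (elim t)
    show ?case
    proof
      assume "t \<in> {a<..<b}"
      then have "norm (g t - k t) \<le> L * norm (x t - y t)" using elim by blast
      then have "(x t - y t) \<bullet> (g t - k t) \<le> norm (x t - y t) * (L * norm (x t - y t))"
        by (meson mult_left_mono norm_cauchy_schwarz norm_ge_zero order_trans)
      then have "(x t - y t) \<bullet> (g t - k t) - L * (norm (x t - y t))\<^sup>2 \<le> 0"
        by (simp add: power2_eq_square algebra_simps)
      then have "exp (-2 * L * (t - a)) * (2 * ((x t - y t) \<bullet> (g t - k t) - L * (norm (x t - y t))\<^sup>2)) \<le> 0"
        by (intro mult_nonneg_nonpos) auto
      then show "?w' t \<le> 0" by (simp add: algebra_simps)
    qed
  qed
  from lipschitz_primitive_le[OF w lipschitz_primitive_const[of a b 0] \<open>a \<le> b\<close> this]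
  have "exp (-2 * L * (b - a)) * (norm (x b - y b))\<^sup>2 \<le> (norm (x a - y a))\<^sup>2" by simp
  then have "exp (-2 * L * (b - a)) * (norm (x b - y b))\<^sup>2 * (exp (L * (b - a)))\<^sup>2 \<le> (norm (x a - y a))\<^sup>2 * (exp (L * (b - a)))\<^sup>2"
    by (rule mult_right_mono) simp
  also have "(norm (x a - y a))\<^sup>2 * (exp (L * (b - a)))\<^sup>2 = (exp (L * (b - a)) * norm (x a - y a))\<^sup>2"
    by (simp add: power_mult_distrib mult.commute)
  finally have le: "exp (-2 * L * (b - a)) * (norm (x b - y b))\<^sup>2 * (exp (L * (b - a)))\<^sup>2 \<le> (exp (L * (b - a)) * norm (x a - y a))\<^sup>2" .
  have one: "exp (-2 * L * (b - a)) * (exp (L * (b - a)))\<^sup>2 = 1"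
    by (simp add: power2_eq_square mult_exp_exp)
  have "(norm (x b - y b))\<^sup>2 = (exp (-2 * L * (b - a)) * (exp (L * (b - a)))\<^sup>2) * (norm (x b - y b))\<^sup>2"
    unfolding one by simp
  also have "\<dots> = exp (-2 * L * (b - a)) * (norm (x b - y b))\<^sup>2 * (exp (L * (b - a)))\<^sup>2"
    by (simp only: mult_ac)
  also note le
  finally have "(norm (x b - y b))\<^sup>2 \<le> (exp (L * (b - a)) * norm (x a - y a))\<^sup>2" .
  then show ?thesis by (rule power2_le_imp_le) simp
qed

text \<open>
  Banach's fixed point theorem for the integral equation. In the supremum norm weighted by
  \<open>exp (- K (t - s))\<close> the integral operator has Lipschitz constant \<open>L / K\<close>, so a large \<open>K\<close> makes it
  a contraction on all of \<open>[s, T]\<close> at once. The weight is built into the functions, which live in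
  the space of bounded continuous functions on the line and are frozen outside \<open>[s, T]\<close>.
\<close>

lemma ode_exists:
  fixes F :: "real \<Rightarrow> 'b::euclidean_space \<Rightarrow> 'b"
  assumes "s \<le> T" and "L \<ge> 0" and "M \<ge> 0"
    and meas: "\<And>x. continuous_on {s..T} x \<Longrightarrow> (\<lambda>t. F t (x t)) \<in> borel_measurable (lebesgue_on {s..T})"
    and lip: "\<And>t x y. norm (F t x - F t y) \<le> L * norm (x - y)"
    and bd: "\<And>t. t \<in> {s..T} \<Longrightarrow> norm (F t 0) \<le> M"
  shows "\<exists>x. x s = \<xi> \<and> lipschitz_primitive s T x (\<lambda>t. F t (x t))"
proof -
  define K where "K = 2 * (L + 1)"
  have "K > 0" "L / K \<le> 1/2" using \<open>L \<ge> 0\<close> by (auto simp: K_def field_simps)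
  define \<tau> where "\<tau> t = max s (min T t)" for t
  have \<tau>: "\<tau> t \<in> {s..T}" for t using \<open>s \<le> T\<close> by (auto simp: \<tau>_def)
  have \<tau>id: "\<tau> t = t" if "t \<in> {s..T}" for t using that by (auto simp: \<tau>_def)
  have \<tau>c: "continuous_on UNIV \<tau>" unfolding \<tau>_def by (intro continuous_intros)
  \<comment> \<open>the path itself, with the weight removed\<close>
  define X where "X \<phi> t = exp (K * (t - s)) *\<^sub>R apply_bcontfun \<phi> t" for \<phi> :: "real \<Rightarrow>\<^sub>C 'b" and t
  have Xc: "continuous_on A (X \<phi>)" for \<phi> A
    unfolding X_def by (intro continuous_intros continuous_on_apply_bcontfun)
  define V where "V \<phi> t = (LINT r:{s..t}|lebesgue. F r (X \<phi> r))" for \<phi> t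
  have bnd: "\<exists>B\<ge>0. \<forall>t\<in>{s..T}. norm (F t (x t)) \<le> B" if x: "continuous_on {s..T} x" for x
  proof -
    have "bounded (x ` {s..T})" using x by (auto intro!: compact_imp_bounded compact_continuous_image)
    then obtain B where B: "\<And>t. t \<in> {s..T} \<Longrightarrow> norm (x t) \<le> B" by (metis bounded_iff imageI)
    have "norm (F t (x t)) \<le> M + L * \<bar>B\<bar>" if t: "t \<in> {s..T}" for t
    proof -
      have "norm (F t (x t)) \<le> norm (F t 0) + norm (F t (x t) - F t 0)" by (rule norm_triangle_sub)
      also have "\<dots> \<le> M + L * norm (x t - 0)" by (intro add_mono bd t lip)
      also have "\<dots> \<le> M + L * \<bar>B\<bar>" using B[OF t] \<open>L \<ge> 0\<close> by (intro add_mono mult_left_mono) auto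
      finally show ?thesis .
    qed
    then show ?thesis using \<open>M \<ge> 0\<close> \<open>L \<ge> 0\<close> by (intro exI[of _ "M + L * \<bar>B\<bar>"]) auto
  qed
  have V: "lipschitz_primitive s T (V \<phi>) (\<lambda>r. F r (X \<phi> r))" for \<phi>
  proof -
    obtain B where B: "B \<ge> 0" "\<forall>t\<in>{s..T}. norm (F t (X \<phi> t)) \<le> B" using bnd[OF Xc] by blast
    have "set_integrable lebesgue {s..T} (\<lambda>r. F r (X \<phi> r))"
      by (rule set_integrable_bounded[where M=B, OF meas[OF Xc]]) (use B in auto)
    then show ?thesis unfolding V_def
      by (rule lipschitz_primitive_integral[where M=B]) (use B in auto)
  qed
  define P where "P \<phi> = Bcontfun (\<lambda>t. exp (- K * (\<tau> t - s)) *\<^sub>R (\<xi> + V \<phi> (\<tau> t)))" for \<phi>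
  have P: "apply_bcontfun (P \<phi>) t = exp (- K * (\<tau> t - s)) *\<^sub>R (\<xi> + V \<phi> (\<tau> t))" for \<phi> t
    unfolding P_def
  proof (subst Bcontfun_inverse)
    have c: "continuous_on UNIV (\<lambda>t. exp (- K * (\<tau> t - s)) *\<^sub>R (\<xi> + V \<phi> (\<tau> t)))"
      by (intro continuous_intros \<tau>c continuous_on_compose2[OF lipschitz_primitiveD(4)[OF V] \<tau>c]) (use \<tau> in auto)
    have "bounded ((\<lambda>t. exp (- K * (t - s)) *\<^sub>R (\<xi> + V \<phi> t)) ` {s..T})"
      by (intro compact_imp_bounded compact_continuous_image continuous_intros lipschitz_primitiveD(4)[OF V]) auto
    then have "bounded (range (\<lambda>t. exp (- K * (\<tau> t - s)) *\<^sub>R (\<xi> + V \<phi> (\<tau> t))))"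
      by (rule bounded_subset) (use \<tau> in auto)
    with c show "(\<lambda>t. exp (- K * (\<tau> t - s)) *\<^sub>R (\<xi> + V \<phi> (\<tau> t))) \<in> bcontfun" by (simp add: bcontfun_def)
  qed simp
  have "dist (P \<phi>) (P \<psi>) \<le> 1/2 * dist \<phi> \<psi>" for \<phi> \<psi>
  proof (rule dist_bound)
    fix t
    define \<sigma> where "\<sigma> = \<tau> t"
    have \<sigma>: "s \<le> \<sigma>" "\<sigma> \<le> T" using \<tau>[of t] by (auto simp: \<sigma>_def)
    define G where "G r = L * dist \<phi> \<psi> / K * exp (K * (r - s))" for r
    have "lipschitz_primitive s \<sigma> (\<lambda>r. V \<phi> r - V \<psi> r) (\<lambda>r. F r (X \<phi> r) - F r (X \<psi> r))"
      using \<sigma> by (intro lipschitz_primitive_diff lipschitz_primitive_subinterval[OF V]) auto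
    moreover have "lipschitz_primitive s \<sigma> G (\<lambda>r. L * dist \<phi> \<psi> / K * (exp (K * (r - s)) * K))"
      unfolding G_def by (intro lipschitz_primitive_cmult lipschitz_primitive_exp lipschitz_primitive_linear)
    moreover have "norm (F r (X \<phi> r) - F r (X \<psi> r)) \<le> L * dist \<phi> \<psi> / K * (exp (K * (r - s)) * K)" for r
    proof -
      have "norm (X \<phi> r - X \<psi> r) = exp (K * (r - s)) * dist (apply_bcontfun \<phi> r) (apply_bcontfun \<psi> r)"
        unfolding X_def scaleR_diff_right[symmetric] by (simp add: dist_norm)
      also have "\<dots> \<le> exp (K * (r - s)) * dist \<phi> \<psi>" by (intro mult_left_mono dist_bounded) auto
      finally have "L * norm (X \<phi> r - X \<psi> r) \<le> L * (exp (K * (r - s)) * dist \<phi> \<psi>)"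
        using \<open>L \<ge> 0\<close> by (rule mult_left_mono)
      with lip[of r "X \<phi> r" "X \<psi> r"] have "norm (F r (X \<phi> r) - F r (X \<psi> r)) \<le> L * (exp (K * (r - s)) * dist \<phi> \<psi>)"
        by (rule order_trans)
      then show ?thesis using \<open>K > 0\<close> by (simp add: mult_ac)
    qed
    ultimately have "norm ((V \<phi> \<sigma> - V \<psi> \<sigma>) - (V \<phi> s - V \<psi> s)) \<le> G \<sigma> - G s"
      using \<sigma> by (intro lipschitz_primitive_norm_le[where x="\<lambda>r. V \<phi> r - V \<psi> r"]) auto
    also have "V \<phi> s - V \<psi> s = 0"
      using lipschitz_primitive_set_integrable(2)[OF lipschitz_primitive_subinterval[OF V, of s s]] \<open>s \<le> T\<close>
      by (simp add: V_def)
    also have "G \<sigma> - G s \<le> G \<sigma>" using \<open>K > 0\<close> \<open>L \<ge> 0\<close> by (simp add: G_def)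
    finally have *: "norm (V \<phi> \<sigma> - V \<psi> \<sigma>) \<le> G \<sigma>" by simp
    have "dist (apply_bcontfun (P \<phi>) t) (apply_bcontfun (P \<psi>) t) = exp (- K * (\<sigma> - s)) * norm (V \<phi> \<sigma> - V \<psi> \<sigma>)"
      unfolding P dist_norm scaleR_diff_right[symmetric] \<sigma>_def[symmetric] by simp
    also have "\<dots> \<le> exp (- K * (\<sigma> - s)) * G \<sigma>" using * by (intro mult_left_mono) auto
    also have "\<dots> = (exp (- K * (\<sigma> - s)) * exp (K * (\<sigma> - s))) * (L / K * dist \<phi> \<psi>)"
      unfolding G_def by (simp only: mult_ac times_divide_eq_left times_divide_eq_right)
    also have "\<dots> = L / K * dist \<phi> \<psi>" by (simp add: mult_exp_exp)
    also have "\<dots> \<le> 1/2 * dist \<phi> \<psi>" using \<open>L / K \<le> 1/2\<close> by (intro mult_right_mono) auto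
    finally show "dist (apply_bcontfun (P \<phi>) t) (apply_bcontfun (P \<psi>) t) \<le> 1/2 * dist \<phi> \<psi>" .
  qed
  then obtain \<phi> where \<phi>: "P \<phi> = \<phi>" using banach_fix_type[of "1/2" P] by auto
  have X: "X \<phi> t = \<xi> + V \<phi> t" if "t \<in> {s..T}" for t
  proof -
    have "X \<phi> t = exp (K * (t - s)) *\<^sub>R apply_bcontfun (P \<phi>) t" by (simp add: X_def \<phi>)
    then show ?thesis unfolding P \<tau>id[OF that] by (simp add: mult_exp_exp)
  qed
  have "lipschitz_primitive s T (\<lambda>t. \<xi> + V \<phi> t) (\<lambda>t. 0 + F t (X \<phi> t))"
    by (intro lipschitz_primitive_add lipschitz_primitive_const V)
  then have "lipschitz_primitive s T (X \<phi>) (\<lambda>t. F t (X \<phi> t))"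
    using X by (auto intro: lipschitz_primitive_transform)
  moreover have "V \<phi> s = 0"
    using lipschitz_primitive_set_integrable(2)[OF lipschitz_primitive_subinterval[OF V, of s s]] \<open>s \<le> T\<close>
    by (simp add: V_def)
  then have "X \<phi> s = \<xi>" using X[of s] \<open>s \<le> T\<close> by simp
  ultimately show ?thesis by blast
qed

section \<open>Paths of linearly bounded speed\<close>

text \<open>
  The speed bound involves the running supremum of the path. Let \<open>B\<close> be the maximum of
  \<open>(1 + |x(t)|) exp (- K (t - s))\<close>. Then the speed is at most \<open>K B exp (K (t - s))\<close>, and integrating
  this up to a point where the maximum is attained gives \<open>B \<le> 1 + |\<xi>|\<close>.
\<close>

lemma path_set_properties:
  fixes x :: "real \<Rightarrow> 'a::euclidean_space"
  assumes x: "x \<in> path_set T K s \<xi>" and "K \<ge> 0" and "s \<le> T"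
  defines "R \<equiv> (1 + norm \<xi>) * exp (K * (T - s))"
  shows "\<And>t. t \<in> {s..T} \<Longrightarrow> 1 + norm (x t) \<le> (1 + norm \<xi>) * exp (K * (t - s))"
    and "AE t in lebesgue. t \<in> {s<..<T} \<longrightarrow> norm (vector_derivative x (at t)) \<le> K * R"
    and "(K * R)-lipschitz_on {s..T} x"
    and "lipschitz_primitive s T x (\<lambda>t. vector_derivative x (at t))"
proof -
  have ac: "absolutely_continuous_on_interval s T x" and xs: "x s = \<xi>"
    and ae: "AE t in lebesgue. t \<in> {s<..<T} \<longrightarrow> x differentiable (at t) \<and>
        norm (vector_derivative x (at t)) \<le> K * (1 + (SUP r\<in>{s..t}. norm (x r)))"
    using x by (auto simp: path_set_def)
  have xc: "continuous_on {s..T} x" by (rule absolutely_continuous_imp_continuous_on[OF ac])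
  have deriv: "AE t in lebesgue. t \<in> {s<..<T} \<longrightarrow> (x has_vector_derivative vector_derivative x (at t)) (at t)"
    using ae by eventually_elim (auto simp: vector_derivative_works)
  have lip: "(K * B)-lipschitz_on {s..T} x" and bd: "AE t in lebesgue. t \<in> {s<..<T} \<longrightarrow> norm (vector_derivative x (at t)) \<le> K * B"
    if B: "\<And>t. t \<in> {s..T} \<Longrightarrow> 1 + norm (x t) \<le> B" for B
  proof -
    have "B \<ge> 0" using B[of s] \<open>s \<le> T\<close> by (smt (verit) atLeastAtMost_iff norm_ge_zero)
    show bd: "AE t in lebesgue. t \<in> {s<..<T} \<longrightarrow> norm (vector_derivative x (at t)) \<le> K * B"
      using ae
    proof eventually_elim
      case (elim t)
      show ?case
      proof
        assume t: "t \<in> {s<..<T}"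
        have "(SUP r\<in>{s..t}. norm (x r)) \<le> B - 1"
        proof (rule cSUP_least)
          fix r assume "r \<in> {s..t}"
          then have "r \<in> {s..T}" using t by auto
          from B[OF this] show "norm (x r) \<le> B - 1" by simp
        qed (use t in auto)
        then have "K * (1 + (SUP r\<in>{s..t}. norm (x r))) \<le> K * B"
          using \<open>K \<ge> 0\<close> by (intro mult_left_mono) auto
        then show "norm (vector_derivative x (at t)) \<le> K * B" using elim t by auto
      qed
    qed
    show "(K * B)-lipschitz_on {s..T} x"
      by (rule bounded_derivative_imp_lipschitz_on[OF ac _ deriv bd]) (use \<open>K \<ge> 0\<close> \<open>B \<ge> 0\<close> in auto)
  qed
  have "bounded (x ` {s..T})" using xc by (auto intro!: compact_imp_bounded compact_continuous_image)
  then obtain B0 where "\<forall>y\<in>x ` {s..T}. norm y \<le> B0" by (auto simp: bounded_iff)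
  then have "\<And>t. t \<in> {s..T} \<Longrightarrow> 1 + norm (x t) \<le> 1 + B0" by auto
  from lip[OF this] deriv
  show lp: "lipschitz_primitive s T x (\<lambda>t. vector_derivative x (at t))"
    unfolding lipschitz_primitive_def by blast
  define w where "w t = (1 + norm (x t)) * exp (- K * (t - s))" for t
  have wc: "continuous_on {s..T} w" unfolding w_def by (intro continuous_intros xc)
  obtain t0 where t0: "t0 \<in> {s..T}" "\<And>t. t \<in> {s..T} \<Longrightarrow> w t \<le> w t0"
    using continuous_attains_sup[OF _ _ wc] \<open>s \<le> T\<close> by auto
  define B where "B = w t0"
  have B0: "B \<ge> 0" by (simp add: B_def w_def)
  have weq: "1 + norm (x t) = w t * exp (K * (t - s))" for t
    by (simp add: w_def mult.assoc mult_exp_exp)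
  have xB: "1 + norm (x t) \<le> B * exp (K * (t - s))" if "t \<in> {s..T}" for t
    unfolding weq B_def using t0(2)[OF that] by (intro mult_right_mono) auto
  have gB: "AE t in lebesgue. t \<in> {s<..<T} \<longrightarrow> norm (vector_derivative x (at t)) \<le> B * (exp (K * (t - s)) * K)"
    using ae
  proof eventually_elim
    case (elim t)
    show ?case
    proof
      assume t: "t \<in> {s<..<T}"
      have "(SUP r\<in>{s..t}. norm (x r)) \<le> B * exp (K * (t - s)) - 1"
      proof (rule cSUP_least)
        fix r assume r: "r \<in> {s..t}"
        then have "1 + norm (x r) \<le> B * exp (K * (r - s))" using t by (intro xB) auto
        also have "\<dots> \<le> B * exp (K * (t - s))" using B0 r \<open>K \<ge> 0\<close> by (intro mult_left_mono) (auto intro: mult_left_mono)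
        finally show "norm (x r) \<le> B * exp (K * (t - s)) - 1" by simp
      qed (use t in auto)
      then have "K * (1 + (SUP r\<in>{s..t}. norm (x r))) \<le> K * (B * exp (K * (t - s)))"
        using \<open>K \<ge> 0\<close> by (intro mult_left_mono) auto
      then show "norm (vector_derivative x (at t)) \<le> B * (exp (K * (t - s)) * K)" using elim t by (auto simp: mult_ac)
    qed
  qed
  have "norm (x t0 - x s) \<le> B * exp (K * (t0 - s)) - B * exp (K * (s - s))"
  proof (rule lipschitz_primitive_norm_le)
    show "lipschitz_primitive s t0 x (\<lambda>t. vector_derivative x (at t))"
      by (rule lipschitz_primitive_subinterval[OF lp]) (use t0 in auto)
    show "lipschitz_primitive s t0 (\<lambda>t. B * exp (K * (t - s))) (\<lambda>t. B * (exp (K * (t - s)) * K))"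
      by (intro lipschitz_primitive_cmult lipschitz_primitive_exp lipschitz_primitive_linear)
    show "AE t in lebesgue. t \<in> {s<..<t0} \<longrightarrow> norm (vector_derivative x (at t)) \<le> B * (exp (K * (t - s)) * K)"
      using gB by eventually_elim (use t0 in auto)
  qed (use t0 in auto)
  then have "norm (x t0) \<le> norm \<xi> + (B * exp (K * (t0 - s)) - B)"
    using norm_triangle_sub[of "x t0" "x s"] by (simp add: xs)
  moreover have "1 + norm (x t0) = B * exp (K * (t0 - s))" unfolding weq B_def ..
  ultimately have B: "B \<le> 1 + norm \<xi>" by simp
  show xb: "1 + norm (x t) \<le> (1 + norm \<xi>) * exp (K * (t - s))" if "t \<in> {s..T}" for t
    using order_trans[OF xB[OF that] mult_right_mono[OF B]] by simp
  have "1 + norm (x t) \<le> R" if "t \<in> {s..T}" for t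
  proof -
    have "1 + norm (x t) \<le> (1 + norm \<xi>) * exp (K * (t - s))" by (rule xb[OF that])
    also have "\<dots> \<le> R" unfolding R_def using that \<open>K \<ge> 0\<close> by (intro mult_left_mono) (auto intro: mult_left_mono)
    finally show ?thesis .
  qed
  from lip[OF this] bd[OF this]
  show "(K * R)-lipschitz_on {s..T} x" "AE t in lebesgue. t \<in> {s<..<T} \<longrightarrow> norm (vector_derivative x (at t)) \<le> K * R"
    by auto
qed

lemma path_setI:
  fixes X :: "real \<Rightarrow> 'a::euclidean_space"
  assumes X: "lipschitz_primitive s T X g" and "K \<ge> 0"
    and le: "AE t in lebesgue. t \<in> {s<..<T} \<longrightarrow> norm (g t) \<le> K * (1 + norm (X t))"
  shows "X \<in> path_set T K s (X s)"
  unfolding path_set_def mem_Collect_eq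
proof (intro conjI lipschitz_primitiveD(3)[OF X] refl)
  show "AE t in lebesgue. t \<in> {s<..<T} \<longrightarrow> X differentiable (at t) \<and>
        norm (vector_derivative X (at t)) \<le> K * (1 + (SUP s\<in>{s..t}. norm (X s)))"
    using lipschitz_primitiveD(2)[OF X] le
  proof eventually_elim
    case (elim t)
    show ?case
    proof
      assume t: "t \<in> {s<..<T}"
      then have d: "(X has_vector_derivative g t) (at t)" using elim by blast
      have "norm (g t) \<le> K * (1 + norm (X t))" using elim t by blast
      also have "bounded ((\<lambda>s. norm (X s)) ` {s..t})"
        using continuous_on_subset[OF lipschitz_primitiveD(4)[OF X], of "{s..t}"] t
        by (intro compact_imp_bounded compact_continuous_image continuous_on_norm) auto
      then have "norm (X t) \<le> (SUP s\<in>{s..t}. norm (X s))"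
        using t by (intro cSUP_upper bounded_imp_bdd_above) auto
      then have "K * (1 + norm (X t)) \<le> K * (1 + (SUP s\<in>{s..t}. norm (X s)))"
        using \<open>K \<ge> 0\<close> by (intro mult_left_mono) auto
      finally show "X differentiable (at t) \<and>
        norm (vector_derivative X (at t)) \<le> K * (1 + (SUP s\<in>{s..t}. norm (X s)))"
        using vector_derivative_at[OF d] differentiableI_vector[OF d] by auto
    qed
  qed
qed

lemma exp_minus_lip: "\<bar>exp (- u) - exp (- w)\<bar> \<le> \<bar>u - w\<bar>" if "0 \<le> u" "0 \<le> w" for u w :: real
proof -
  have *: "\<bar>exp (- u) - exp (- w)\<bar> \<le> \<bar>u - w\<bar>" if "0 \<le> u" "u \<le> w" for u w :: real
  proof -
    have "exp (- u) - exp (- w) = exp (- u) * (1 - exp (u - w))" by (simp add: right_diff_distrib mult_exp_exp)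
    also have "\<dots> \<le> 1 * (w - u)"
    proof (rule mult_mono)
      show "1 - exp (u - w) \<le> w - u" using exp_ge_add_one_self[of "u - w"] by linarith
    qed (use that in auto)
    finally show ?thesis using that by auto
  qed
  show ?thesis using *[of u w] *[of w u] that by linarith
qed

lemma abs_cINF_diff_le:
  fixes p q :: "'i \<Rightarrow> real"
  assumes "A \<noteq> {}" "\<And>a. a \<in> A \<Longrightarrow> \<bar>p a - q a\<bar> \<le> c" "bdd_below (p ` A)" "bdd_below (q ` A)"
  shows "\<bar>(INF a\<in>A. p a) - (INF a\<in>A. q a)\<bar> \<le> c"
proof -
  have "(INF a\<in>A. p a) - c \<le> (INF a\<in>A. q a)"
  proof (rule cINF_greatest[OF \<open>A \<noteq> {}\<close>])
    fix a assume a: "a \<in> A"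
    show "(INF a\<in>A. p a) - c \<le> q a" using cINF_lower[OF assms(3) a] assms(2)[OF a] by linarith
  qed
  moreover have "(INF a\<in>A. q a) - c \<le> (INF a\<in>A. p a)"
  proof (rule cINF_greatest[OF \<open>A \<noteq> {}\<close>])
    fix a assume a: "a \<in> A"
    show "(INF a\<in>A. q a) - c \<le> p a" using cINF_lower[OF assms(4) a] assms(2)[OF a] by linarith
  qed
  ultimately show ?thesis by linarith
qed

section \<open>The control problem with data regular at every time\<close>

lemma controls_mem: "a \<in> controls T A \<Longrightarrow> t \<in> {0..T} \<Longrightarrow> a t \<in> A"
  unfolding controls_def by (auto dest!: measurable_space simp: space_restrict_space)

lemma controls_measurable:
  assumes "a \<in> controls T A" "0 \<le> s" "t \<le> T"
  shows "a \<in> borel_measurable (restrict_space borel {s..t})"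
proof -
  have "a \<in> borel_measurable (restrict_space borel {0..T})"
    using assms(1) unfolding controls_def by (auto simp: measurable_restrict_space2_iff)
  then show ?thesis by (rule measurable_restrict_mono) (use assms in auto)
qed

lemma const_control: "c \<in> A \<Longrightarrow> (\<lambda>_. c) \<in> controls T A"
  unfolding controls_def by (intro measurable_const) (simp add: space_restrict_space)

lemma splice_controls:
  assumes "a \<in> controls T A" "b \<in> controls T A"
  shows "(\<lambda>r. if r < t then a r else b r) \<in> controls T A"
  using assms unfolding controls_def
  by (intro measurable_If) (auto simp: space_restrict_space intro!: sets_restrict_space_iff[THEN iffD2] )

text \<open>
  The hypotheses of the theorem, required at every real time. Controls are defined on \<open>[0, T]\<close>
  only, but the data may be taken to vanish at all other times.
\<close>

locale control_data =
  fixes T C La L :: real and A :: "'p::polish_space set"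
    and f :: "real \<Rightarrow> 'a::euclidean_space \<Rightarrow> 'p \<Rightarrow> 'a"
    and lam ell :: "real \<Rightarrow> 'a \<Rightarrow> 'p \<Rightarrow> real"
    and h :: "'a \<Rightarrow> real"
  assumes T_pos: "T > 0" and A_nonempty: "A \<noteq> {}"
    and nonneg: "C \<ge> 0" "La \<ge> 0" "L \<ge> 0"
    and cont: "\<And>t. continuous_on (UNIV \<times> A) (\<lambda>(\<xi>, a). (f t \<xi> a, lam t \<xi> a, ell t \<xi> a))"
    and meas: "\<And>\<xi> a. a \<in> A \<Longrightarrow> (\<lambda>t. (f t \<xi> a, lam t \<xi> a, ell t \<xi> a)) \<in> borel_measurable borel"
    and lam_nonneg: "\<And>t \<xi> a. a \<in> A \<Longrightarrow> 0 \<le> lam t \<xi> a"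
    and growth: "\<And>t \<xi> a. a \<in> A \<Longrightarrow> norm (f t \<xi> a) + \<bar>ell t \<xi> a\<bar> \<le> C * (1 + norm \<xi>)"
    and lam_le: "\<And>t \<xi> a. a \<in> A \<Longrightarrow> lam t \<xi> a \<le> La"
    and lip: "\<And>t \<xi> \<xi>' a. a \<in> A \<Longrightarrow>
       norm (f t \<xi> a - f t \<xi>' a) + \<bar>ell t \<xi> a - ell t \<xi>' a\<bar> + \<bar>lam t \<xi> a - lam t \<xi>' a\<bar> \<le> L * norm (\<xi> - \<xi>')"
    and h_lip: "\<And>\<xi> \<xi>'. \<bar>h \<xi> - h \<xi>'\<bar> \<le> L * norm (\<xi> - \<xi>')"
begin

abbreviation "H \<equiv> hamiltonian A f lam ell"
abbreviation "v \<equiv> value_function T A f lam ell h"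
abbreviation "J \<equiv> cost T f lam ell h"

lemma f_le: "a \<in> A \<Longrightarrow> norm (f t \<xi> a) \<le> C * (1 + norm \<xi>)"
  using growth[of a t \<xi>] by linarith

lemma ell_le: "a \<in> A \<Longrightarrow> \<bar>ell t \<xi> a\<bar> \<le> C * (1 + norm \<xi>)"
  using growth[of a t \<xi>] norm_ge_zero[of "f t \<xi> a"] by linarith

lemma f_lip: "a \<in> A \<Longrightarrow> norm (f t \<xi> a - f t \<xi>' a) \<le> L * norm (\<xi> - \<xi>')"
  and ell_lip: "a \<in> A \<Longrightarrow> \<bar>ell t \<xi> a - ell t \<xi>' a\<bar> \<le> L * norm (\<xi> - \<xi>')"
  and lam_lip: "a \<in> A \<Longrightarrow> \<bar>lam t \<xi> a - lam t \<xi>' a\<bar> \<le> L * norm (\<xi> - \<xi>')"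
  using lip[of a t \<xi> \<xi>'] norm_ge_zero[of "f t \<xi> a - f t \<xi>' a"] by linarith+

lemma measurable_along:
  assumes a: "a \<in> controls T A" and x: "continuous_on {s..t} x" and st: "0 \<le> s" "t \<le> T"
  shows "(\<lambda>r. f r (x r) (a r)) \<in> borel_measurable (lebesgue_on {s..t})"
    "(\<lambda>r. lam r (x r) (a r)) \<in> borel_measurable (lebesgue_on {s..t})"
    "(\<lambda>r. ell r (x r) (a r)) \<in> borel_measurable (lebesgue_on {s..t})"
proof -
  let ?F = "\<lambda>r (p :: 'a \<times> 'p). case p of (\<xi>, a) \<Rightarrow> (f r \<xi> a, lam r \<xi> a, ell r \<xi> a)"
  have "(\<lambda>r. ?F r (x r, a r)) \<in> borel_measurable (restrict_space borel {s..t})"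
  proof (rule borel_measurable_caratheodory[where S="UNIV \<times> A" and F="?F"])
    show "(\<lambda>r. (x r, a r)) \<in> borel_measurable (restrict_space borel {s..t})"
      by (intro borel_measurable_Pair borel_measurable_continuous_on_restrict x controls_measurable[OF a st])
    show "(\<lambda>t. ?F t p) \<in> borel_measurable (restrict_space borel {s..t})" if "p \<in> UNIV \<times> A" for p
      using that meas by (auto intro!: measurable_restrict_space1)
    show "(x r, a r) \<in> UNIV \<times> A" if "r \<in> space (restrict_space borel {s..t})" for r
      using that st controls_mem[OF a] by (auto simp: space_restrict_space)
  qed (rule cont)
  then have F: "(\<lambda>r. (f r (x r) (a r), lam r (x r) (a r), ell r (x r) (a r))) \<in> borel_measurable (restrict_space borel {s..t})"
    by simp
  have "(\<lambda>r. fst (f r (x r) (a r), lam r (x r) (a r), ell r (x r) (a r))) \<in> borel_measurable (restrict_space borel {s..t})"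
    "(\<lambda>r. fst (snd (f r (x r) (a r), lam r (x r) (a r), ell r (x r) (a r)))) \<in> borel_measurable (restrict_space borel {s..t})"
    "(\<lambda>r. snd (snd (f r (x r) (a r), lam r (x r) (a r), ell r (x r) (a r)))) \<in> borel_measurable (restrict_space borel {s..t})"
    by (rule borel_measurable_continuous_on[OF _ F], intro continuous_intros)+
  then show "(\<lambda>r. f r (x r) (a r)) \<in> borel_measurable (lebesgue_on {s..t})"
    "(\<lambda>r. lam r (x r) (a r)) \<in> borel_measurable (lebesgue_on {s..t})"
    "(\<lambda>r. ell r (x r) (a r)) \<in> borel_measurable (lebesgue_on {s..t})"
    by (auto intro!: borel_measurable_lebesgue_on_if_borel)
qed

section \<open>Controlled trajectories\<close>

text \<open>
  Uniqueness is the case of equal initial values.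
\<close>

lemma trajectory_stability:
  assumes "lipschitz_primitive s t X (\<lambda>r. f r (X r) (a r))" "lipschitz_primitive s t Y (\<lambda>r. f r (Y r) (a r))"
    and "a \<in> controls T A" "0 \<le> s" "t \<le> T" "r \<in> {s..t}"
  shows "norm (X r - Y r) \<le> exp (L * (r - s)) * norm (X s - Y s)"
proof (rule ode_stability)
  show "lipschitz_primitive s r X (\<lambda>r. f r (X r) (a r))" "lipschitz_primitive s r Y (\<lambda>r. f r (Y r) (a r))"
    using assms by (auto intro: lipschitz_primitive_subinterval)
  show "AE u in lebesgue. u \<in> {s<..<r} \<longrightarrow> norm (f u (X u) (a u) - f u (Y u) (a u)) \<le> L * norm (X u - Y u)"
    using assms by (intro AE_I2 impI f_lip controls_mem[OF assms(3)]) auto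
qed (use assms in auto)

lemma trajectory_exists:
  assumes a: "a \<in> controls T A" and s: "s \<in> {0..T}"
  shows "\<exists>X. X s = \<xi> \<and> lipschitz_primitive s T X (\<lambda>r. f r (X r) (a r))"
proof -
  obtain c where c: "c \<in> A" using A_nonempty by blast
  \<comment> \<open>a control is unspecified outside \<open>[0, T]\<close>, where the Lipschitz bound needs values in \<open>A\<close>\<close>
  define a' where "a' t = (if t \<in> {0..T} then a t else c)" for t
  have a'A: "a' t \<in> A" for t using controls_mem[OF a] c by (auto simp: a'_def)
  have "\<exists>X. X s = \<xi> \<and> lipschitz_primitive s T X (\<lambda>r. f r (X r) (a' r))"
  proof (rule ode_exists)
    fix x :: "real \<Rightarrow> 'a" assume "continuous_on {s..T} x"
    then have "(\<lambda>r. f r (x r) (a r)) \<in> borel_measurable (lebesgue_on {s..T})"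
      using s by (intro measurable_along a) auto
    then show "(\<lambda>r. f r (x r) (a' r)) \<in> borel_measurable (lebesgue_on {s..T})"
      by (rule measurable_cong[THEN iffD1, rotated]) (use s in \<open>auto simp: a'_def\<close>)
  next
    show "norm (f t x (a' t) - f t y (a' t)) \<le> L * norm (x - y)" for t x y by (rule f_lip[OF a'A])
    show "norm (f t 0 (a' t)) \<le> C" for t using f_le[OF a'A, of t 0] by simp
  qed (use s nonneg in auto)
  then obtain X where "X s = \<xi>" "lipschitz_primitive s T X (\<lambda>r. f r (X r) (a' r))" by blast
  then show ?thesis
    using s by (intro exI[of _ X]) (auto intro!: AE_I2 elim!: lipschitz_primitive_cong simp: a'_def)
qed

text \<open>
  The linear growth of \<open>f\<close> makes every absolutely continuous solution Lipschitz, so the stability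
  estimate applies to it and the definite description is justified.
\<close>

lemma trajectory_eq:
  assumes a: "a \<in> controls T A" and s: "s \<in> {0..T}"
    and X: "lipschitz_primitive s T X (\<lambda>r. f r (X r) (a r))" and Xs: "X s = \<xi>" and t: "t \<in> {s..T}"
  shows "trajectory T f s \<xi> a t = X t"
proof -
  let ?Y = "restrict X {s..T}"
  have "trajectory T f s \<xi> a = ?Y"
    unfolding trajectory_def
  proof (rule the_equality)
    have "lipschitz_primitive s T ?Y (\<lambda>r. f r (X r) (a r))"
      by (rule lipschitz_primitive_transform[OF X]) auto
    then have "lipschitz_primitive s T ?Y (\<lambda>r. f r (?Y r) (a r))"
      by (rule lipschitz_primitive_cong) auto
    from lipschitz_primitiveD(2,3)[OF this] show "?Y \<in> extensional {s..T} \<and>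
      absolutely_continuous_on_interval s T ?Y \<and> ?Y s = \<xi> \<and>
      (AE t in lebesgue. t \<in> {s<..<T} \<longrightarrow> (?Y has_vector_derivative f t (?Y t) (a t)) (at t))"
      using s Xs by auto
  next
    fix Y assume "Y \<in> extensional {s..T} \<and>
      absolutely_continuous_on_interval s T Y \<and> Y s = \<xi> \<and>
      (AE t in lebesgue. t \<in> {s<..<T} \<longrightarrow> (Y has_vector_derivative f t (Y t) (a t)) (at t))"
    then have Y: "Y \<in> extensional {s..T}" "absolutely_continuous_on_interval s T Y" "Y s = \<xi>"
      "AE t in lebesgue. t \<in> {s<..<T} \<longrightarrow> (Y has_vector_derivative f t (Y t) (a t)) (at t)" by auto
    have "bounded (Y ` {s..T})"
      using absolutely_continuous_imp_continuous_on[OF Y(2)] by (auto intro!: compact_imp_bounded compact_continuous_image)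
    then obtain B where B: "\<forall>y\<in>Y ` {s..T}. norm y \<le> B" by (auto simp: bounded_iff)
    have "norm (f t (Y t) (a t)) \<le> C * (1 + \<bar>B\<bar>)" if "t \<in> {s<..<T}" for t
    proof -
      have "a t \<in> A" using that s by (intro controls_mem[OF a]) auto
      then have "norm (f t (Y t) (a t)) \<le> C * (1 + norm (Y t))" by (rule f_le)
      also have "\<dots> \<le> C * (1 + \<bar>B\<bar>)"
        using B that nonneg by (intro mult_left_mono add_left_mono) (auto intro: order_trans[OF _ abs_ge_self])
      finally show ?thesis .
    qed
    then have "(C * (1 + \<bar>B\<bar>))-lipschitz_on {s..T} Y"
      using nonneg by (intro bounded_derivative_imp_lipschitz_on[OF Y(2) _ Y(4)]) auto
    then have "lipschitz_primitive s T Y (\<lambda>r. f r (Y r) (a r))" using Y(4) unfolding lipschitz_primitive_def by blast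
    from trajectory_stability[OF this X a] s Y(3) Xs have "Y r = X r" if "r \<in> {s..T}" for r
      using that by auto
    then show "Y = ?Y" using Y(1) by (auto simp: extensional_def fun_eq_iff restrict_def)
  qed
  then show ?thesis using t by simp
qed

lemma trajectory_in_path_set:
  assumes a: "a \<in> controls T A" and s: "0 \<le> s" "T' \<le> T"
    and X: "lipschitz_primitive s T' X (\<lambda>r. f r (X r) (a r))"
  shows "X \<in> path_set T' C s (X s)"
  by (rule path_setI[OF X nonneg(1)], intro AE_I2 impI f_le controls_mem[OF a]) (use s in auto)

section \<open>Cost along a controlled trajectory\<close>

text \<open>
  \<open>E\<close> accumulates the discount rate and \<open>I\<close> the discounted running cost. Together with the
  trajectory they determine the cost, and keeping the three as solutions of differential equations
  avoids any further manipulation of integrals.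
\<close>

definition evolution :: "(real \<Rightarrow> 'p) \<Rightarrow> real \<Rightarrow> real \<Rightarrow> (real \<Rightarrow> 'a) \<Rightarrow> (real \<Rightarrow> real) \<Rightarrow> (real \<Rightarrow> real) \<Rightarrow> bool" where
  "evolution a s t X E I \<longleftrightarrow>
     lipschitz_primitive s t X (\<lambda>r. f r (X r) (a r)) \<and>
     lipschitz_primitive s t E (\<lambda>r. lam r (X r) (a r)) \<and>
     lipschitz_primitive s t I (\<lambda>r. exp (- E r) * ell r (X r) (a r))"

lemma evolutionD:
  assumes "evolution a s t X E I"
  shows "lipschitz_primitive s t X (\<lambda>r. f r (X r) (a r))"
    "lipschitz_primitive s t E (\<lambda>r. lam r (X r) (a r))"
    "lipschitz_primitive s t I (\<lambda>r. exp (- E r) * ell r (X r) (a r))"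
  using assms unfolding evolution_def by auto

lemma evolution_subinterval:
  "evolution a s t X E I \<Longrightarrow> s \<le> c \<Longrightarrow> d \<le> t \<Longrightarrow> evolution a c d X E I"
  unfolding evolution_def by (auto intro: lipschitz_primitive_subinterval)

lemma evolution_cong:
  assumes "evolution a s t X E I" "\<And>r. r \<in> {s<..<t} \<Longrightarrow> a r = b r"
  shows "evolution b s t X E I"
  using evolutionD[OF assms(1)] unfolding evolution_def
  by (auto elim!: lipschitz_primitive_cong simp: assms(2))

text \<open>
  With \<open>e\<close> and \<open>i\<close> the values of \<open>E\<close> and \<open>I\<close> at a later time, this restarts the evolution there.
\<close>

lemma evolution_shift:
  assumes "evolution a s t X E I"
  shows "evolution a s t X (\<lambda>r. E r - e) (\<lambda>r. exp e * (I r - i))"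
proof -
  have "lipschitz_primitive s t (\<lambda>r. E r - e) (\<lambda>r. lam r (X r) (a r) - 0)"
    by (intro lipschitz_primitive_diff lipschitz_primitive_const evolutionD[OF assms])
  moreover have "lipschitz_primitive s t (\<lambda>r. exp e * (I r - i)) (\<lambda>r. exp e * (exp (- E r) * ell r (X r) (a r) - 0))"
    by (intro lipschitz_primitive_cmult lipschitz_primitive_diff lipschitz_primitive_const evolutionD[OF assms])
  ultimately show ?thesis
    using evolutionD(1)[OF assms] unfolding evolution_def by (simp add: exp_add exp_diff exp_minus field_simps)
qed

lemma evolution_bounds:
  assumes ev: "evolution a s t X E I" and a: "a \<in> controls T A" and st: "0 \<le> s" "t \<le> T"
    and E0: "E s = 0" and I0: "I s = 0" and r: "r \<in> {s..t}"
  shows "1 + norm (X r) \<le> (1 + norm (X s)) * exp (C * T)"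
    "0 \<le> E r" "E r \<le> La * (r - s)"
    "\<bar>I r\<bar> \<le> C * ((1 + norm (X s)) * exp (C * T)) * (r - s)"
    "norm (X r - X s) \<le> C * ((1 + norm (X s)) * exp (C * T)) * (r - s)"
proof -
  let ?R = "(1 + norm (X s)) * exp (C * T)"
  have aA: "a u \<in> A" if "u \<in> {s..t}" for u using that st by (intro controls_mem[OF a]) auto
  have XR: "1 + norm (X u) \<le> ?R" if "u \<in> {s..t}" for u
  proof -
    have "1 + norm (X u) \<le> (1 + norm (X s)) * exp (C * (u - s))"
      using that nonneg
      by (intro path_set_properties(1)[OF trajectory_in_path_set[OF a st evolutionD(1)[OF ev]]]) auto
    also have "\<dots> \<le> ?R"
      using that st nonneg by (intro mult_left_mono) (auto intro!: mult_left_mono)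
    finally show ?thesis .
  qed
  show "1 + norm (X r) \<le> ?R" by (rule XR[OF r])
  have sub: "evolution a s u X E I" if "u \<in> {s..t}" for u using that by (intro evolution_subinterval[OF ev]) auto
  have Epos: "0 \<le> E u" if u: "u \<in> {s..t}" for u
  proof -
    have "E s \<le> E u"
      using u by (intro lipschitz_primitive_mono[OF evolutionD(2)[OF sub[OF u]]] AE_I2 impI lam_nonneg aA) auto
    then show ?thesis using E0 by simp
  qed
  show "0 \<le> E r" by (rule Epos[OF r])
  have "E r - E s \<le> La * (r - s) - La * (s - s)"
    using r by (intro lipschitz_primitive_le[OF evolutionD(2)[OF sub[OF r]] lipschitz_primitive_linear] AE_I2 impI lam_le aA) auto
  then show "E r \<le> La * (r - s)" using E0 by simp
  have CR: "C * (1 + norm (X u)) \<le> C * ?R" if "u \<in> {s..t}" for u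
    using XR[OF that] nonneg by (intro mult_left_mono) auto
  have "norm (X r - X s) \<le> C * ?R * (r - s) - C * ?R * (s - s)"
    using r CR by (intro lipschitz_primitive_norm_le[OF evolutionD(1)[OF sub[OF r]] lipschitz_primitive_linear] AE_I2 impI
       order_trans[OF f_le[OF aA]]) auto
  then show "norm (X r - X s) \<le> C * ?R * (r - s)" by simp
  have "norm (I r - I s) \<le> C * ?R * (r - s) - C * ?R * (s - s)"
  proof (intro lipschitz_primitive_norm_le[OF evolutionD(3)[OF sub[OF r]] lipschitz_primitive_linear] AE_I2 impI)
    fix u assume "u \<in> {s<..<r}"
    then have u: "u \<in> {s..t}" using r by auto
    have "norm (exp (- E u) * ell u (X u) (a u)) \<le> 1 * (C * (1 + norm (X u)))"
      using Epos[OF u] ell_le[OF aA[OF u], of u "X u"] unfolding norm_mult by (intro mult_mono) auto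
    then show "norm (exp (- E u) * ell u (X u) (a u)) \<le> C * ?R" using CR[OF u] by simp
  qed (use r in auto)
  then show "\<bar>I r\<bar> \<le> C * ?R * (r - s)" using I0 by simp
qed

lemma evolution_exists:
  assumes a: "a \<in> controls T A" and s: "s \<in> {0..T}"
  shows "\<exists>X E I. X s = \<xi> \<and> E s = 0 \<and> I s = 0 \<and> evolution a s T X E I"
proof -
  obtain X where Xs: "X s = \<xi>" and X: "lipschitz_primitive s T X (\<lambda>r. f r (X r) (a r))"
    using trajectory_exists[OF a s] by blast
  have s0: "0 \<le> s" "s \<le> T" using s by auto
  note Xc = lipschitz_primitiveD(4)[OF X]
  have aA: "a u \<in> A" if "u \<in> {s..T}" for u using that s by (intro controls_mem[OF a]) auto
  define E where "E t = (LINT r:{s..t}|lebesgue. lam r (X r) (a r))" for t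
  have lamb: "norm (lam r (X r) (a r)) \<le> La" if "r \<in> {s..T}" for r
    using lam_nonneg[OF aA[OF that]] lam_le[OF aA[OF that]] by simp
  have "set_integrable lebesgue {s..T} (\<lambda>r. lam r (X r) (a r))"
    by (rule set_integrable_bounded[where M=La, OF measurable_along(2)[OF a Xc s0(1) order_refl]]) (use lamb in auto)
  then have E: "lipschitz_primitive s T E (\<lambda>r. lam r (X r) (a r))"
    unfolding E_def by (rule lipschitz_primitive_integral[where M=La]) (use lamb nonneg in auto)
  have Es: "E s = 0"
    using lipschitz_primitive_set_integrable(2)[OF lipschitz_primitive_subinterval[OF E, of s s]] s0 by (simp add: E_def)
  have Epos: "0 \<le> E u" if u: "u \<in> {s..T}" for u
  proof -
    have "E s \<le> E u"
      using u by (intro lipschitz_primitive_mono[OF lipschitz_primitive_subinterval[OF E]] AE_I2 impI lam_nonneg aA) auto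
    then show ?thesis using Es by simp
  qed
  define I where "I t = (LINT r:{s..t}|lebesgue. exp (- E r) * ell r (X r) (a r))" for t
  let ?R = "(1 + norm (X s)) * exp (C * (T - s))"
  have ib: "norm (exp (- E u) * ell u (X u) (a u)) \<le> C * ?R" if u: "u \<in> {s..T}" for u
  proof -
    have "norm (exp (- E u) * ell u (X u) (a u)) \<le> 1 * (C * (1 + norm (X u)))"
      using Epos[OF u] ell_le[OF aA[OF u], of u "X u"] unfolding norm_mult by (intro mult_mono) auto
    also have "1 + norm (X u) \<le> (1 + norm (X s)) * exp (C * (u - s))"
      using u nonneg s0 by (intro path_set_properties(1)[OF trajectory_in_path_set[OF a s0(1) order_refl X]]) auto
    also have "\<dots> \<le> ?R"
      using u nonneg by (intro mult_left_mono) (auto intro!: mult_left_mono)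
    finally show ?thesis using nonneg by (simp add: mult_left_mono)
  qed
  have "(\<lambda>r. exp (- E r) * ell r (X r) (a r)) \<in> borel_measurable (lebesgue_on {s..T})"
  proof (intro borel_measurable_times measurable_along(3)[OF a Xc s0(1) order_refl])
    show "(\<lambda>r. exp (- E r)) \<in> borel_measurable (lebesgue_on {s..T})"
      by (rule continuous_imp_measurable_on_sets_lebesgue) (intro continuous_intros lipschitz_primitiveD(4)[OF E], simp)
  qed
  then have "set_integrable lebesgue {s..T} (\<lambda>r. exp (- E r) * ell r (X r) (a r))"
    by (rule set_integrable_bounded[where M="C * ?R"]) (use ib in auto)
  then have I: "lipschitz_primitive s T I (\<lambda>r. exp (- E r) * ell r (X r) (a r))"
    unfolding I_def by (rule lipschitz_primitive_integral[where M="C * ?R"]) (use ib nonneg in auto)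
  have "I s = 0"
    using lipschitz_primitive_set_integrable(2)[OF lipschitz_primitive_subinterval[OF I, of s s]] s0 by (simp add: I_def)
  with X E I Xs Es show ?thesis unfolding evolution_def by blast
qed

lemma evolution_unique:
  assumes ev: "evolution a s t X E I" "evolution a s t X' E' I'" and a: "a \<in> controls T A" "0 \<le> s" "t \<le> T"
    and init: "X s = X' s" "E s = E' s" "I s = I' s" and r: "r \<in> {s..t}"
  shows "X r = X' r" "E r = E' r" "I r = I' r"
proof -
  have X: "X u = X' u" if "u \<in> {s..t}" for u
    using trajectory_stability[OF evolutionD(1)[OF ev(1)] evolutionD(1)[OF ev(2)] a that] init by simp
  have E: "E u = E' u" if u: "u \<in> {s..t}" for u
  proof -
    have "norm ((\<lambda>r. E r - E' r) u - (\<lambda>r. E r - E' r) s) \<le> 0 - 0"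
      by (rule lipschitz_primitive_norm_le[OF lipschitz_primitive_subinterval[OF
        lipschitz_primitive_diff[OF evolutionD(2)[OF ev(1)] evolutionD(2)[OF ev(2)]]] lipschitz_primitive_const])
        (use u X in auto)
    then show ?thesis using init by simp
  qed
  have "norm ((\<lambda>r. I r - I' r) r - (\<lambda>r. I r - I' r) s) \<le> 0 - 0"
    by (rule lipschitz_primitive_norm_le[OF lipschitz_primitive_subinterval[OF
        lipschitz_primitive_diff[OF evolutionD(3)[OF ev(1)] evolutionD(3)[OF ev(2)]]] lipschitz_primitive_const])
        (use r X E in auto)
  then show "X r = X' r" "E r = E' r" "I r = I' r" using init X[OF r] E[OF r] by auto
qed

lemma cost_eq:
  assumes ev: "evolution a s T X E I" and a: "a \<in> controls T A" and s: "s \<in> {0..T}"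
    and init: "X s = \<xi>" "E s = 0" "I s = 0"
  shows "J s \<xi> a = I T + exp (- E T) * h (X T)"
proof -
  define x where "x = trajectory T f s \<xi> a"
  have x: "x t = X t" if "t \<in> {s..T}" for t
    unfolding x_def using trajectory_eq[OF a s evolutionD(1)[OF ev] init(1) that] .
  have disc: "discount lam x a s t = exp (- E t)" if t: "t \<in> {s..T}" for t
  proof -
    have "(LINT r:{s..t}|lebesgue. lam r (x r) (a r)) = (LINT r:{s..t}|lebesgue. lam r (X r) (a r))"
      unfolding set_lebesgue_integral_def
      by (intro Bochner_Integration.integral_cong refl) (use x t in \<open>auto simp: indicator_def\<close>)
    also have "\<dots> = E t - E s"
      using t by (intro lipschitz_primitive_set_integrable(2) lipschitz_primitive_subinterval[OF evolutionD(2)[OF ev]]) auto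
    finally show ?thesis using init by (simp add: discount_def)
  qed
  have "(LINT t:{s..T}|lebesgue. discount lam x a s t * ell t (x t) (a t)) =
    (LINT t:{s..T}|lebesgue. exp (- E t) * ell t (X t) (a t))"
      unfolding set_lebesgue_integral_def
      by (intro Bochner_Integration.integral_cong refl) (use x disc in \<open>auto simp: indicator_def\<close>)
  also have "\<dots> = I T - I s"
    using s by (intro lipschitz_primitive_set_integrable(2) evolutionD[OF ev]) auto
  finally show ?thesis using s init x[of T] disc[of T] by (simp add: cost_def x_def[symmetric])
qed

lemma cost_decompose:
  assumes ev: "evolution a s T X E I" and a: "a \<in> controls T A" and s: "s \<in> {0..T}"
    and init: "X s = \<xi>" "E s = 0" "I s = 0" and t: "t \<in> {s..T}"
  shows "J s \<xi> a = I t + exp (- E t) * J t (X t) a"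
proof -
  have "J t (X t) a = exp (E t) * (I T - I t) + exp (- (E T - E t)) * h (X T)"
    using t s by (intro cost_eq[OF evolution_shift[OF evolution_subinterval[OF ev]] a]) auto
  then have "exp (- E t) * J t (X t) a = (exp (- E t) * exp (E t)) * (I T - I t) + (exp (- E t) * exp (- (E T - E t))) * h (X T)"
    by (simp only: distrib_left mult.assoc)
  also have "\<dots> = I T - I t + exp (- E T) * h (X T)" by (simp add: mult_exp_exp)
  finally show ?thesis using cost_eq[OF ev a s init] by simp
qed

lemma cost_cong:
  assumes a: "a \<in> controls T A" and b: "b \<in> controls T A" and s: "s \<in> {0..T}" and "\<And>r. r \<in> {s..T} \<Longrightarrow> a r = b r"
  shows "J s \<xi> a = J s \<xi> b"
proof -
  obtain X E I where *: "X s = \<xi>" "E s = 0" "I s = 0" and ev: "evolution a s T X E I" using evolution_exists[OF a s] by blast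
  have ev': "evolution b s T X E I" by (rule evolution_cong[OF ev]) (use assms in auto)
  show ?thesis using cost_eq[OF ev a s *] cost_eq[OF ev' b s *] by simp
qed

lemma h_le: "\<bar>h \<xi>\<bar> \<le> \<bar>h 0\<bar> + L * norm \<xi>"
  using h_lip[of \<xi> 0] by simp

text \<open>
  A bound for \<open>1 + |x|\<close> along every controlled trajectory that starts in the ball of radius \<open>\<rho>\<close>.
\<close>

definition radius :: "real \<Rightarrow> real" where "radius \<rho> = (1 + \<rho>) * exp (C * T)"

definition cost_bound :: "real \<Rightarrow> real" where "cost_bound \<rho> = C * radius \<rho> * T + (\<bar>h 0\<bar> + L * radius \<rho>)"

lemma radius_ge: "0 \<le> \<rho> \<Longrightarrow> 1 + \<rho> \<le> radius \<rho>"
proof -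
  assume "0 \<le> \<rho>"
  then have "(1 + \<rho>) * 1 \<le> (1 + \<rho>) * exp (C * T)" using nonneg T_pos by (intro mult_left_mono) auto
  then show ?thesis by (simp add: radius_def)
qed

lemma evolution_radius:
  assumes ev: "evolution a s t X E I" and a: "a \<in> controls T A" and st: "0 \<le> s" "t \<le> T"
    and E0: "E s = 0" and I0: "I s = 0" and r: "r \<in> {s..t}" and \<rho>: "norm (X s) \<le> \<rho>"
  shows "1 + norm (X r) \<le> radius \<rho>" "\<bar>I r\<bar> \<le> C * radius \<rho> * (r - s)" "norm (X r - X s) \<le> C * radius \<rho> * (r - s)"
proof -
  have le: "(1 + norm (X s)) * exp (C * T) \<le> radius \<rho>"
    unfolding radius_def using \<rho> by (intro mult_right_mono) auto
  then have le': "C * ((1 + norm (X s)) * exp (C * T)) * (r - s) \<le> C * radius \<rho> * (r - s)"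
    using r nonneg by (intro mult_right_mono mult_left_mono) auto
  note b = evolution_bounds[OF ev a st E0 I0 r]
  show "1 + norm (X r) \<le> radius \<rho>" "\<bar>I r\<bar> \<le> C * radius \<rho> * (r - s)" "norm (X r - X s) \<le> C * radius \<rho> * (r - s)"
    using order_trans[OF b(1) le] order_trans[OF b(4) le'] order_trans[OF b(5) le'] by auto
qed

lemma cost_le:
  assumes a: "a \<in> controls T A" and s: "s \<in> {0..T}" and \<rho>: "norm \<xi> \<le> \<rho>"
  shows "\<bar>J s \<xi> a\<bar> \<le> cost_bound \<rho>"
proof -
  obtain X E I where i: "X s = \<xi>" "E s = 0" "I s = 0" and ev: "evolution a s T X E I" using evolution_exists[OF a s] by blast
  have TT: "T \<in> {s..T}" using s by auto
  have s0: "0 \<le> s" using s by auto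
  note b = evolution_radius[OF ev a s0 order_refl i(2,3) TT, of \<rho>, unfolded i(1), OF \<rho>]
  have E: "0 \<le> E T" using evolution_bounds(2)[OF ev a s0 order_refl i(2,3) TT] .
  have rp: "0 \<le> radius \<rho>" using b(1) norm_ge_zero[of "X T"] by linarith
  have "\<bar>h (X T)\<bar> \<le> \<bar>h 0\<bar> + L * norm (X T)" by (rule h_le)
  also have "\<dots> \<le> \<bar>h 0\<bar> + L * radius \<rho>" using b(1) nonneg by (intro add_left_mono mult_left_mono) auto
  finally have "\<bar>exp (- E T) * h (X T)\<bar> \<le> 1 * (\<bar>h 0\<bar> + L * radius \<rho>)"
    using E unfolding abs_mult by (intro mult_mono) auto
  moreover have "\<bar>I T\<bar> \<le> C * radius \<rho> * T"
    using b(2) s nonneg rp mult_left_mono[of "T - s" T "C * radius \<rho>"] by auto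
  ultimately show ?thesis unfolding cost_eq[OF ev a s i] cost_bound_def
    by (intro order_trans[OF abs_triangle_ineq] add_mono) auto
qed

text \<open>
  The constant is uniform over the controls, so that the estimate passes to the infimum. The
  trajectories from two starting points stay proportionally close, hence so do the discount exponents.
  The discount rate being nonnegative, \<open>exp (- E)\<close> only occurs with \<open>E \<ge> 0\<close>, where it is
  \<open>1\<close>-Lipschitz in \<open>E\<close>.
\<close>

lemma cost_Lipschitz_state:
  "\<exists>K\<ge>0. \<forall>s\<in>{0..T}. \<forall>a\<in>controls T A. \<forall>\<xi> \<xi>'. norm \<xi> \<le> \<rho> \<longrightarrow> norm \<xi>' \<le> \<rho> \<longrightarrow>
     \<bar>J s \<xi> a - J s \<xi>' a\<bar> \<le> K * norm (\<xi> - \<xi>')"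
proof (cases "\<rho> \<ge> 0")
  case False
  then have "\<not> norm \<xi> \<le> \<rho>" for \<xi> :: 'a using norm_ge_zero[of \<xi>] by linarith
  then show ?thesis by (intro exI[of _ 0]) auto
next
  case True
  define R where "R = radius \<rho>"
  have R0: "R \<ge> 0" using radius_ge[OF True] True by (simp add: R_def)
  define K where "K = exp (L * T) * ((L + L * T * (C * R)) * T + (L + L * T * (\<bar>h 0\<bar> + L * R)))"
  have "K \<ge> 0" using R0 nonneg T_pos by (simp add: K_def)
  show ?thesis
  proof (intro exI[of _ K] conjI ballI allI impI \<open>K \<ge> 0\<close>)
    fix s a and \<xi> \<xi>' :: 'a assume s: "s \<in> {0..T}" and a: "a \<in> controls T A" and \<rho>: "norm \<xi> \<le> \<rho>" "norm \<xi>' \<le> \<rho>"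
    have s0: "0 \<le> s" "s \<le> T" using s by auto
    obtain X E I where i: "X s = \<xi>" "E s = 0" "I s = 0" and ev: "evolution a s T X E I" using evolution_exists[OF a s] by blast
    obtain X' E' I' where i': "X' s = \<xi>'" "E' s = 0" "I' s = 0" and ev': "evolution a s T X' E' I'" using evolution_exists[OF a s] by blast
    have aA: "a u \<in> A" if "u \<in> {s..T}" for u using that s by (intro controls_mem[OF a]) auto
    define \<eta> where "\<eta> = exp (L * T) * norm (\<xi> - \<xi>')"
    have \<eta>0: "\<eta> \<ge> 0" by (simp add: \<eta>_def)
    have X: "norm (X r - X' r) \<le> \<eta>" if r: "r \<in> {s..T}" for r
    proof -
      have "norm (X r - X' r) \<le> exp (L * (r - s)) * norm (X s - X' s)"
        by (rule trajectory_stability[OF evolutionD(1)[OF ev] evolutionD(1)[OF ev'] a s0(1) order_refl r])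
      also have "\<dots> \<le> \<eta>" unfolding \<eta>_def i i'
        using r s0 nonneg by (intro mult_right_mono) (auto intro!: mult_left_mono)
      finally show ?thesis .
    qed
    have LX: "L * norm (X r - X' r) \<le> L * \<eta>" if "r \<in> {s..T}" for r
      using X[OF that] nonneg by (intro mult_left_mono) auto
    have Epos: "0 \<le> E r" "0 \<le> E' r" if "r \<in> {s..T}" for r
      using evolution_bounds(2)[OF ev a s0(1) order_refl i(2,3) that] evolution_bounds(2)[OF ev' a s0(1) order_refl i'(2,3) that] by auto
    have R': "1 + norm (X' r) \<le> R" if "r \<in> {s..T}" for r
      unfolding R_def using evolution_radius(1)[OF ev' a s0(1) order_refl i'(2,3) that, of \<rho>] i' \<rho> by simp
    have E: "\<bar>E r - E' r\<bar> \<le> L * \<eta> * T" if r: "r \<in> {s..T}" for r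
    proof -
      have "norm ((\<lambda>r. E r - E' r) r - (\<lambda>r. E r - E' r) s) \<le> L * \<eta> * (r - s) - L * \<eta> * (s - s)"
      proof (rule lipschitz_primitive_norm_le[OF lipschitz_primitive_subinterval[OF
        lipschitz_primitive_diff[OF evolutionD(2)[OF ev] evolutionD(2)[OF ev']]] lipschitz_primitive_linear])
        show "AE u in lebesgue. u \<in> {s<..<r} \<longrightarrow> norm (lam u (X u) (a u) - lam u (X' u) (a u)) \<le> L * \<eta>"
        proof (intro AE_I2 impI)
          fix u assume "u \<in> {s<..<r}"
          then have u: "u \<in> {s..T}" using r by auto
          show "norm (lam u (X u) (a u) - lam u (X' u) (a u)) \<le> L * \<eta>"
            using order_trans[OF lam_lip[OF aA[OF u]] LX[OF u]] by simp
        qed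
      qed (use r in auto)
      moreover have "L * \<eta> * (r - s) \<le> L * \<eta> * T"
        using r s0 nonneg \<eta>0 by (intro mult_left_mono) auto
      ultimately show ?thesis using i i' by simp
    qed
    have eE: "\<bar>exp (- E r) - exp (- E' r)\<bar> \<le> L * \<eta> * T" if r: "r \<in> {s..T}" for r
      using order_trans[OF exp_minus_lip[OF Epos[OF r]] E[OF r]] .
    have prod: "\<bar>exp (- E r) * p - exp (- E' r) * q\<bar> \<le> c + L * \<eta> * T * b"
      if r: "r \<in> {s..T}" and "\<bar>p - q\<bar> \<le> c" "\<bar>q\<bar> \<le> b" for r p q c b
    proof -
      have "exp (- E r) * p - exp (- E' r) * q = exp (- E r) * (p - q) + (exp (- E r) - exp (- E' r)) * q"
        by (simp add: algebra_simps)
      also have "\<bar>\<dots>\<bar> \<le> exp (- E r) * \<bar>p - q\<bar> + \<bar>exp (- E r) - exp (- E' r)\<bar> * \<bar>q\<bar>"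
        by (rule order_trans[OF abs_triangle_ineq]) (simp add: abs_mult)
      also have "\<dots> \<le> 1 * c + L * \<eta> * T * b"
        using that Epos[OF r] eE[OF r] nonneg \<eta>0 T_pos by (intro add_mono mult_mono) auto
      finally show ?thesis by simp
    qed
    let ?k = "L * \<eta> + L * \<eta> * T * (C * R)"
    have "norm ((\<lambda>r. I r - I' r) T - (\<lambda>r. I r - I' r) s) \<le> ?k * (T - s) - ?k * (s - s)"
    proof (rule lipschitz_primitive_norm_le[OF lipschitz_primitive_diff[OF evolutionD(3)[OF ev] evolutionD(3)[OF ev']] lipschitz_primitive_linear])
      show "AE u in lebesgue. u \<in> {s<..<T} \<longrightarrow> norm (exp (- E u) * ell u (X u) (a u) - exp (- E' u) * ell u (X' u) (a u)) \<le> ?k"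
      proof (intro AE_I2 impI)
        fix u assume "u \<in> {s<..<T}"
        then have u: "u \<in> {s..T}" by auto
        have "C * (1 + norm (X' u)) \<le> C * R" using R'[OF u] nonneg by (intro mult_left_mono) auto
        then have "\<bar>ell u (X' u) (a u)\<bar> \<le> C * R" using ell_le[OF aA[OF u], of u "X' u"] by linarith
        then show "norm (exp (- E u) * ell u (X u) (a u) - exp (- E' u) * ell u (X' u) (a u)) \<le> ?k"
          using prod[OF u order_trans[OF ell_lip[OF aA[OF u]] LX[OF u]]] by simp
      qed
    qed (use s0 in auto)
    moreover have "?k * (T - s) \<le> ?k * T"
      using s0 nonneg \<eta>0 R0 T_pos by (intro mult_left_mono) auto
    ultimately have I: "\<bar>I T - I' T\<bar> \<le> ?k * T" using i i' by simp
    have TT: "T \<in> {s..T}" using s0 by auto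
    have "\<bar>h (X' T)\<bar> \<le> \<bar>h 0\<bar> + L * R"
      using order_trans[OF h_le add_left_mono[OF mult_left_mono[of "norm (X' T)" R L]]] R'[OF TT] nonneg by simp
    from prod[OF TT order_trans[OF h_lip LX[OF TT]] this]
    have "\<bar>exp (- E T) * h (X T) - exp (- E' T) * h (X' T)\<bar> \<le> L * \<eta> + L * \<eta> * T * (\<bar>h 0\<bar> + L * R)" .
    with I have "\<bar>J s \<xi> a - J s \<xi>' a\<bar> \<le> ?k * T + (L * \<eta> + L * \<eta> * T * (\<bar>h 0\<bar> + L * R))"
      unfolding cost_eq[OF ev a s i] cost_eq[OF ev' a s i'] by linarith
    also have "\<dots> = K * norm (\<xi> - \<xi>')" by (simp add: K_def \<eta>_def algebra_simps)
    finally show "\<bar>J s \<xi> a - J s \<xi>' a\<bar> \<le> K * norm (\<xi> - \<xi>')" .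
  qed
qed

text \<open>
  Starting earlier by \<open>t - s\<close> adds a running cost of this order, discounts the rest by a
  factor that differs from \<open>1\<close> by this order, and moves the state at time \<open>t\<close> by this order.
\<close>

lemma cost_Lipschitz_time:
  assumes "\<rho> \<ge> 0"
  shows "\<exists>K\<ge>0. \<forall>s\<in>{0..T}. \<forall>t\<in>{s..T}. \<forall>a\<in>controls T A. \<forall>\<xi>. norm \<xi> \<le> \<rho> \<longrightarrow>
     \<bar>J s \<xi> a - J t \<xi> a\<bar> \<le> K * (t - s)"
proof -
  define R where "R = radius \<rho>"
  have R0: "R \<ge> 0" "\<rho> \<le> R" using radius_ge[OF assms] assms by (auto simp: R_def)
  obtain K1 where K1: "K1 \<ge> 0" "\<And>s a \<xi> \<xi>'. s \<in> {0..T} \<Longrightarrow> a \<in> controls T A \<Longrightarrow> norm \<xi> \<le> R \<Longrightarrow> norm \<xi>' \<le> R \<Longrightarrow>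
     \<bar>J s \<xi> a - J s \<xi>' a\<bar> \<le> K1 * norm (\<xi> - \<xi>')" using cost_Lipschitz_state[of R] by blast
  have cb: "cost_bound R \<ge> 0"
    using radius_ge[OF R0(1)] R0 nonneg T_pos by (auto simp: cost_bound_def intro!: add_nonneg_nonneg mult_nonneg_nonneg)
  define K where "K = C * R + La * cost_bound R + K1 * (C * R)"
  show ?thesis
  proof (intro exI[of _ K] conjI ballI allI impI)
    show "K \<ge> 0" using K1 R0 nonneg cb by (simp add: K_def)
    fix s t a and \<xi> :: 'a assume s: "s \<in> {0..T}" and t: "t \<in> {s..T}" and a: "a \<in> controls T A" and \<rho>: "norm \<xi> \<le> \<rho>"
    have s0: "0 \<le> s" "s \<le> T" and tT: "t \<in> {0..T}" using s t by auto
    obtain X E I where i: "X s = \<xi>" "E s = 0" "I s = 0" and ev: "evolution a s T X E I" using evolution_exists[OF a s] by blast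
    note b = evolution_radius[OF ev a s0(1) order_refl i(2,3) t, of \<rho>, unfolded i(1), OF \<rho>, folded R_def]
    note e = evolution_bounds(2,3)[OF ev a s0(1) order_refl i(2,3) t]
    have XR: "norm (X t) \<le> R" using b(1) by simp
    have e1: "\<bar>exp (- E t) - 1\<bar> \<le> La * (t - s)"
      using exp_minus_lip[of "E t" 0] e by simp
    have "\<bar>(exp (- E t) - 1) * J t (X t) a\<bar> \<le> La * (t - s) * cost_bound R"
      unfolding abs_mult using e1 cost_le[OF a tT XR] e by (intro mult_mono) auto
    moreover have "\<bar>J t (X t) a - J t \<xi> a\<bar> \<le> K1 * norm (X t - \<xi>)"
      using K1(2)[OF tT a XR, of \<xi>] \<rho> R0 by simp
    moreover have "K1 * norm (X t - \<xi>) \<le> K1 * (C * R * (t - s))" using b(3) K1(1) by (rule mult_left_mono)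
    moreover have "J s \<xi> a - J t \<xi> a = I t + (exp (- E t) - 1) * J t (X t) a + (J t (X t) a - J t \<xi> a)"
      using cost_decompose[OF ev a s i t] by (simp add: algebra_simps)
    ultimately have "\<bar>J s \<xi> a - J t \<xi> a\<bar> \<le> C * R * (t - s) + La * (t - s) * cost_bound R + K1 * (C * R * (t - s))"
      using b(2) by linarith
    also have "\<dots> = K * (t - s)" by (simp add: K_def algebra_simps)
    finally show "\<bar>J s \<xi> a - J t \<xi> a\<bar> \<le> K * (t - s)" .
  qed
qed

section \<open>The value function and dynamic programming\<close>

lemma controls_nonempty: "controls T A \<noteq> {}"
  using A_nonempty const_control by blast

lemma cost_bdd_below: "s \<in> {0..T} \<Longrightarrow> bdd_below (J s \<xi> ` controls T A)"
  using cost_le[of _ s \<xi> "norm \<xi>"] by (intro bdd_belowI2[where m="- cost_bound (norm \<xi>)"]) (smt (verit))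

lemma value_le_cost: "s \<in> {0..T} \<Longrightarrow> a \<in> controls T A \<Longrightarrow> v s \<xi> \<le> J s \<xi> a"
  unfolding value_function_def by (rule cINF_lower[OF cost_bdd_below])

lemma value_Lipschitz:
  assumes "\<rho> \<ge> 0"
  shows "\<exists>K\<ge>0. \<forall>s\<in>{0..T}. \<forall>t\<in>{0..T}. \<forall>\<xi> \<xi>'. norm \<xi> \<le> \<rho> \<longrightarrow> norm \<xi>' \<le> \<rho> \<longrightarrow>
     \<bar>v s \<xi> - v t \<xi>'\<bar> \<le> K * (\<bar>s - t\<bar> + norm (\<xi> - \<xi>'))"
proof -
  obtain K1 where K1: "K1 \<ge> 0" "\<And>s a \<xi> \<xi>'. s \<in> {0..T} \<Longrightarrow> a \<in> controls T A \<Longrightarrow> norm \<xi> \<le> \<rho> \<Longrightarrow> norm \<xi>' \<le> \<rho> \<Longrightarrow>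
     \<bar>J s \<xi> a - J s \<xi>' a\<bar> \<le> K1 * norm (\<xi> - \<xi>')" using cost_Lipschitz_state[of \<rho>] by blast
  obtain K2 where K2: "K2 \<ge> 0" "\<And>s t a \<xi>. s \<in> {0..T} \<Longrightarrow> t \<in> {s..T} \<Longrightarrow> a \<in> controls T A \<Longrightarrow> norm \<xi> \<le> \<rho> \<Longrightarrow>
     \<bar>J s \<xi> a - J t \<xi> a\<bar> \<le> K2 * (t - s)" using cost_Lipschitz_time[OF assms] by blast
  show ?thesis
  proof (intro exI[of _ "K1 + K2"] conjI ballI allI impI)
    fix s t and \<xi> \<xi>' :: 'a assume st: "s \<in> {0..T}" "t \<in> {0..T}" and \<rho>: "norm \<xi> \<le> \<rho>" "norm \<xi>' \<le> \<rho>"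
    show "\<bar>v s \<xi> - v t \<xi>'\<bar> \<le> (K1 + K2) * (\<bar>s - t\<bar> + norm (\<xi> - \<xi>'))"
      unfolding value_function_def
    proof (rule abs_cINF_diff_le[OF controls_nonempty _ cost_bdd_below[OF st(1)] cost_bdd_below[OF st(2)]])
      fix a assume a: "a \<in> controls T A"
      have "\<bar>J s \<xi> a - J t \<xi> a\<bar> \<le> K2 * \<bar>s - t\<bar>"
        using K2(2)[of s t a \<xi>] K2(2)[of t s a \<xi>] st a \<rho> by (cases "s \<le> t") (auto simp: abs_minus_commute)
      moreover have "\<bar>J t \<xi> a - J t \<xi>' a\<bar> \<le> K1 * norm (\<xi> - \<xi>')" by (rule K1(2)[OF st(2) a \<rho>])
      moreover have "K2 * \<bar>s - t\<bar> + K1 * norm (\<xi> - \<xi>') \<le> (K1 + K2) * (\<bar>s - t\<bar> + norm (\<xi> - \<xi>'))"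
        using K1(1) K2(1) by (simp add: algebra_simps)
      ultimately show "\<bar>J s \<xi> a - J t \<xi>' a\<bar> \<le> (K1 + K2) * (\<bar>s - t\<bar> + norm (\<xi> - \<xi>'))" by linarith
    qed
  qed (use K1 K2 in auto)
qed

lemma value_continuous: "continuous_on ({0..T} \<times> UNIV) (\<lambda>(t, \<xi>). v t \<xi>)"
  unfolding continuous_on_iff
proof (intro ballI allI impI)
  fix p :: "real \<times> 'a" and e :: real assume p: "p \<in> {0..T} \<times> UNIV" and "e > 0"
  obtain s \<xi> where [simp]: "p = (s, \<xi>)" by (cases p)
  have s: "s \<in> {0..T}" using p by auto
  obtain K where K: "K \<ge> 0" "\<And>s t \<xi>1 \<xi>2. s \<in> {0..T} \<Longrightarrow> t \<in> {0..T} \<Longrightarrow> norm \<xi>1 \<le> norm \<xi> + 1 \<Longrightarrow> norm \<xi>2 \<le> norm \<xi> + 1 \<Longrightarrow>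
     \<bar>v s \<xi>1 - v t \<xi>2\<bar> \<le> K * (\<bar>s - t\<bar> + norm (\<xi>1 - \<xi>2))" using value_Lipschitz[of "norm \<xi> + 1"] by auto
  define d where "d = min 1 (e / (2 * (K + 1)))"
  have d: "d > 0" "d \<le> 1" "2 * (K + 1) * d \<le> e"
  proof -
    show "d > 0" "d \<le> 1" using \<open>e > 0\<close> \<open>K \<ge> 0\<close> by (auto simp: d_def)
    have "2 * (K + 1) * d \<le> 2 * (K + 1) * (e / (2 * (K + 1)))"
      using \<open>K \<ge> 0\<close> by (intro mult_left_mono) (auto simp: d_def)
    then show "2 * (K + 1) * d \<le> e" using \<open>K \<ge> 0\<close> by simp
  qed
  show "\<exists>d>0. \<forall>q\<in>{0..T} \<times> UNIV. dist q p < d \<longrightarrow> dist (case q of (t, \<xi>) \<Rightarrow> v t \<xi>) (case p of (t, \<xi>) \<Rightarrow> v t \<xi>) < e"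
  proof (intro exI[of _ d] conjI ballI impI d(1))
    fix q assume q: "q \<in> {0..T} \<times> (UNIV :: 'a set)" "dist q p < d"
    obtain t \<xi>' where [simp]: "q = (t, \<xi>')" by (cases q)
    have n: "\<bar>t - s\<bar> < d" "norm (\<xi>' - \<xi>) < d"
      using q(2) dist_fst_le[of q p] dist_snd_le[of q p] by (auto simp: dist_real_def dist_norm)
    then have "norm \<xi>' \<le> norm \<xi> + 1" using norm_triangle_sub[of \<xi>' \<xi>] d by linarith
    then have "\<bar>v t \<xi>' - v s \<xi>\<bar> \<le> K * (\<bar>t - s\<bar> + norm (\<xi>' - \<xi>))" using q s by (intro K(2)) auto
    also have "\<dots> \<le> K * (2 * d)" using n \<open>K \<ge> 0\<close> by (intro mult_left_mono) auto
    also have "\<dots> < e" using d by (simp add: algebra_simps)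
    finally show "dist (case q of (t, \<xi>) \<Rightarrow> v t \<xi>) (case p of (t, \<xi>) \<Rightarrow> v t \<xi>) < e" by (simp add: dist_real_def)
  qed
qed

lemma value_terminal: "v T \<xi> = h \<xi>"
proof -
  have "J T \<xi> a = h \<xi>" if a: "a \<in> controls T A" for a
  proof -
    have TT: "T \<in> {0..T}" using T_pos by auto
    obtain X E I where i: "X T = \<xi>" "E T = 0" "I T = 0" and ev: "evolution a T T X E I" using evolution_exists[OF a TT] by blast
    show ?thesis using cost_eq[OF ev a TT i] i by simp
  qed
  then show ?thesis unfolding value_function_def using controls_nonempty by (simp cong: INF_cong_simp)
qed

text \<open>
  Follow \<open>a\<close> up to time \<open>t\<close> and an arbitrary control afterwards.
\<close>

lemma dynamic_programming_le:
  assumes ev: "evolution a s t X E I" and a: "a \<in> controls T A" and st: "0 \<le> s" "s \<le> t" "t \<le> T"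
    and i: "E s = 0" "I s = 0"
  shows "v s (X s) \<le> I t + exp (- E t) * v t (X t)"
proof -
  have sT: "s \<in> {0..T}" and tT: "t \<in> {0..T}" using st by auto
  have "exp (E t) * (v s (X s) - I t) \<le> v t (X t)"
    unfolding value_function_def[of T A f lam ell h t]
  proof (rule cINF_greatest[OF controls_nonempty])
    fix b assume b: "b \<in> controls T A"
    define c where "c r = (if r < t then a r else b r)" for r
    have c: "c \<in> controls T A" unfolding c_def by (rule splice_controls[OF a b])
    obtain X' E' I' where i': "X' s = X s" "E' s = 0" "I' s = 0" and ev': "evolution c s T X' E' I'"
      using evolution_exists[OF c sT] by blast
    have evc: "evolution c s t X E I" by (rule evolution_cong[OF ev]) (auto simp: c_def)
    have tt: "t \<in> {s..t}" using st by auto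
    have eq: "X' t = X t" "E' t = E t" "I' t = I t"
      using evolution_unique[OF evolution_subinterval[OF ev' order_refl st(3)] evc c st(1,3) _ _ _ tt] i i' by auto
    have "v s (X s) \<le> J s (X s) c" by (rule value_le_cost[OF sT c])
    also have "\<dots> = I t + exp (- E t) * J t (X t) c"
      using cost_decompose[OF ev' c sT i', of t] st by (simp add: eq)
    also have "J t (X t) c = J t (X t) b" by (rule cost_cong[OF c b tT]) (auto simp: c_def)
    finally have "exp (E t) * (v s (X s) - I t) \<le> exp (E t) * (exp (- E t) * J t (X t) b)"
      by (intro mult_left_mono) auto
    then show "exp (E t) * (v s (X s) - I t) \<le> J t (X t) b" by (simp add: mult.assoc[symmetric] mult_exp_exp)
  qed
  then have "exp (- E t) * (exp (E t) * (v s (X s) - I t)) \<le> exp (- E t) * v t (X t)"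
    by (intro mult_left_mono) auto
  then show ?thesis by (simp add: mult.assoc[symmetric] mult_exp_exp)
qed

lemma dynamic_programming_ge:
  assumes ev: "evolution a s T X E I" and a: "a \<in> controls T A" and s: "s \<in> {0..T}"
    and i: "E s = 0" "I s = 0" and t: "t \<in> {s..T}"
  shows "I t + exp (- E t) * v t (X t) \<le> J s (X s) a"
proof -
  have "v t (X t) \<le> J t (X t) a" using s t by (intro value_le_cost a) auto
  then have "exp (- E t) * v t (X t) \<le> exp (- E t) * J t (X t) a" by (intro mult_left_mono) auto
  then show ?thesis using cost_decompose[OF ev a s refl i t] by simp
qed

section \<open>The Hamiltonian and nearly minimizing controls\<close>

text \<open>
  The function of the control whose infimum is the Hamiltonian.
\<close>

definition Q :: "real \<Rightarrow> 'a \<Rightarrow> real \<Rightarrow> 'a \<Rightarrow> 'p \<Rightarrow> real" where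
  "Q t \<xi> y z a = ell t \<xi> a + f t \<xi> a \<bullet> z - lam t \<xi> a * y"

lemma H_eq: "H t \<xi> y z = (INF a\<in>A. Q t \<xi> y z a)"
  by (simp add: hamiltonian_def Q_def)

lemma Q_bound:
  assumes a: "a \<in> A"
  shows "\<bar>Q t \<xi> y z a\<bar> \<le> C * (1 + norm \<xi>) * (1 + norm z) + La * \<bar>y\<bar>"
proof -
  have "\<bar>f t \<xi> a \<bullet> z\<bar> \<le> norm (f t \<xi> a) * norm z" by (rule Cauchy_Schwarz_ineq2)
  moreover have "\<bar>lam t \<xi> a * y\<bar> \<le> La * \<bar>y\<bar>"
    using lam_nonneg[OF a] lam_le[OF a] unfolding abs_mult by (intro mult_right_mono) auto
  moreover have "\<bar>ell t \<xi> a\<bar> + norm (f t \<xi> a) * norm z \<le> (norm (f t \<xi> a) + \<bar>ell t \<xi> a\<bar>) * (1 + norm z)"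
    by (simp add: algebra_simps)
  moreover have "(norm (f t \<xi> a) + \<bar>ell t \<xi> a\<bar>) * (1 + norm z) \<le> C * (1 + norm \<xi>) * (1 + norm z)"
    using growth[OF a] by (intro mult_right_mono) auto
  ultimately show ?thesis unfolding Q_def by linarith
qed

lemma Q_bdd_below: "bdd_below (Q t \<xi> y z ` A)"
proof (rule bdd_belowI2)
  show "-(C * (1 + norm \<xi>) * (1 + norm z) + La * \<bar>y\<bar>) \<le> Q t \<xi> y z a" if "a \<in> A" for a
    using Q_bound[OF that, of t \<xi> y z] by linarith
qed

lemma Q_Lipschitz:
  assumes a: "a \<in> A"
  shows "\<bar>Q t \<xi> y z a - Q t \<xi>' y' z a\<bar> \<le> L * (1 + norm z + \<bar>y\<bar>) * norm (\<xi> - \<xi>') + La * \<bar>y - y'\<bar>"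
proof -
  let ?n = "norm (\<xi> - \<xi>')"
  have "Q t \<xi> y z a - Q t \<xi>' y' z a = (ell t \<xi> a - ell t \<xi>' a) + (f t \<xi> a - f t \<xi>' a) \<bullet> z
     - (lam t \<xi> a - lam t \<xi>' a) * y - lam t \<xi>' a * (y - y')"
    by (simp add: Q_def algebra_simps)
  moreover have "\<bar>(f t \<xi> a - f t \<xi>' a) \<bullet> z\<bar> \<le> L * ?n * norm z"
    by (rule order_trans[OF Cauchy_Schwarz_ineq2 mult_right_mono[OF f_lip[OF a] norm_ge_zero]])
  moreover have "\<bar>(lam t \<xi> a - lam t \<xi>' a) * y\<bar> \<le> L * ?n * \<bar>y\<bar>"
    unfolding abs_mult by (intro mult_right_mono lam_lip[OF a]) auto
  moreover have "\<bar>lam t \<xi>' a * (y - y')\<bar> \<le> La * \<bar>y - y'\<bar>"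
    using lam_nonneg[OF a] lam_le[OF a] unfolding abs_mult by (intro mult_right_mono) auto
  moreover have "\<bar>ell t \<xi> a - ell t \<xi>' a\<bar> \<le> L * ?n" by (rule ell_lip[OF a])
  ultimately have "\<bar>Q t \<xi> y z a - Q t \<xi>' y' z a\<bar> \<le> L * ?n + L * ?n * norm z + L * ?n * \<bar>y\<bar> + La * \<bar>y - y'\<bar>"
    by linarith
  then show ?thesis by (simp add: algebra_simps)
qed

lemma H_Lipschitz:
  "\<bar>H t \<xi> y z - H t \<xi>' y' z\<bar> \<le> L * (1 + norm z + \<bar>y\<bar>) * norm (\<xi> - \<xi>') + La * \<bar>y - y'\<bar>"
  unfolding H_eq by (rule abs_cINF_diff_le[OF A_nonempty Q_Lipschitz Q_bdd_below Q_bdd_below])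

lemma H_bound: "\<bar>H t \<xi> y z\<bar> \<le> C * (1 + norm \<xi>) * (1 + norm z) + La * \<bar>y\<bar>"
proof -
  have "\<bar>(INF a\<in>A. Q t \<xi> y z a) - (INF a\<in>A. (0::real))\<bar> \<le> C * (1 + norm \<xi>) * (1 + norm z) + La * \<bar>y\<bar>"
    by (rule abs_cINF_diff_le[OF A_nonempty _ Q_bdd_below]) (auto simp: Q_bound)
  then show ?thesis using A_nonempty by (simp add: H_eq)
qed

lemma H_le_Q: "a \<in> A \<Longrightarrow> H t \<xi> y z \<le> Q t \<xi> y z a"
  unfolding H_eq by (rule cINF_lower[OF Q_bdd_below])

text \<open>
  The discount rate is nonnegative. This monotonicity is what the comparison theorem uses.
\<close>

lemma H_antimono: "y \<le> y' \<Longrightarrow> H t \<xi> y' z \<le> H t \<xi> y z"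
  unfolding H_eq
proof (rule cINF_mono[OF A_nonempty Q_bdd_below])
  fix a assume "y \<le> y'" and a: "a \<in> A"
  then have "lam t \<xi> a * y \<le> lam t \<xi> a * y'" by (intro mult_left_mono lam_nonneg)
  then show "\<exists>b\<in>A. Q t \<xi> y' z b \<le> Q t \<xi> y z a" using a by (intro bexI[of _ a]) (auto simp: Q_def)
qed

lemma Q_continuous: "continuous_on A (Q t \<xi> y z)"
proof -
  have "continuous_on A (\<lambda>a. (\<lambda>(\<xi>, a). (f t \<xi> a, lam t \<xi> a, ell t \<xi> a)) (\<xi>, a))"
    by (rule continuous_on_compose2[OF cont]) (auto intro!: continuous_intros)
  then have c: "continuous_on A (\<lambda>a. (f t \<xi> a, lam t \<xi> a, ell t \<xi> a))" by simp
  have "continuous_on A (\<lambda>a. f t \<xi> a)" "continuous_on A (\<lambda>a. lam t \<xi> a)" "continuous_on A (\<lambda>a. ell t \<xi> a)"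
    using continuous_on_fst[OF c] continuous_on_fst[OF continuous_on_snd[OF c]] continuous_on_snd[OF continuous_on_snd[OF c]]
    by simp_all
  then show ?thesis unfolding Q_def by (intro continuous_intros)
qed

text \<open>
  Continuity in the control reduces the infimum over \<open>A\<close> to a countable one, independently of
  the other arguments. This is the source of all measurability statements about \<open>H\<close>.
\<close>

lemma countable_dense_controls:
  "\<exists>D. countable D \<and> D \<noteq> {} \<and> D \<subseteq> A \<and> (\<forall>t \<xi> y z. H t \<xi> y z = (INF d\<in>D. Q t \<xi> y z d))"
proof -
  obtain D where D: "countable D" "D \<subseteq> A" "A \<subseteq> closure D" using separable by blast
  have "D \<noteq> {}" using A_nonempty D by auto
  have "H t \<xi> y z = (INF d\<in>D. Q t \<xi> y z d)" for t \<xi> y z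
  proof (rule antisym)
    have bd: "bdd_below (Q t \<xi> y z ` D)" using Q_bdd_below D(2) by (meson bdd_below_mono image_mono)
    show "H t \<xi> y z \<le> (INF d\<in>D. Q t \<xi> y z d)"
      using D(2) by (intro cINF_greatest[OF \<open>D \<noteq> {}\<close>] H_le_Q) auto
    show "(INF d\<in>D. Q t \<xi> y z d) \<le> H t \<xi> y z"
      unfolding H_eq
    proof (rule cINF_greatest[OF A_nonempty])
      fix a assume a: "a \<in> A"
      then have "a \<in> closure D" using D(3) by blast
      then obtain q where q: "\<forall>n. q n \<in> D" "q \<longlonglongrightarrow> a" unfolding closure_sequential by blast
      have "(\<lambda>n. Q t \<xi> y z (q n)) \<longlonglongrightarrow> Q t \<xi> y z a"
        by (rule continuous_on_tendsto_compose[OF Q_continuous q(2) a]) (use q D in \<open>auto intro!: always_eventually\<close>)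
      then show "(INF d\<in>D. Q t \<xi> y z d) \<le> Q t \<xi> y z a"
        by (rule LIMSEQ_le_const) (use q in \<open>auto intro!: cINF_lower[OF bd]\<close>)
    qed
  qed
  then show ?thesis using D \<open>D \<noteq> {}\<close> by blast
qed

lemma H_measurable_along:
  assumes x: "continuous_on {s..t} x" and y: "continuous_on {s..t} y" and st: "0 \<le> s" "t \<le> T"
  shows "(\<lambda>r. H r (x r) (y r) z) \<in> borel_measurable (lebesgue_on {s..t})"
proof -
  obtain D where D: "countable D" "D \<noteq> {}" "D \<subseteq> A" "\<And>t \<xi> y z. H t \<xi> y z = (INF d\<in>D. Q t \<xi> y z d)"
    using countable_dense_controls by blast
  have "(\<lambda>r. Q r (x r) (y r) z d) \<in> borel_measurable (lebesgue_on {s..t})" if "d \<in> D" for d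
  proof -
    have dc: "(\<lambda>_. d) \<in> controls T A" using that D by (intro const_control) auto
    have "y \<in> borel_measurable (lebesgue_on {s..t})"
      by (rule continuous_imp_measurable_on_sets_lebesgue[OF y]) simp
    then show ?thesis
      unfolding Q_def
      by (intro borel_measurable_diff borel_measurable_add borel_measurable_inner borel_measurable_times
        borel_measurable_const measurable_along[OF dc x st])
  qed
  then show ?thesis unfolding D(4) by (intro borel_measurable_cINF_real D(1))
qed

text \<open>
  The selector picks, in an enumeration of a countable dense set of controls, the first one that
  is within \<open>\<delta>\<close> of all others. This involves countably many comparisons of measurable functions only.
\<close>

lemma near_minimizing_selector:
  assumes "\<delta> > 0"
  shows "\<exists>b\<in>controls T A. \<forall>t. Q t \<xi> y z (b t) \<le> H t \<xi> y z + \<delta>"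
proof -
  obtain D where D: "countable D" "D \<noteq> {}" "D \<subseteq> A" "\<And>t \<xi> y z. H t \<xi> y z = (INF d\<in>D. Q t \<xi> y z d)"
    using countable_dense_controls by blast
  define d where "d = from_nat_into D"
  have dD: "d k \<in> D" for k unfolding d_def by (rule from_nat_into[OF D(2)])
  have dA: "d k \<in> A" for k using dD D by auto
  have [measurable]: "(\<lambda>t. Q t \<xi> y z (d k)) \<in> borel_measurable borel" for k
  proof -
    have F: "(\<lambda>t. (f t \<xi> (d k), lam t \<xi> (d k), ell t \<xi> (d k))) \<in> borel_measurable borel" by (rule meas[OF dA])
    have "(\<lambda>t. snd (snd (f t \<xi> (d k), lam t \<xi> (d k), ell t \<xi> (d k))) + fst (f t \<xi> (d k), lam t \<xi> (d k), ell t \<xi> (d k)) \<bullet> z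
       - fst (snd (f t \<xi> (d k), lam t \<xi> (d k), ell t \<xi> (d k))) * y) \<in> borel_measurable borel"
      by (rule borel_measurable_continuous_on[OF _ F]) (intro continuous_intros)
    then show ?thesis by (simp add: Q_def)
  qed
  define K where "K t = (LEAST k. \<forall>j. Q t \<xi> y z (d k) \<le> Q t \<xi> y z (d j) + \<delta>)" for t
  have Km: "K \<in> measurable borel (count_space UNIV)" unfolding K_def by measurable
  have bd: "bdd_below (Q t \<xi> y z ` D)" for t using Q_bdd_below D(3) by (meson bdd_below_mono image_mono)
  have KK: "Q t \<xi> y z (d (K t)) \<le> Q t \<xi> y z (d j) + \<delta>" for t j
  proof -
    have "\<exists>e\<in>D. Q t \<xi> y z e < H t \<xi> y z + \<delta>"
      using \<open>\<delta> > 0\<close> D(2) unfolding D(4) by (subst cINF_less_iff[OF _ bd, symmetric]) auto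
    then obtain k where k: "Q t \<xi> y z (d k) < H t \<xi> y z + \<delta>"
      unfolding d_def using from_nat_into_surj[OF D(1)] by metis
    have "\<forall>j. Q t \<xi> y z (d k) \<le> Q t \<xi> y z (d j) + \<delta>"
    proof
      show "Q t \<xi> y z (d k) \<le> Q t \<xi> y z (d j) + \<delta>" for j
        using k H_le_Q[OF dA[of j], of t \<xi> y z] by linarith
    qed
    then have "\<forall>j. Q t \<xi> y z (d (K t)) \<le> Q t \<xi> y z (d j) + \<delta>"
      unfolding K_def by (rule LeastI)
    then show ?thesis by blast
  qed
  have "Q t \<xi> y z (d (K t)) - \<delta> \<le> H t \<xi> y z" for t
    unfolding D(4)
  proof (rule cINF_greatest[OF D(2)])
    fix e assume "e \<in> D"
    then obtain j where "e = d j" using from_nat_into_surj[OF D(1)] unfolding d_def by metis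
    then show "Q t \<xi> y z (d (K t)) - \<delta> \<le> Q t \<xi> y z e" using KK[of t j] by simp
  qed
  moreover have "(\<lambda>t. d (K t)) \<in> controls T A"
    unfolding controls_def
    by (intro measurable_restrict_space2 measurable_restrict_space1 measurable_compose[OF Km])
      (use dA in auto)
  ultimately show ?thesis by (intro bexI[of _ "\<lambda>t. d (K t)"]) (auto simp: algebra_simps)
qed

lemma controlled_pair_exists:
  assumes a: "a \<in> controls T A" and s: "s \<in> {0..T}" and X: "lipschitz_primitive s T X (\<lambda>r. f r (X r) (a r))"
  shows "\<exists>y. y s = y0 \<and> lipschitz_primitive s T y (\<lambda>t. f t (X t) (a t) \<bullet> z - H t (X t) (y t) z)"
proof -
  note Xc = lipschitz_primitiveD(4)[OF X]
  have s0: "0 \<le> s" "s \<le> T" using s by auto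
  have aA: "a u \<in> A" if "u \<in> {s..T}" for u using that s by (intro controls_mem[OF a]) auto
  have "bounded (X ` {s..T})" using Xc by (auto intro!: compact_imp_bounded compact_continuous_image)
  then obtain B where B: "\<forall>y\<in>X ` {s..T}. norm y \<le> B" by (auto simp: bounded_iff)
  have B0: "0 \<le> B" using B s0 by (auto intro: order_trans[OF norm_ge_zero])
  let ?M = "C * (1 + B) * norm z + C * (1 + B) * (1 + norm z)"
  show ?thesis
  proof (rule ode_exists[of s T La ?M "\<lambda>t y. f t (X t) (a t) \<bullet> z - H t (X t) y z" y0])
    fix y :: "real \<Rightarrow> real" assume y: "continuous_on {s..T} y"
    show "(\<lambda>t. f t (X t) (a t) \<bullet> z - H t (X t) (y t) z) \<in> borel_measurable (lebesgue_on {s..T})"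
      by (intro borel_measurable_diff borel_measurable_inner borel_measurable_const
        measurable_along[OF a Xc] H_measurable_along Xc y s0 order_refl)
  next
    fix t x y :: real
    show "norm ((f t (X t) (a t) \<bullet> z - H t (X t) x z) - (f t (X t) (a t) \<bullet> z - H t (X t) y z)) \<le> La * norm (x - y)"
      using H_Lipschitz[of t "X t" x z "X t" y] by simp
  next
    fix t assume t: "t \<in> {s..T}"
    have XB: "norm (X t) \<le> B" using B t by auto
    have "\<bar>f t (X t) (a t) \<bullet> z\<bar> \<le> norm (f t (X t) (a t)) * norm z" by (rule Cauchy_Schwarz_ineq2)
    also have "\<dots> \<le> C * (1 + B) * norm z"
    proof (rule mult_right_mono[OF order_trans[OF f_le[OF aA[OF t]]]])
      show "C * (1 + norm (X t)) \<le> C * (1 + B)" using XB nonneg by (intro mult_left_mono) auto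
    qed simp
    finally have "\<bar>f t (X t) (a t) \<bullet> z\<bar> \<le> C * (1 + B) * norm z" .
    moreover have "C * (1 + norm (X t)) * (1 + norm z) \<le> C * (1 + B) * (1 + norm z)"
      using XB nonneg by (intro mult_right_mono mult_left_mono) auto
    then have "\<bar>H t (X t) 0 z\<bar> \<le> C * (1 + B) * (1 + norm z)"
      using H_bound[of t "X t" 0 z] by simp
    ultimately show "norm (f t (X t) (a t) \<bullet> z - H t (X t) 0 z) \<le> ?M" by simp
  qed (use s0 nonneg B0 in auto)
qed

section \<open>Characteristics and their compactness\<close>

lemma path_pairI:
  assumes s: "s \<in> {0..T}" and x: "x \<in> path_set T C s \<xi>" and ys: "y s = y0"
    and y: "lipschitz_primitive s T y (\<lambda>t. vector_derivative x (at t) \<bullet> z - H t (x t) (y t) z)"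
  shows "(x, y) \<in> path_pair_set T H C s \<xi> y0 z"
proof -
  have "y t = y0 + (LINT r:{s..t}|lebesgue. vector_derivative x (at r) \<bullet> z - H r (x r) (y r) z)" if "t \<in> {s..T}" for t
    using lipschitz_primitive_set_integrable(2)[OF lipschitz_primitive_subinterval[OF y, of s t]] that ys by simp
  then show ?thesis
    unfolding path_pair_set_def
    using x lipschitz_primitiveD(4)[OF y] lipschitz_primitive_set_integrable(1)[OF y] s by simp
qed

text \<open>
  The last statement bounds \<open>y\<close>: its speed grows at most linearly in \<open>|y|\<close>, so \<open>y\<close> belongs to
  a path set of its own and inherits the estimates for such paths.
\<close>

lemma path_pairD:
  assumes s: "s \<in> {0..T}" and xy: "(x, y) \<in> path_pair_set T H C s \<xi> y0 z"
  shows "x \<in> path_set T C s \<xi>" "y s = y0" "x s = \<xi>"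
    "lipschitz_primitive s T x (\<lambda>t. vector_derivative x (at t))"
    "lipschitz_primitive s T y (\<lambda>t. vector_derivative x (at t) \<bullet> z - H t (x t) (y t) z)"
    "y \<in> path_set T (C * ((1 + norm \<xi>) * exp (C * T)) * (1 + 2 * norm z) + La) s y0"
proof -
  have s0: "0 \<le> s" "s \<le> T" using s by auto
  have x: "x \<in> path_set T C s \<xi>" and yc: "continuous_on {s..T} y"
    and int: "set_integrable lebesgue {s..T} (\<lambda>t. vector_derivative x (at t) \<bullet> z - H t (x t) (y t) z)"
    and yeq: "\<And>t. t \<in> {s..T} \<Longrightarrow> y t = y0 + (LINT r:{s..t}|lebesgue. vector_derivative x (at r) \<bullet> z - H r (x r) (y r) z)"
    using xy by (auto simp: path_pair_set_def)
  show "x \<in> path_set T C s \<xi>" "x s = \<xi>" using x by (auto simp: path_set_def)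
  note P = path_set_properties[OF x nonneg(1) s0(2)]
  show "lipschitz_primitive s T x (\<lambda>t. vector_derivative x (at t))" by (rule P(4))
  let ?R = "(1 + norm \<xi>) * exp (C * T)"
  have Rle: "(1 + norm \<xi>) * exp (C * (t - s)) \<le> ?R" if "t \<in> {s..T}" for t
    using that s0 nonneg by (intro mult_left_mono) (auto intro!: mult_left_mono)
  have xR: "1 + norm (x t) \<le> ?R" if "t \<in> {s..T}" for t
    using order_trans[OF P(1)[OF that] Rle[OF that]] .
  let ?N = "C * ?R * (1 + 2 * norm z)"
  have N0: "?N \<ge> 0" using nonneg by simp
  have gle: "AE t in lebesgue. t \<in> {s<..<T} \<longrightarrow> norm (vector_derivative x (at t) \<bullet> z - H t (x t) (y t) z) \<le> ?N + La * \<bar>y t\<bar>"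
    using P(2)
  proof eventually_elim
    case (elim t)
    show ?case
    proof
      assume t: "t \<in> {s<..<T}"
      then have t': "t \<in> {s..T}" by auto
      have "norm (vector_derivative x (at t)) \<le> C * ?R"
        using elim t Rle[of T] s0 nonneg by (auto intro: order_trans mult_left_mono)
      then have "\<bar>vector_derivative x (at t) \<bullet> z\<bar> \<le> C * ?R * norm z"
        by (intro order_trans[OF Cauchy_Schwarz_ineq2] mult_right_mono) auto
      moreover have "C * (1 + norm (x t)) * (1 + norm z) \<le> C * ?R * (1 + norm z)"
        using xR[OF t'] nonneg by (intro mult_right_mono mult_left_mono) auto
      moreover have "C * ?R * norm z + C * ?R * (1 + norm z) = ?N" by (simp add: algebra_simps)
      ultimately show "norm (vector_derivative x (at t) \<bullet> z - H t (x t) (y t) z) \<le> ?N + La * \<bar>y t\<bar>"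
        using H_bound[of t "x t" "y t" z] unfolding real_norm_def by linarith
    qed
  qed
  have "bounded (y ` {s..T})" using yc by (auto intro!: compact_imp_bounded compact_continuous_image)
  then obtain B where B: "\<forall>u\<in>y ` {s..T}. norm u \<le> B" by (auto simp: bounded_iff)
  have "AE t in lebesgue. t \<in> {s<..<T} \<longrightarrow> norm (vector_derivative x (at t) \<bullet> z - H t (x t) (y t) z) \<le> ?N + La * \<bar>B\<bar>"
    using gle
  proof eventually_elim
    case (elim t)
    show ?case
    proof
      assume t: "t \<in> {s<..<T}"
      then have "\<bar>y t\<bar> \<le> B" using B by auto
      then have "\<bar>y t\<bar> \<le> \<bar>B\<bar>" by linarith
      then have "La * \<bar>y t\<bar> \<le> La * \<bar>B\<bar>" using nonneg by (intro mult_left_mono) auto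
      then show "norm (vector_derivative x (at t) \<bullet> z - H t (x t) (y t) z) \<le> ?N + La * \<bar>B\<bar>" using elim t by auto
    qed
  qed
  from lipschitz_primitive_integral[OF int this] N0 nonneg
  have lp: "lipschitz_primitive s T (\<lambda>t. LINT r:{s..t}|lebesgue. vector_derivative x (at r) \<bullet> z - H r (x r) (y r) z)
     (\<lambda>t. vector_derivative x (at t) \<bullet> z - H t (x t) (y t) z)" by simp
  from lipschitz_primitive_set_integrable(2)[OF lipschitz_primitive_subinterval[OF lp, of s s]] s0
  have "(LINT r:{s..s}|lebesgue. vector_derivative x (at r) \<bullet> z - H r (x r) (y r) z) = 0" by simp
  with yeq[of s] s0 show ys: "y s = y0" by simp
  have "lipschitz_primitive s T (\<lambda>t. y0 + (LINT r:{s..t}|lebesgue. vector_derivative x (at r) \<bullet> z - H r (x r) (y r) z))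
     (\<lambda>t. 0 + (vector_derivative x (at t) \<bullet> z - H t (x t) (y t) z))"
    by (intro lipschitz_primitive_add lipschitz_primitive_const lp)
  from lipschitz_primitive_transform[OF this, of y] yeq
  show y: "lipschitz_primitive s T y (\<lambda>t. vector_derivative x (at t) \<bullet> z - H t (x t) (y t) z)" by simp
  have "y \<in> path_set T (?N + La) s (y s)"
  proof (rule path_setI[OF y])
    show "AE t in lebesgue. t \<in> {s<..<T} \<longrightarrow> norm (vector_derivative x (at t) \<bullet> z - H t (x t) (y t) z) \<le> (?N + La) * (1 + norm (y t))"
      using gle
    proof eventually_elim
      case (elim t)
      have "?N + La * \<bar>y t\<bar> \<le> (?N + La) * (1 + norm (y t))"
        using N0 nonneg mult_nonneg_nonneg[OF N0, of "\<bar>y t\<bar>"] by (simp only: real_norm_def distrib_left distrib_right) auto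
      then show ?case using elim by (auto intro: order_trans)
    qed
  qed (use N0 nonneg in auto)
  then show "y \<in> path_set T (?N + La) s y0" using ys by simp
qed

text \<open>
  Uniformity in the starting point is needed on the time grid of the comparison theorem, where
  each step starts a new characteristic.
\<close>

lemma path_pair_uniform_bounds:
  "\<exists>K\<ge>0. \<forall>s\<in>{0..T}. \<forall>\<xi> y0 z x y. norm \<xi> \<le> \<rho> \<longrightarrow> \<bar>y0\<bar> \<le> M \<longrightarrow> norm z \<le> Z \<longrightarrow>
    (x, y) \<in> path_pair_set T H C s \<xi> y0 z \<longrightarrow> K-lipschitz_on {s..T} x \<and> K-lipschitz_on {s..T} y \<and>
     (\<forall>t\<in>{s..T}. norm (x t) \<le> K \<and> \<bar>y t\<bar> \<le> K)"
proof -
  define R where "R = (1 + \<bar>\<rho>\<bar>) * exp (C * T)"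
  define N where "N = C * R * (1 + 2 * \<bar>Z\<bar>) + La"
  define R2 where "R2 = (1 + \<bar>M\<bar>) * exp (N * T)"
  have R0: "R \<ge> 0" "N \<ge> 0" "R2 \<ge> 0" using nonneg by (auto simp: R_def N_def R2_def)
  define K where "K = max (max (C * R) (N * R2)) (max R R2)"
  have K: "C * R \<le> K" "N * R2 \<le> K" "R \<le> K" "R2 \<le> K" by (auto simp: K_def)
  show ?thesis
  proof (intro exI[of _ K] conjI ballI allI impI)
    show "K \<ge> 0" using K(3) R0 by linarith
    fix s y0 and \<xi> z :: 'a and x y
    assume s: "s \<in> {0..T}" and b: "norm \<xi> \<le> \<rho>" "\<bar>y0\<bar> \<le> M" "norm z \<le> Z"
      and xy: "(x, y) \<in> path_pair_set T H C s \<xi> y0 z"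
    have s0: "0 \<le> s" "s \<le> T" using s by auto
    note P = path_pairD[OF s xy]
    have e: "exp (k * (t - s)) \<le> exp (k * T)" if "0 \<le> k" "t \<le> T" for k t
      using that s0 by (auto intro!: mult_left_mono)
    have xR: "(1 + norm \<xi>) * exp (C * (t - s)) \<le> R" if "t \<le> T" for t
      unfolding R_def using e[of C t] that nonneg b by (intro mult_mono) auto
    note X = path_set_properties[OF P(1) nonneg(1) s0(2)]
    show "K-lipschitz_on {s..T} x"
      by (rule lipschitz_on_le[OF X(3)]) (use xR[of T] K nonneg in \<open>auto intro: order_trans[OF mult_left_mono]\<close>)
    have X1: "norm (x t) \<le> K" if "t \<in> {s..T}" for t
      using X(1)[OF that] xR[of t] that K by simp
    define N' where "N' = C * ((1 + norm \<xi>) * exp (C * T)) * (1 + 2 * norm z) + La"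
    have N': "0 \<le> N'" "N' \<le> N"
      using nonneg b unfolding N'_def N_def R_def
      by (auto intro!: mult_mono add_mono)
    note Y = path_set_properties[OF P(6)[folded N'_def] N'(1) s0(2)]
    have yR: "(1 + norm y0) * exp (N' * (t - s)) \<le> R2" if "t \<in> {s..T}" for t
    proof -
      have "N' * (t - s) \<le> N * T" using that N' s0 by (intro mult_mono) auto
      then show ?thesis unfolding R2_def using b by (intro mult_mono) auto
    qed
    have "N' * ((1 + norm y0) * exp (N' * (T - s))) \<le> N * R2"
      using N' yR[of T] s0 by (intro mult_mono) auto
    then show "K-lipschitz_on {s..T} y"
      by (intro lipschitz_on_le[OF Y(3)]) (use K in auto)
    fix t assume t: "t \<in> {s..T}"
    show "norm (x t) \<le> K" by (rule X1[OF t])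
    show "\<bar>y t\<bar> \<le> K" using Y(1)[OF t] yR[OF t] K by simp
  qed
qed

text \<open>
  The bound on the speed is nondecreasing in time, so on \<open>[r, t]\<close> its value at \<open>t\<close> serves. In
  this integrated form the speed bound survives uniform limits.
\<close>

lemma path_set_increment:
  fixes x :: "real \<Rightarrow> 'a"
  assumes x: "x \<in> path_set T C s \<xi>" and s: "s \<le> T" and st: "s \<le> r" "r \<le> t" "t \<le> T"
    and b: "\<And>u. u \<in> {s..t} \<Longrightarrow> norm (x u) \<le> b"
  shows "norm (x t - x r) \<le> C * (1 + b) * (t - r)"
proof -
  note lp = path_set_properties(4)[OF x nonneg(1) s]
  have ae: "AE t in lebesgue. t \<in> {s<..<T} \<longrightarrow> x differentiable (at t) \<and>
        norm (vector_derivative x (at t)) \<le> C * (1 + (SUP r\<in>{s..t}. norm (x r)))"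
    using x by (auto simp: path_set_def)
  have "norm (x t - x r) \<le> C * (1 + b) * (t - r) - C * (1 + b) * (r - r)"
  proof (rule lipschitz_primitive_norm_le[OF lipschitz_primitive_subinterval[OF lp] lipschitz_primitive_linear])
    show "AE u in lebesgue. u \<in> {r<..<t} \<longrightarrow> norm (vector_derivative x (at u)) \<le> C * (1 + b)"
      using ae
    proof eventually_elim
      case (elim u)
      show ?case
      proof
        assume u: "u \<in> {r<..<t}"
        have "(SUP r\<in>{s..u}. norm (x r)) \<le> b"
          by (rule cSUP_least) (use u st b in auto)
        then have "C * (1 + (SUP r\<in>{s..u}. norm (x r))) \<le> C * (1 + b)" using nonneg by (intro mult_left_mono) auto
        then show "norm (vector_derivative x (at u)) \<le> C * (1 + b)" using elim u st by auto
      qed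
    qed
  qed (use st in auto)
  then show ?thesis by simp
qed

text \<open>
  The limit is Lipschitz, hence differentiable almost everywhere. At such a time the increments
  from the left obey the integrated speed bound of the approximating paths, which bounds the derivative.
\<close>

lemma path_set_limit:
  fixes x :: "nat \<Rightarrow> real \<Rightarrow> 'a"
  assumes x: "\<And>n. x n \<in> path_set T C s \<xi>" and s: "s \<in> {0..T}"
    and lim: "\<And>e. 0 < e \<Longrightarrow> \<exists>N. \<forall>n\<ge>N. \<forall>t\<in>{s..T}. norm (x n t - x' t) < e"
  shows "x' \<in> path_set T C s \<xi>"
proof -
  have s0: "s \<le> T" using s by auto
  have pt: "(\<lambda>n. x n t) \<longlonglongrightarrow> x' t" if "t \<in> {s..T}" for t
  proof (rule LIMSEQ_I)
    fix e :: real assume "0 < e"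
    from lim[OF this] that show "\<exists>N. \<forall>n\<ge>N. norm (x n t - x' t) < e" by meson
  qed
  define K where "K = C * ((1 + norm \<xi>) * exp (C * (T - s)))"
  have Kn: "K-lipschitz_on {s..T} (x n)" for n
    unfolding K_def by (rule path_set_properties(3)[OF x nonneg(1) s0])
  have K: "K-lipschitz_on {s..T} x'"
  proof (rule lipschitz_onI)
    fix r t assume rt: "r \<in> {s..T}" "t \<in> {s..T}"
    have "(\<lambda>n. dist (x n r) (x n t)) \<longlonglongrightarrow> dist (x' r) (x' t)" by (intro tendsto_dist pt rt)
    then show "dist (x' r) (x' t) \<le> K * dist r t"
      by (rule LIMSEQ_le_const2) (use lipschitz_onD[OF Kn rt] in auto)
  qed (rule lipschitz_on_nonneg[OF Kn])
  note lp = lipschitz_has_primitive[OF K s0]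
  have xs: "x' s = \<xi>"
  proof -
    have "(\<lambda>n. x n s) \<longlonglongrightarrow> x' s" using s0 by (intro pt) auto
    moreover have "x n s = \<xi>" for n using x[of n] by (simp add: path_set_def)
    ultimately show ?thesis by (simp add: LIMSEQ_const_iff)
  qed
  have "AE t in lebesgue. t \<in> {s<..<T} \<longrightarrow> x' differentiable (at t) \<and>
        norm (vector_derivative x' (at t)) \<le> C * (1 + (SUP r\<in>{s..t}. norm (x' r)))"
    using lipschitz_primitiveD(2)[OF lp]
  proof eventually_elim
    case (elim t)
    show ?case
    proof
      assume t: "t \<in> {s<..<T}"
      then have d: "(x' has_vector_derivative vector_derivative x' (at t)) (at t)" using elim by blast
      define m where "m = (SUP r\<in>{s..t}. norm (x' r))"
      have "bounded ((\<lambda>r. norm (x' r)) ` {s..t})"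
        using continuous_on_subset[OF lipschitz_primitiveD(4)[OF lp], of "{s..t}"] t
        by (intro compact_imp_bounded compact_continuous_image continuous_on_norm) auto
      then have m: "norm (x' u) \<le> m" if "u \<in> {s..t}" for u
        unfolding m_def using that by (intro cSUP_upper bounded_imp_bdd_above) auto
      have incr: "norm (x' t - x' r) \<le> C * (1 + m) * (t - r)" if r: "r \<in> {s..t}" for r
      proof (rule field_le_epsilon)
        fix e :: real assume "e > 0"
        define e' where "e' = e / (C * (t - r) + 2)"
        have Ctr: "C * (t - r) \<ge> 0" using r nonneg by auto
        have e': "e' > 0" "(C * (t - r) + 2) * e' = e" using \<open>e > 0\<close> Ctr by (auto simp: e'_def)
        obtain n where n: "\<And>u. u \<in> {s..T} \<Longrightarrow> norm (x n u - x' u) < e'" using lim[OF e'(1)] by blast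
        have "norm (x n t - x n r) \<le> C * (1 + (m + e')) * (t - r)"
        proof (rule path_set_increment[OF x s0])
          fix u assume u: "u \<in> {s..t}"
          then have "u \<in> {s..T}" using t by auto
          with n[of u] m[OF u] show "norm (x n u) \<le> m + e'" using norm_triangle_sub[of "x n u" "x' u"] by linarith
        qed (use r t in auto)
        moreover have "norm (x' t - x' r) \<le> norm (x n t - x' t) + norm (x n t - x n r) + norm (x n r - x' r)"
        proof -
          have "x' t - x' r = (x n t - x n r) - (x n t - x' t) + (x n r - x' r)" by simp
          then have "norm (x' t - x' r) \<le> norm ((x n t - x n r) - (x n t - x' t)) + norm (x n r - x' r)"
            by (metis norm_triangle_ineq)
          then show ?thesis using norm_triangle_ineq4[of "x n t - x n r" "x n t - x' t"] by linarith
        qed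
        moreover have "norm (x n t - x' t) < e'" "norm (x n r - x' r) < e'" using r t by (auto intro!: n)
        ultimately have "norm (x' t - x' r) \<le> C * (1 + (m + e')) * (t - r) + 2 * e'" by linarith
        also have "\<dots> = C * (1 + m) * (t - r) + (C * (t - r) + 2) * e'" by (simp add: algebra_simps)
        finally show "norm (x' t - x' r) \<le> C * (1 + m) * (t - r) + e" by (simp only: e'(2))
      qed
      have "norm (vector_derivative x' (at t)) \<le> C * (1 + m)"
      proof (rule has_vector_derivative_norm_le_left[OF d, of s])
        fix r assume "r \<in> {s..t}"
        with incr[OF this] show "norm (x' r - x' t) \<le> C * (1 + m) * norm (r - t)"
          by (simp add: norm_minus_commute)
      qed (use t in auto)
      then show "x' differentiable (at t) \<and> norm (vector_derivative x' (at t)) \<le> C * (1 + (SUP r\<in>{s..t}. norm (x' r)))"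
        using differentiableI_vector[OF d] by (simp add: m_def)
    qed
  qed
  then show ?thesis
    unfolding path_set_def using xs lipschitz_imp_absolutely_continuous[OF K] by blast
qed

text \<open>
  Arzela-Ascoli for the pairs. The derivatives of the \<open>x n\<close> need not converge, but they enter
  the equation for \<open>y n\<close> only through \<open>x n \<bullet> z\<close>, so that \<open>y n - x n \<bullet> z\<close> has derivative
  \<open>- H t (x n) (y n) z\<close>, which converges uniformly.
\<close>

lemma path_pair_compact:
  assumes xy: "\<And>n. (x n, y n) \<in> path_pair_set T H C s \<xi> y0 z" and s: "s \<in> {0..T}"
  obtains k x' y' where "strict_mono (k :: nat \<Rightarrow> nat)" "(x', y') \<in> path_pair_set T H C s \<xi> y0 z"
    "\<And>t. t \<in> {s..T} \<Longrightarrow> (\<lambda>n. x (k n) t) \<longlonglongrightarrow> x' t" "\<And>t. t \<in> {s..T} \<Longrightarrow> (\<lambda>n. y (k n) t) \<longlonglongrightarrow> y' t"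
proof -
  have s0: "0 \<le> s" "s \<le> T" using s by auto
  obtain K where K: "K \<ge> 0" "\<And>n. K-lipschitz_on {s..T} (x n)" "\<And>n. K-lipschitz_on {s..T} (y n)"
    "\<And>n t. t \<in> {s..T} \<Longrightarrow> norm (x n t) \<le> K" "\<And>n t. t \<in> {s..T} \<Longrightarrow> \<bar>y n t\<bar> \<le> K"
    using path_pair_uniform_bounds[of "norm \<xi>" "\<bar>y0\<bar>" "norm z"] s xy by (metis order_refl)
  define F where "F n t = (x n t, y n t)" for n t
  obtain g k where k: "strict_mono (k :: nat \<Rightarrow> nat)"
    and gk: "\<And>e. 0 < e \<Longrightarrow> \<exists>N. \<forall>n t. n \<ge> N \<and> t \<in> {s..T} \<longrightarrow> norm (F (k n) t - g t) < e"
  proof (rule Arzela_Ascoli[of "{s..T}" F "2 * K"])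
    show "compact {s..T}" by simp
    show "norm (F n t) \<le> 2 * K" if "t \<in> {s..T}" for n t
      using norm_Pair_le[of "x n t" "y n t"] K(4,5)[OF that, of n] unfolding F_def real_norm_def by linarith
    fix t e :: real assume t: "t \<in> {s..T}" and "0 < e"
    show "\<exists>d. 0 < d \<and> (\<forall>n r. r \<in> {s..T} \<and> norm (t - r) < d \<longrightarrow> norm (F n t - F n r) < e)"
    proof (intro exI[of _ "e / (2 * K + 1)"] conjI allI impI)
      show "0 < e / (2 * K + 1)" using \<open>e > 0\<close> K by simp
      fix n r assume r: "r \<in> {s..T} \<and> norm (t - r) < e / (2 * K + 1)"
      have "norm (F n t - F n r) \<le> norm (x n t - x n r) + norm (y n t - y n r)"
        unfolding F_def using norm_Pair_le[of "x n t - x n r" "y n t - y n r"] by simp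
      also have "\<dots> \<le> K * norm (t - r) + K * norm (t - r)"
        using r t by (intro add_mono lipschitz_on_normD[OF K(2)] lipschitz_on_normD[OF K(3)]) auto
      also have "\<dots> \<le> (2 * K + 1) * norm (t - r)" by (simp add: algebra_simps)
      also have "\<dots> < e" using r K(1) by (simp add: pos_less_divide_eq mult.commute)
      finally show "norm (F n t - F n r) < e" .
    qed
  qed auto
  define x' where "x' t = fst (g t)" for t
  define y' where "y' t = snd (g t)" for t
  have ux: "\<exists>N. \<forall>n\<ge>N. \<forall>t\<in>{s..T}. norm (x (k n) t - x' t) < e \<and> \<bar>y (k n) t - y' t\<bar> < e" if e: "0 < e" for e
  proof -
    obtain N where N: "\<And>n t. n \<ge> N \<Longrightarrow> t \<in> {s..T} \<Longrightarrow> norm (F (k n) t - g t) < e" using gk[OF e] by blast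
    have "norm (x (k n) t - x' t) < e \<and> \<bar>y (k n) t - y' t\<bar> < e" if "n \<ge> N" "t \<in> {s..T}" for n t
    proof -
      have "F (k n) t - g t = (x (k n) t - x' t, y (k n) t - y' t)"
        by (simp add: F_def x'_def y'_def prod_eq_iff)
      then have "norm (x (k n) t - x' t, y (k n) t - y' t) < e" using N[OF that] by simp
      then show ?thesis
        using norm_fst_le[of "x (k n) t - x' t" "y (k n) t - y' t"] norm_snd_le[of "y (k n) t - y' t" "x (k n) t - x' t"]
        unfolding real_norm_def by linarith
    qed
    then show ?thesis by blast
  qed
  have limx: "(\<lambda>n. x (k n) t) \<longlonglongrightarrow> x' t" and limy: "(\<lambda>n. y (k n) t) \<longlonglongrightarrow> y' t" if "t \<in> {s..T}" for t
  proof -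
    show "(\<lambda>n. x (k n) t) \<longlonglongrightarrow> x' t"
      by (rule LIMSEQ_I) (use ux that in meson)
    show "(\<lambda>n. y (k n) t) \<longlonglongrightarrow> y' t"
      by (rule LIMSEQ_I, unfold real_norm_def) (use ux that in meson)
  qed
  note Pn = path_pairD[OF s xy]
  have x': "x' \<in> path_set T C s \<xi>"
    by (rule path_set_limit[of "\<lambda>n. x (k n)", OF Pn(1) s]) (use ux in blast)
  note lpx' = path_set_properties(4)[OF x' nonneg(1) s0(2)]
  have x's: "x' s = \<xi>" using x' by (simp add: path_set_def)
  have ylip: "K-lipschitz_on {s..T} y'"
  proof (rule lipschitz_onI)
    fix r t assume rt: "r \<in> {s..T}" "t \<in> {s..T}"
    have "(\<lambda>n. dist (y (k n) r) (y (k n) t)) \<longlonglongrightarrow> dist (y' r) (y' t)" by (intro tendsto_dist limy rt)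
    then show "dist (y' r) (y' t) \<le> K * dist r t"
      by (rule LIMSEQ_le_const2) (use lipschitz_onD[OF K(3) rt] in auto)
  qed (rule K(1))
  have y'K: "\<bar>y' t\<bar> \<le> K" and x'K: "norm (x' t) \<le> K" if t: "t \<in> {s..T}" for t
  proof -
    show "\<bar>y' t\<bar> \<le> K" by (rule LIMSEQ_le_const2[OF tendsto_rabs[OF limy[OF t]]]) (use K(5)[OF t] in auto)
    show "norm (x' t) \<le> K" by (rule LIMSEQ_le_const2[OF tendsto_norm[OF limx[OF t]]]) (use K(4)[OF t] in auto)
  qed
  define G where "G t = H t (x' t) (y' t) z" for t
  have Gb: "\<bar>G t\<bar> \<le> C * (1 + K) * (1 + norm z) + La * K" if t: "t \<in> {s..T}" for t
  proof -
    have "C * (1 + norm (x' t)) * (1 + norm z) + La * \<bar>y' t\<bar> \<le> C * (1 + K) * (1 + norm z) + La * K"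
      using x'K[OF t] y'K[OF t] nonneg by (intro add_mono mult_right_mono mult_left_mono) auto
    then show ?thesis using H_bound[of t "x' t" "y' t" z] unfolding G_def by linarith
  qed
  have "G \<in> borel_measurable (lebesgue_on {s..T})"
    unfolding G_def
    by (rule H_measurable_along[OF lipschitz_primitiveD(4)[OF lpx'] lipschitz_on_continuous_on[OF ylip] s0(1) order_refl])
  then have "set_integrable lebesgue {s..T} G"
    by (rule set_integrable_bounded[where M="C * (1 + K) * (1 + norm z) + La * K"]) (use Gb in auto)
  then have GI: "lipschitz_primitive s T (\<lambda>t. LINT r:{s..t}|lebesgue. G r) G"
    by (rule lipschitz_primitive_integral[where M="C * (1 + K) * (1 + norm z) + La * K"]) (use Gb nonneg K(1) in auto)
  define Y where "Y t = y0 - \<xi> \<bullet> z + x' t \<bullet> z - (LINT r:{s..t}|lebesgue. G r)" for t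
  have Y: "lipschitz_primitive s T Y (\<lambda>t. 0 + vector_derivative x' (at t) \<bullet> z - G t)"
    unfolding Y_def
    by (intro lipschitz_primitive_diff lipschitz_primitive_add lipschitz_primitive_const lipschitz_primitive_inner_const lpx' GI)
  have Ys: "Y s = y0"
    using lipschitz_primitive_set_integrable(2)[OF lipschitz_primitive_subinterval[OF GI, of s s]] s0 x's by (simp add: Y_def)
  have "y' t = Y t" if t: "t \<in> {s..T}" for t
  proof -
    define c where "c = L * (1 + norm z + K) + La"
    have c0: "c \<ge> 0" using nonneg K(1) by (simp add: c_def)
    define Dn where "Dn n r = (y (k n) r - x (k n) r \<bullet> z) - (Y r - x' r \<bullet> z)" for n r
    have "(\<lambda>n. Dn n t) \<longlonglongrightarrow> 0"
    proof (rule LIMSEQ_I)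
      fix e :: real assume "e > 0"
      define e' where "e' = e / (c * (T - s) + 1)"
      have cT: "c * (T - s) \<ge> 0" using c0 s0 by auto
      have e': "e' > 0" "c * (T - s) * e' < e" using \<open>e > 0\<close> cT by (auto simp: e'_def field_simps)
      obtain N where N: "\<And>n t. n \<ge> N \<Longrightarrow> t \<in> {s..T} \<Longrightarrow> norm (x (k n) t - x' t) < e' \<and> \<bar>y (k n) t - y' t\<bar> < e'"
        using ux[OF e'(1)] by blast
      show "\<exists>N. \<forall>n\<ge>N. norm (Dn n t - 0) < e"
      proof (intro exI[of _ N] allI impI)
        fix n assume n: "N \<le> n"
        have lpD: "lipschitz_primitive s T (Dn n) (\<lambda>r. (vector_derivative (x (k n)) (at r) \<bullet> z - H r (x (k n) r) (y (k n) r) z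
            - vector_derivative (x (k n)) (at r) \<bullet> z) - (0 + vector_derivative x' (at r) \<bullet> z - G r - vector_derivative x' (at r) \<bullet> z))"
          unfolding Dn_def
          by (intro lipschitz_primitive_diff lipschitz_primitive_inner_const Pn(4,5) Y lpx')
        have "norm (Dn n t - Dn n s) \<le> c * e' * (t - s) - c * e' * (s - s)"
        proof (rule lipschitz_primitive_norm_le[OF lipschitz_primitive_subinterval[OF lpD] lipschitz_primitive_linear])
          show "AE r in lebesgue. r \<in> {s<..<t} \<longrightarrow> norm ((vector_derivative (x (k n)) (at r) \<bullet> z - H r (x (k n) r) (y (k n) r) z
            - vector_derivative (x (k n)) (at r) \<bullet> z) - (0 + vector_derivative x' (at r) \<bullet> z - G r - vector_derivative x' (at r) \<bullet> z)) \<le> c * e'"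
          proof (intro AE_I2 impI)
            fix r assume "r \<in> {s<..<t}"
            then have r: "r \<in> {s..T}" using t by auto
            have "\<bar>H r (x (k n) r) (y (k n) r) z - G r\<bar> \<le> L * (1 + norm z + \<bar>y (k n) r\<bar>) * norm (x (k n) r - x' r) + La * \<bar>y (k n) r - y' r\<bar>"
              unfolding G_def by (rule H_Lipschitz)
            also have "\<dots> \<le> L * (1 + norm z + K) * e' + La * e'"
              using N[OF n r] K(5)[OF r, of "k n"] nonneg K(1)
              by (intro add_mono mult_mono mult_left_mono) auto
            also have "\<dots> = c * e'" by (simp add: c_def algebra_simps)
            finally show "norm ((vector_derivative (x (k n)) (at r) \<bullet> z - H r (x (k n) r) (y (k n) r) z
            - vector_derivative (x (k n)) (at r) \<bullet> z) - (0 + vector_derivative x' (at r) \<bullet> z - G r - vector_derivative x' (at r) \<bullet> z)) \<le> c * e'"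
              by (simp add: abs_minus_commute)
          qed
        qed (use t in auto)
        moreover have "Dn n s = 0" using Pn(2,3) Ys x's by (simp add: Dn_def)
        moreover have "c * e' * (t - s) \<le> c * e' * (T - s)"
          using t c0 e'(1) by (intro mult_left_mono) auto
        ultimately show "norm (Dn n t - 0) < e" using e'(2) by (simp add: mult_ac)
      qed
    qed
    moreover have "(\<lambda>n. Dn n t) \<longlonglongrightarrow> (y' t - x' t \<bullet> z) - (Y t - x' t \<bullet> z)"
      unfolding Dn_def by (intro tendsto_intros limx limy t)
    ultimately have "0 = (y' t - x' t \<bullet> z) - (Y t - x' t \<bullet> z)" by (rule LIMSEQ_unique)
    then show ?thesis by simp
  qed
  then have "lipschitz_primitive s T y' (\<lambda>t. 0 + vector_derivative x' (at t) \<bullet> z - G t)" "y' s = y0"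
    using lipschitz_primitive_transform[OF Y, of y'] Ys s0 by auto
  then have "(x', y') \<in> path_pair_set T H C s \<xi> y0 z"
    by (intro path_pairI s x') (simp_all add: G_def)
  then show ?thesis using that k limx limy by blast
qed

text \<open>
  The sign \<open>\<sigma>\<close> covers characteristics above \<open>W\<close> and below \<open>W\<close> together.
\<close>

lemma approximate_characteristics_suffice:
  assumes W: "continuous_on ({0..T} \<times> UNIV) (\<lambda>(t, \<xi>). W t \<xi> :: real)" and s: "s \<in> {0..T}"
    and approx: "\<And>e. e > 0 \<Longrightarrow> \<exists>(x, y)\<in>path_pair_set T H C s \<xi> y0 z. \<forall>t\<in>{s..T}. \<sigma> * (y t - W t (x t)) \<ge> - e"
  shows "\<exists>(x, y)\<in>path_pair_set T H C s \<xi> y0 z. \<forall>t\<in>{s..T}. \<sigma> * (y t - W t (x t)) \<ge> 0"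
proof -
  have "\<exists>p\<in>path_pair_set T H C s \<xi> y0 z. \<forall>t\<in>{s..T}. \<sigma> * (snd p t - W t (fst p t)) \<ge> - (1 / real (Suc n))" for n
    using approx[of "1 / real (Suc n)"] by (auto simp: split_beta)
  then obtain p where p: "\<And>n. p n \<in> path_pair_set T H C s \<xi> y0 z"
    "\<And>n t. t \<in> {s..T} \<Longrightarrow> \<sigma> * (snd (p n) t - W t (fst (p n) t)) \<ge> - (1 / real (Suc n))" by metis
  obtain k x' y' where k: "strict_mono (k :: nat \<Rightarrow> nat)" "(x', y') \<in> path_pair_set T H C s \<xi> y0 z"
    "\<And>t. t \<in> {s..T} \<Longrightarrow> (\<lambda>n. fst (p (k n)) t) \<longlonglongrightarrow> x' t" "\<And>t. t \<in> {s..T} \<Longrightarrow> (\<lambda>n. snd (p (k n)) t) \<longlonglongrightarrow> y' t"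
    using path_pair_compact[of "\<lambda>n. fst (p n)" "\<lambda>n. snd (p n)" s \<xi> y0 z] p(1) s by auto
  have "\<sigma> * (y' t - W t (x' t)) \<ge> 0" if t: "t \<in> {s..T}" for t
  proof -
    have tT: "t \<in> {0..T}" using s t by auto
    have "(\<lambda>n. (t, fst (p (k n)) t)) \<longlonglongrightarrow> (t, x' t)" by (intro tendsto_intros k(3) t)
    from continuous_on_tendsto_compose[OF W this] tT
    have "(\<lambda>n. W t (fst (p (k n)) t)) \<longlonglongrightarrow> W t (x' t)" by (simp add: always_eventually)
    then have l: "(\<lambda>n. \<sigma> * (snd (p (k n)) t - W t (fst (p (k n)) t))) \<longlonglongrightarrow> \<sigma> * (y' t - W t (x' t))"
      by (intro tendsto_intros k(4) t)
    have "(\<lambda>n. - (1 / real (Suc n))) \<longlonglongrightarrow> 0"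
      using tendsto_minus[OF LIMSEQ_inverse_real_of_nat] by (simp add: inverse_eq_divide)
    moreover have "((\<lambda>n. - (1 / real (Suc n))) \<circ> k) \<longlonglongrightarrow> 0"
      by (rule LIMSEQ_subseq_LIMSEQ[OF calculation k(1)])
    ultimately show ?thesis
      by (intro LIMSEQ_le[OF _ l, of "(\<lambda>n. - (1 / real (Suc n))) \<circ> k" 0]) (use p(2)[OF t] in auto)
  qed
  then show ?thesis using k(2) by (intro bexI[of _ "(x', y')"]) auto
qed

section \<open>The value function is a minimax solution\<close>

lemma controlled_pair_in_path_pair_set:
  assumes a: "a \<in> controls T A" and s: "s \<in> {0..T}" and X: "lipschitz_primitive s T X (\<lambda>r. f r (X r) (a r))"
    and y: "lipschitz_primitive s T y (\<lambda>t. f t (X t) (a t) \<bullet> z - H t (X t) (y t) z)"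
  shows "(X, y) \<in> path_pair_set T H C s (X s) (y s) z"
proof (rule path_pairI[OF s _ refl])
  show "X \<in> path_set T C s (X s)" by (rule trajectory_in_path_set[OF a _ _ X]) (use s in auto)
  show "lipschitz_primitive s T y (\<lambda>t. vector_derivative X (at t) \<bullet> z - H t (X t) (y t) z)"
  proof (rule lipschitz_primitive_cong[OF y])
    show "AE t in lebesgue. t \<in> {s<..<T} \<longrightarrow> f t (X t) (a t) \<bullet> z - H t (X t) (y t) z = vector_derivative X (at t) \<bullet> z - H t (X t) (y t) z"
      using lipschitz_primitiveD(2)[OF X] by eventually_elim (auto dest: vector_derivative_at)
  qed
qed

text \<open>
  The terms with the discount rate cancel those that the product rule produces, and what remains
  is the gap between \<open>Q\<close> at the chosen control and its infimum, whose sign is known.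
\<close>

lemma discounted_characteristic:
  assumes ev: "evolution a s T X E I"
    and y: "lipschitz_primitive s T y (\<lambda>t. f t (X t) (a t) \<bullet> z - H t (X t) (y t) z)"
  shows "lipschitz_primitive s T (\<lambda>t. I t + exp (- E t) * y t)
     (\<lambda>t. exp (- E t) * (Q t (X t) (y t) z (a t) - H t (X t) (y t) z))"
proof -
  have "lipschitz_primitive s T (\<lambda>t. - E t) (\<lambda>t. - lam t (X t) (a t))"
    using lipschitz_primitive_cmult[OF evolutionD(2)[OF ev], of "-1"] by simp
  then have "lipschitz_primitive s T (\<lambda>t. I t + exp (- E t) * y t)
     (\<lambda>t. exp (- E t) * ell t (X t) (a t) + (exp (- E t) * (f t (X t) (a t) \<bullet> z - H t (X t) (y t) z)
        + exp (- E t) * (- lam t (X t) (a t)) * y t))"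
    by (intro lipschitz_primitive_add lipschitz_primitive_mult lipschitz_primitive_exp evolutionD[OF ev] y)
  then show ?thesis by (rule lipschitz_primitive_cong) (simp add: Q_def algebra_simps)
qed

text \<open>
  For any control, \<open>I + exp (- E) y\<close> is nondecreasing. For a nearly optimal one it starts at least
  at the cost, up to the error, and the cost dominates \<open>I + exp (- E) v\<close> along the trajectory.
\<close>

lemma value_characteristics_above:
  assumes s: "s \<in> {0..T}" and y0: "y0 \<ge> v s \<xi>"
  shows "\<exists>(x, y)\<in>path_pair_set T H C s \<xi> y0 z. \<forall>t\<in>{s..T}. y t \<ge> v t (x t)"
proof -
  have s0: "0 \<le> s" "s \<le> T" using s by auto
  have "\<exists>(x, y)\<in>path_pair_set T H C s \<xi> y0 z. \<forall>t\<in>{s..T}. 1 * (y t - v t (x t)) \<ge> 0"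
  proof (rule approximate_characteristics_suffice[OF value_continuous s])
    fix e :: real assume "e > 0"
    \<comment> \<open>undoing the discount at the end may enlarge the error by the factor \<open>exp (La * T)\<close>\<close>
    define e' where "e' = e * exp (- (La * T))"
    have "e' > 0" using \<open>e > 0\<close> by (simp add: e'_def)
    then have "v s \<xi> < v s \<xi> + e'" by simp
    then obtain a where a: "a \<in> controls T A" and J: "J s \<xi> a < v s \<xi> + e'"
      unfolding value_function_def using cINF_less_iff[OF controls_nonempty cost_bdd_below[OF s]] by metis
    obtain X E I where i: "X s = \<xi>" "E s = 0" "I s = 0" and ev: "evolution a s T X E I" using evolution_exists[OF a s] by blast
    obtain y where ys: "y s = y0" and y: "lipschitz_primitive s T y (\<lambda>t. f t (X t) (a t) \<bullet> z - H t (X t) (y t) z)"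
      using controlled_pair_exists[OF a s evolutionD(1)[OF ev]] by blast
    have "y t - v t (X t) \<ge> - e" if t: "t \<in> {s..T}" for t
    proof -
      have "I s + exp (- E s) * y s \<le> I t + exp (- E t) * y t"
      proof (rule lipschitz_primitive_mono[OF lipschitz_primitive_subinterval[OF discounted_characteristic[OF ev y]]])
        show "AE r in lebesgue. r \<in> {s<..<t} \<longrightarrow> exp (- E r) * (Q r (X r) (y r) z (a r) - H r (X r) (y r) z) \<ge> 0"
        proof (intro AE_I2 impI)
          fix r assume "r \<in> {s<..<t}"
          then have "a r \<in> A" using s t by (intro controls_mem[OF a]) auto
          then show "exp (- E r) * (Q r (X r) (y r) z (a r) - H r (X r) (y r) z) \<ge> 0"
            using H_le_Q[of "a r" r "X r" "y r" z] by simp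
        qed
      qed (use t in auto)
      then have "y0 \<le> I t + exp (- E t) * y t" using i ys by simp
      moreover have "I t + exp (- E t) * v t (X t) \<le> J s \<xi> a"
        using dynamic_programming_ge[OF ev a s i(2,3) t] i by simp
      ultimately have "- e' \<le> exp (- E t) * (y t - v t (X t))" using J y0 by (simp add: algebra_simps)
      then have "exp (E t) * (- e') \<le> exp (E t) * (exp (- E t) * (y t - v t (X t)))" by (intro mult_left_mono) auto
      then have "- (exp (E t) * e') \<le> y t - v t (X t)" by (simp add: mult.assoc[symmetric] mult_exp_exp)
      moreover have "E t \<le> La * T"
      proof -
        have "La * (t - s) \<le> La * T" using t s0 nonneg by (intro mult_left_mono) auto
        then show ?thesis using evolution_bounds(3)[OF ev a s0(1) order_refl i(2,3) t] by linarith
      qed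
      then have "exp (E t) * exp (- (La * T)) \<le> 1" by (simp add: mult_exp_exp)
      then have "exp (E t) * exp (- (La * T)) * e \<le> 1 * e" using \<open>e > 0\<close> by (intro mult_right_mono) auto
      then have "exp (E t) * e' \<le> e" by (simp add: e'_def mult_ac)
      ultimately show ?thesis by linarith
    qed
    then show "\<exists>(x, y)\<in>path_pair_set T H C s \<xi> y0 z. \<forall>t\<in>{s..T}. 1 * (y t - v t (x t)) \<ge> - e"
      using controlled_pair_in_path_pair_set[OF a s evolutionD(1)[OF ev] y] i ys
      by (intro bexI[of _ "(X, y)"]) auto
  qed
  then show ?thesis by auto
qed

text \<open>
  The feedback law depends on the state, which in turn depends on the control. On a fine time
  grid the state is frozen at the beginning of each interval, where the selector for fixed arguments
  applies; the Lipschitz bounds for \<open>Q\<close>, \<open>H\<close> and the characteristic, which are uniform over all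
  controls, pay for freezing. The induction replaces the control from a grid point on, which leaves
  the state up to that point unchanged.
\<close>

lemma near_minimizing_control:
  assumes s: "s \<in> {0..T}" and "\<delta> > 0"
  shows "\<exists>a X y. a \<in> controls T A \<and> X s = \<xi> \<and> y s = y0 \<and> lipschitz_primitive s T X (\<lambda>r. f r (X r) (a r)) \<and>
     lipschitz_primitive s T y (\<lambda>t. f t (X t) (a t) \<bullet> z - H t (X t) (y t) z) \<and>
     (\<forall>t\<in>{s..<T}. Q t (X t) (y t) z (a t) \<le> H t (X t) (y t) z + \<delta>)"
proof -
  have s0: "0 \<le> s" "s \<le> T" using s by auto
  define sol where "sol a X y \<longleftrightarrow> a \<in> controls T A \<and> X s = \<xi> \<and> y s = y0 \<and> lipschitz_primitive s T X (\<lambda>r. f r (X r) (a r)) \<and>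
     lipschitz_primitive s T y (\<lambda>t. f t (X t) (a t) \<bullet> z - H t (X t) (y t) z)" for a X y
  have ex: "\<exists>X y. sol a X y" if a: "a \<in> controls T A" for a
  proof -
    obtain X where X: "X s = \<xi>" "lipschitz_primitive s T X (\<lambda>r. f r (X r) (a r))"
      using trajectory_exists[OF a s] by blast
    obtain y where "y s = y0" "lipschitz_primitive s T y (\<lambda>t. f t (X t) (a t) \<bullet> z - H t (X t) (y t) z)"
      using controlled_pair_exists[OF a s X(2)] by blast
    then show ?thesis using a X unfolding sol_def by blast
  qed
  obtain K where K: "K \<ge> 0" "\<And>x y. (x, y) \<in> path_pair_set T H C s \<xi> y0 z \<Longrightarrow> K-lipschitz_on {s..T} x \<and> K-lipschitz_on {s..T} y \<and>
     (\<forall>t\<in>{s..T}. norm (x t) \<le> K \<and> \<bar>y t\<bar> \<le> K)"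
    using path_pair_uniform_bounds[of "norm \<xi>" "\<bar>y0\<bar>" "norm z"] s by (metis order_refl)
  have solK: "K-lipschitz_on {s..T} X" "K-lipschitz_on {s..T} y" "\<And>t. t \<in> {s..T} \<Longrightarrow> \<bar>y t\<bar> \<le> K" if "sol a X y" for a X y
    using K(2)[of X y] controlled_pair_in_path_pair_set[of a s X y z] that s unfolding sol_def by auto
  define c where "c = (L * (1 + norm z + K) + La) * K"
  have c0: "c \<ge> 0" using nonneg K(1) by (simp add: c_def)
  \<comment> \<open>mesh of the grid: freezing costs at most \<open>c * \<eta>\<close>, once for \<open>Q\<close> and once for \<open>H\<close>\<close>
  define \<eta> where "\<eta> = \<delta> / (4 * (c + 1))"
  have \<eta>: "\<eta> > 0" "2 * (c * \<eta>) \<le> \<delta> / 2"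
    using \<open>\<delta> > 0\<close> c0 by (auto simp: \<eta>_def field_simps)
  have "\<exists>a X y. sol a X y \<and> (\<forall>t\<in>{s..<T}. t < s + real i * \<eta> \<longrightarrow> Q t (X t) (y t) z (a t) \<le> H t (X t) (y t) z + \<delta>)" for i
  proof (induction i)
    case 0
    obtain a where "a \<in> controls T A" using controls_nonempty by blast
    then show ?case using ex[of a] by auto
  next
    case (Suc i)
    then obtain a X y where sol: "sol a X y"
      and Qle: "\<And>t. t \<in> {s..<T} \<Longrightarrow> t < s + real i * \<eta> \<Longrightarrow> Q t (X t) (y t) z (a t) \<le> H t (X t) (y t) z + \<delta>" by blast
    define \<tau> where "\<tau> = s + real i * \<eta>"
    have s\<tau>: "s \<le> \<tau>" using \<eta> by (simp add: \<tau>_def)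
    show ?case
    proof (cases "\<tau> < T")
      case False
      then show ?thesis using sol Qle by (auto simp: \<tau>_def intro!: exI[of _ a] exI[of _ X] exI[of _ y])
    next
      case True
      obtain b where b: "b \<in> controls T A" "\<And>t. Q t (X \<tau>) (y \<tau>) z (b t) \<le> H t (X \<tau>) (y \<tau>) z + \<delta> / 2"
        using near_minimizing_selector[OF half_gt_zero[OF \<open>\<delta> > 0\<close>]] by blast
      define c' where "c' r = (if r < \<tau> then a r else b r)" for r
      have a: "a \<in> controls T A" using sol by (simp add: sol_def)
      have c': "c' \<in> controls T A" unfolding c'_def by (rule splice_controls[OF a b(1)])
      obtain X' y' where sol': "sol c' X' y'" using ex[OF c'] by blast
      have XX: "X' r = X r" if r: "r \<in> {s..\<tau>}" for r
      proof -
        have "lipschitz_primitive s \<tau> X (\<lambda>r. f r (X r) (a r))" "lipschitz_primitive s \<tau> X' (\<lambda>r. f r (X' r) (c' r))"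
          using sol sol' True unfolding sol_def by (auto intro: lipschitz_primitive_subinterval)
        moreover from this(2) have "lipschitz_primitive s \<tau> X' (\<lambda>r. f r (X' r) (a r))"
          by (rule lipschitz_primitive_cong) (auto simp: c'_def)
        ultimately have "norm (X' r - X r) \<le> exp (L * (r - s)) * norm (X' s - X s)"
          using True by (intro trajectory_stability[OF _ _ a s0(1) _ r]) auto
        then show ?thesis using sol sol' by (simp add: sol_def)
      qed
      have yy: "y' r = y r" if r: "r \<in> {s..\<tau>}" for r
      proof -
        have "norm (y' r - y r) \<le> exp (La * (r - s)) * norm (y' s - y s)"
        proof (rule ode_stability)
          show "lipschitz_primitive s r y (\<lambda>t. f t (X t) (a t) \<bullet> z - H t (X t) (y t) z)"
            "lipschitz_primitive s r y' (\<lambda>t. f t (X' t) (c' t) \<bullet> z - H t (X' t) (y' t) z)"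
            using sol sol' True r unfolding sol_def by (auto intro: lipschitz_primitive_subinterval)
          show "AE t in lebesgue. t \<in> {s<..<r} \<longrightarrow> norm ((f t (X' t) (c' t) \<bullet> z - H t (X' t) (y' t) z)
             - (f t (X t) (a t) \<bullet> z - H t (X t) (y t) z)) \<le> La * norm (y' t - y t)"
          proof (intro AE_I2 impI)
            fix t assume "t \<in> {s<..<r}"
            then have t: "t \<in> {s..\<tau>}" "t < \<tau>" using r by auto
            show "norm ((f t (X' t) (c' t) \<bullet> z - H t (X' t) (y' t) z)
             - (f t (X t) (a t) \<bullet> z - H t (X t) (y t) z)) \<le> La * norm (y' t - y t)"
              using H_Lipschitz[of t "X t" "y t" z "X t" "y' t"] t XX[OF t(1)]
              by (simp add: c'_def abs_minus_commute)
          qed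
        qed (use r in auto)
        then show ?thesis using sol sol' by (simp add: sol_def)
      qed
      have "Q t (X' t) (y' t) z (c' t) \<le> H t (X' t) (y' t) z + \<delta>" if t: "t \<in> {s..<T}" "t < s + real (Suc i) * \<eta>" for t
      proof (cases "t < \<tau>")
        case True
        then show ?thesis using Qle[OF t(1)] XX[of t] yy[of t] t(1) by (simp add: \<tau>_def c'_def)
      next
        case False
        have t\<tau>: "t \<in> {s..T}" "\<tau> \<in> {s..T}" using t s\<tau> \<open>\<tau> < T\<close> by auto
        have "t < \<tau> + \<eta>" using t(2) by (simp add: \<tau>_def algebra_simps)
        then have t\<tau>\<eta>: "\<bar>t - \<tau>\<bar> \<le> \<eta>" using False by linarith
        have tA: "b t \<in> A" using t s0 by (intro controls_mem[OF b(1)]) auto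
        have X\<tau>: "X' \<tau> = X \<tau>" "y' \<tau> = y \<tau>" using XX yy s\<tau> by auto
        have "norm (X' t - X' \<tau>) \<le> K * \<eta>" "norm (y' t - y' \<tau>) \<le> K * \<eta>"
          using lipschitz_on_normD[OF solK(1)[OF sol'] t\<tau>(1,2)] lipschitz_on_normD[OF solK(2)[OF sol'] t\<tau>(1,2)]
            mult_left_mono[OF t\<tau>\<eta> K(1)] by auto
        then have d: "norm (X' t - X \<tau>) \<le> K * \<eta>" "\<bar>y' t - y \<tau>\<bar> \<le> K * \<eta>" by (simp_all add: X\<tau>)
        have "L * (1 + norm z + \<bar>y' t\<bar>) * norm (X' t - X \<tau>) + La * \<bar>y' t - y \<tau>\<bar>
           \<le> L * (1 + norm z + K) * (K * \<eta>) + La * (K * \<eta>)"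
          using solK(3)[OF sol' t\<tau>(1)] d nonneg K(1) by (intro add_mono mult_mono mult_left_mono) auto
        also have "\<dots> = c * \<eta>" by (simp add: c_def algebra_simps)
        finally have bd: "L * (1 + norm z + \<bar>y' t\<bar>) * norm (X' t - X \<tau>) + La * \<bar>y' t - y \<tau>\<bar> \<le> c * \<eta>" .
        have c't: "c' t = b t" using False by (simp add: c'_def)
        show ?thesis unfolding c't
          using b(2)[of t] Q_Lipschitz[OF tA, of t "X' t" "y' t" z "X \<tau>" "y \<tau>"]
            H_Lipschitz[of t "X' t" "y' t" z "X \<tau>" "y \<tau>"] bd \<eta>(2) by linarith
      qed
      then show ?thesis using sol' by blast
    qed
  qed
  moreover obtain n :: nat where n: "(T - s) / \<eta> < n" using reals_Archimedean2 by blast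
  then have "T < s + real n * \<eta>" using \<eta> by (simp add: pos_divide_less_eq algebra_simps)
  ultimately obtain a X y where "sol a X y" "\<forall>t\<in>{s..<T}. Q t (X t) (y t) z (a t) \<le> H t (X t) (y t) z + \<delta>"
    by (metis atLeastLessThan_iff order_less_trans)
  then show ?thesis unfolding sol_def by blast
qed

text \<open>
  For a nearly minimizing control, \<open>I + exp (- E) y\<close> hardly increases, while by dynamic
  programming \<open>I + exp (- E) v\<close> never falls below its initial value along a trajectory.
\<close>

lemma value_characteristics_below:
  assumes s: "s \<in> {0..T}" and y0: "y0 \<le> v s \<xi>"
  shows "\<exists>(x, y)\<in>path_pair_set T H C s \<xi> y0 z. \<forall>t\<in>{s..T}. y t \<le> v t (x t)"
proof -
  have s0: "0 \<le> s" "s \<le> T" using s by auto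
  have "\<exists>(x, y)\<in>path_pair_set T H C s \<xi> y0 z. \<forall>t\<in>{s..T}. - 1 * (y t - v t (x t)) \<ge> 0"
  proof (rule approximate_characteristics_suffice[OF value_continuous s])
    fix e :: real assume "e > 0"
    define \<delta> where "\<delta> = e * exp (- (La * T)) / T"
    have \<delta>: "\<delta> > 0" "\<delta> * T = e * exp (- (La * T))" using \<open>e > 0\<close> T_pos by (auto simp: \<delta>_def)
    obtain a X y where a: "a \<in> controls T A" and Xs: "X s = \<xi>" and ys: "y s = y0"
      and X: "lipschitz_primitive s T X (\<lambda>r. f r (X r) (a r))"
      and y: "lipschitz_primitive s T y (\<lambda>t. f t (X t) (a t) \<bullet> z - H t (X t) (y t) z)"
      and Qle: "\<And>t. t \<in> {s..<T} \<Longrightarrow> Q t (X t) (y t) z (a t) \<le> H t (X t) (y t) z + \<delta>"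
      using near_minimizing_control[OF s \<delta>(1)] by blast
    obtain X' E I where i: "X' s = \<xi>" "E s = 0" "I s = 0" and ev': "evolution a s T X' E I" using evolution_exists[OF a s] by blast
    have XX: "X' r = X r" if "r \<in> {s..T}" for r
      using trajectory_stability[OF evolutionD(1)[OF ev'] X a s0(1) order_refl that] Xs i by simp
    have y': "lipschitz_primitive s T y (\<lambda>t. f t (X' t) (a t) \<bullet> z - H t (X' t) (y t) z)"
      by (rule lipschitz_primitive_cong[OF y]) (use XX in auto)
    have "y t - v t (X t) \<le> e" if t: "t \<in> {s..T}" for t
    proof -
      have Epos: "0 \<le> E r" if "r \<in> {s..T}" for r by (rule evolution_bounds(2)[OF ev' a s0(1) order_refl i(2,3) that])
      have "(I t + exp (- E t) * y t) - (I s + exp (- E s) * y s) \<le> \<delta> * (t - s) - \<delta> * (s - s)"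
      proof (rule lipschitz_primitive_le[OF lipschitz_primitive_subinterval[OF discounted_characteristic[OF ev' y']] lipschitz_primitive_linear])
        show "AE r in lebesgue. r \<in> {s<..<t} \<longrightarrow> exp (- E r) * (Q r (X' r) (y r) z (a r) - H r (X' r) (y r) z) \<le> \<delta>"
        proof (intro AE_I2 impI)
          fix r assume r: "r \<in> {s<..<t}"
          then have "r \<in> {s..T}" "r \<in> {s..<T}" using t by auto
          then have "exp (- E r) * (Q r (X' r) (y r) z (a r) - H r (X' r) (y r) z) \<le> exp (- E r) * \<delta>"
            using Qle[of r] XX[of r] by (intro mult_left_mono) auto
          also have "\<dots> \<le> 1 * \<delta>" using Epos[of r] \<open>r \<in> {s..T}\<close> \<delta>(1) by (intro mult_right_mono) auto
          finally show "exp (- E r) * (Q r (X' r) (y r) z (a r) - H r (X' r) (y r) z) \<le> \<delta>" by simp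
        qed
      qed (use t in auto)
      moreover have "\<delta> * (t - s) \<le> \<delta> * T" using t s0 \<delta>(1) by (intro mult_left_mono) auto
      ultimately have "I t + exp (- E t) * y t \<le> y0 + \<delta> * T" using i ys by simp
      moreover have "v s \<xi> \<le> I t + exp (- E t) * v t (X t)"
      proof -
        have "evolution a s t X' E I" by (rule evolution_subinterval[OF ev']) (use t in auto)
        from dynamic_programming_le[OF this a s0(1) _ _ i(2,3)] t XX[OF t] i(1) show ?thesis by simp
      qed
      ultimately have "exp (- E t) * (y t - v t (X t)) \<le> \<delta> * T" using y0 by (simp add: algebra_simps)
      then have "exp (E t) * (exp (- E t) * (y t - v t (X t))) \<le> exp (E t) * (\<delta> * T)" by (intro mult_left_mono) auto
      then have "y t - v t (X t) \<le> exp (E t) * (\<delta> * T)" by (simp add: mult.assoc[symmetric] mult_exp_exp)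
      also have "\<dots> = exp (E t) * exp (- (La * T)) * e" by (simp add: \<delta>(2))
      also have "\<dots> \<le> 1 * e"
      proof (rule mult_right_mono)
        have "La * (t - s) \<le> La * T" using t s0 nonneg by (intro mult_left_mono) auto
        then have "E t \<le> La * T" using evolution_bounds(3)[OF ev' a s0(1) order_refl i(2,3) t] by linarith
        then show "exp (E t) * exp (- (La * T)) \<le> 1" by (simp add: mult_exp_exp)
      qed (use \<open>e > 0\<close> in simp)
      finally show ?thesis by simp
    qed
    then show "\<exists>(x, y)\<in>path_pair_set T H C s \<xi> y0 z. \<forall>t\<in>{s..T}. - 1 * (y t - v t (x t)) \<ge> - e"
      using controlled_pair_in_path_pair_set[OF a s X y] Xs ys
      by (intro bexI[of _ "(X, y)"]) (auto simp: le_diff_eq diff_le_eq add.commute)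
  qed
  then show ?thesis by auto
qed

lemma value_minimax_solution: "minimax_solution T H h C v"
proof -
  have "lower_semicontinuous_on ({0..T} \<times> UNIV) (\<lambda>(t, \<xi>). v t \<xi>)" "upper_semicontinuous_on ({0..T} \<times> UNIV) (\<lambda>(t, \<xi>). v t \<xi>)"
    using value_continuous unfolding lower_semicontinuous_on_def upper_semicontinuous_on_def continuous_on_def
    by (auto intro: order_tendstoD)
  then show ?thesis
    unfolding minimax_solution_def minimax_supersolution_def minimax_subsolution_def
    using value_terminal value_characteristics_above value_characteristics_below by auto
qed

end

section \<open>Comparison of minimax solutions\<close>

lemma semicontinuous_imp_continuous_on:
  assumes "lower_semicontinuous_on S u" "upper_semicontinuous_on S u"
  shows "continuous_on S u"
  using assms unfolding continuous_on_def lower_semicontinuous_on_def upper_semicontinuous_on_def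
  by (auto intro!: order_tendstoI)

lemma quadratic_lower_bound:
  fixes p q b :: real
  assumes "p > 0"
  shows "p * q\<^sup>2 - b * q \<ge> - (b\<^sup>2 / (4 * p))"
proof -
  have "0 \<le> p * (q - b / (2 * p))\<^sup>2" using assms by simp
  also have "\<dots> = p * q\<^sup>2 - b * q + b\<^sup>2 / (4 * p)"
    using assms by (simp add: power2_diff power2_eq_square field_simps)
  finally show ?thesis by simp
qed

context control_data
begin

text \<open>
  The weight of the penalty. Differentiating the squared distance of two characteristics costs a
  factor \<open>2 L\<close>; the extra \<open>1\<close> in the exponent leaves a positive quadratic term, which absorbs the terms
  linear in the distance.
\<close>

definition decay :: "real \<Rightarrow> real" where "decay t = exp (- (2 * L + 1) * t)"

text \<open>
  With \<open>g = x - x'\<close>, the derivative of \<open>y - y' - k decay(t) |g|\<^sup>2\<close> consists of the following terms.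
  The derivatives of \<open>x\<close> and \<open>x'\<close> are paired with \<open>z - 2 k decay(t) g\<close>, which vanishes at \<open>\<tau>\<close> and so
  is of the order of the step. The Hamiltonians differ by at most \<open>L (1 + |z| + |y|) |g|\<close>, apart
  from their dependence on \<open>y\<close>, which is harmless by monotonicity as long as \<open>y' \<le> y\<close>, and this
  fails by at most the order of the step. Finally the weight contributes
  \<open>k (2 L + 1) decay(t) |g|\<^sup>2\<close>. The part \<open>L |z| |g|\<close> is compensated by \<open>2 L\<close> of the latter, and what
  is left of it dominates \<open>L (1 + |y|) |g|\<close> up to an error \<open>O(1 / k)\<close>, by completing the square.
  It is essential that the coefficient of \<open>1 / k\<close> involves only the bound \<open>M\<close> for \<open>y\<close> and not the
  Lipschitz constant \<open>Ky\<close>, which grows with \<open>k\<close>.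
\<close>

lemma doubled_characteristics_step:
  assumes \<tau>: "\<tau> \<in> {0..T}" "\<tau> \<le> \<tau>'" "\<tau>' \<le> T" and k: "k > 0"
    and xy: "(x, y) \<in> path_pair_set T H C \<tau> \<xi> y0 z" and xy': "(x', y') \<in> path_pair_set T H C \<tau> \<xi>' y0' z"
    and z: "z = (2 * k * decay \<tau>) *\<^sub>R (\<xi> - \<xi>')" and y0: "y0' \<le> y0"
    and xl: "Kx-lipschitz_on {\<tau>..T} x" "Kx-lipschitz_on {\<tau>..T} x'"
    and xb: "\<And>t. t \<in> {\<tau>..T} \<Longrightarrow> norm (x t) \<le> Kx" "\<And>t. t \<in> {\<tau>..T} \<Longrightarrow> norm (x' t) \<le> Kx"
    and yl: "Ky-lipschitz_on {\<tau>..T} y" "Ky-lipschitz_on {\<tau>..T} y'"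
    and yb: "\<And>t. t \<in> {\<tau>..\<tau>'} \<Longrightarrow> \<bar>y t\<bar> \<le> M"
  defines "e1 \<equiv> 4 * k * Kx * (2 * L + 2)"
  defines "m \<equiv> (L * (1 + M))\<^sup>2 / (4 * decay T) / k + (2 * La * Ky + (2 * Kx + 2 * Kx * L) * e1) * (\<tau>' - \<tau>)"
  shows "(y0 - y0' - k * decay \<tau> * (norm (\<xi> - \<xi>'))\<^sup>2) - m * (\<tau>' - \<tau>)
     \<le> y \<tau>' - y' \<tau>' - k * decay \<tau>' * (norm (x \<tau>' - x' \<tau>'))\<^sup>2"
proof -
  note P = path_pairD[OF \<tau>(1) xy] and P' = path_pairD[OF \<tau>(1) xy']
  define \<eta> where "\<eta> = \<tau>' - \<tau>"
  have \<eta>: "\<eta> \<ge> 0" using \<tau> by (simp add: \<eta>_def)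
  have Kx0: "Kx \<ge> 0" and Ky0: "Ky \<ge> 0" using xl yl by (auto dest: lipschitz_on_nonneg)
  have M0: "M \<ge> 0" using yb[of \<tau>] \<tau> by auto
  have e10: "e1 \<ge> 0" using k Kx0 nonneg by (simp add: e1_def)
  define F where "F t = (y t - y' t) - k * (decay t * (norm (x t - x' t))\<^sup>2)" for t
  define dF where "dF t = ((vector_derivative x (at t) \<bullet> z - H t (x t) (y t) z)
      - (vector_derivative x' (at t) \<bullet> z - H t (x' t) (y' t) z))
      - k * (decay t * (2 * ((x t - x' t) \<bullet> (vector_derivative x (at t) - vector_derivative x' (at t))))
             + (decay t * - (2 * L + 1)) * (norm (x t - x' t))\<^sup>2)" for t
  have dec: "lipschitz_primitive \<tau> T decay (\<lambda>t. decay t * - (2 * L + 1))"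
    using lipschitz_primitive_exp[OF lipschitz_primitive_linear[of \<tau> T "- (2 * L + 1)" 0]]
    unfolding decay_def[abs_def] by simp
  have lpF: "lipschitz_primitive \<tau> T F dF"
    unfolding F_def dF_def
    by (intro lipschitz_primitive_diff lipschitz_primitive_cmult lipschitz_primitive_mult lipschitz_primitive_norm_sq dec P(4,5) P'(4,5))
  have decmono: "decay b \<le> decay a" if "a \<le> b" for a b
    unfolding decay_def using that nonneg by (auto intro!: mult_left_mono_neg)
  have dec0: "0 < decay t" for t by (simp add: decay_def)
  have dec1: "decay t \<le> 1" if "t \<ge> 0" for t unfolding decay_def using that nonneg by (auto intro!: mult_nonpos_nonneg)
  have declip: "\<bar>decay a - decay b\<bar> \<le> (2 * L + 1) * (b - a)" if "0 \<le> a" "a \<le> b" for a b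
  proof -
    have "\<bar>exp (- ((2 * L + 1) * a)) - exp (- ((2 * L + 1) * b))\<bar> \<le> \<bar>(2 * L + 1) * a - (2 * L + 1) * b\<bar>"
      using that nonneg by (intro exp_minus_lip) auto
    also have "\<dots> = (2 * L + 1) * (b - a)" using that nonneg
      by (simp add: right_diff_distrib[symmetric] abs_mult del: distrib_right_numeral)
    finally show ?thesis by (simp only: decay_def minus_mult_left)
  qed
  have "- m * (\<tau>' - \<tau>) - - m * (\<tau> - \<tau>) \<le> F \<tau>' - F \<tau>"
  proof (rule lipschitz_primitive_le[OF lipschitz_primitive_linear lipschitz_primitive_subinterval[OF lpF order_refl \<tau>(3)] \<tau>(2)])
    show "AE t in lebesgue. t \<in> {\<tau><..<\<tau>'} \<longrightarrow> - m \<le> dF t"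
      using lipschitz_primitive_derivative_bound[OF P(4) xl(1)] lipschitz_primitive_derivative_bound[OF P'(4) xl(2)]
    proof eventually_elim
      case (elim t)
      show ?case
      proof
        assume t: "t \<in> {\<tau><..<\<tau>'}"
        then have tT: "t \<in> {\<tau>..T}" "\<tau> \<in> {\<tau>..T}" and tt: "\<bar>t - \<tau>\<bar> \<le> \<eta>" and t0: "0 \<le> t" "t \<le> T"
          using \<tau> by (auto simp: \<eta>_def)
        define X where "X = vector_derivative x (at t)"
        define X' where "X' = vector_derivative x' (at t)"
        have Xb: "norm X \<le> Kx" "norm X' \<le> Kx" using elim t \<tau> by (auto simp: X_def X'_def)
        define g where "g = x t - x' t"
        define g0 where "g0 = \<xi> - \<xi>'"
        have g0': "g0 = x \<tau> - x' \<tau>" using P(3) P'(3) by (simp add: g0_def)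
        have gb: "norm g \<le> 2 * Kx" "norm g0 \<le> 2 * Kx"
          unfolding g_def g0' using xb[OF tT(1)] xb[OF tT(2)] norm_triangle_ineq4[of "x t" "x' t"] norm_triangle_ineq4[of "x \<tau>" "x' \<tau>"]
          by auto
        have gd: "norm (g0 - g) \<le> 2 * Kx * \<eta>"
        proof -
          have "g0 - g = (x \<tau> - x t) - (x' \<tau> - x' t)" by (simp add: g_def g0')
          then have "norm (g0 - g) \<le> norm (x \<tau> - x t) + norm (x' \<tau> - x' t)" by (metis norm_triangle_ineq4)
          also have "\<dots> \<le> Kx * norm (\<tau> - t) + Kx * norm (\<tau> - t)"
            by (intro add_mono lipschitz_on_normD[OF xl(1) tT(2,1)] lipschitz_on_normD[OF xl(2) tT(2,1)])
          also have "\<dots> = 2 * Kx * \<bar>t - \<tau>\<bar>" by (simp add: abs_minus_commute)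
          also have "\<dots> \<le> 2 * Kx * \<eta>" using tt Kx0 by (intro mult_left_mono) auto
          finally show ?thesis .
        qed
        define \<zeta> where "\<zeta> = z - (2 * k * decay t) *\<^sub>R g"
        have \<zeta>: "norm \<zeta> \<le> e1 * \<eta>"
        proof -
          have "\<zeta> = (2 * k) *\<^sub>R ((decay \<tau> - decay t) *\<^sub>R g0 + decay t *\<^sub>R (g0 - g))"
            unfolding \<zeta>_def z g0_def[symmetric] by (simp add: algebra_simps)
          then have "norm \<zeta> = 2 * k * norm ((decay \<tau> - decay t) *\<^sub>R g0 + decay t *\<^sub>R (g0 - g))" using k by simp
          also have "\<dots> \<le> 2 * k * (\<bar>decay \<tau> - decay t\<bar> * norm g0 + decay t * norm (g0 - g))"
            using k dec0[of t] by (intro mult_left_mono order_trans[OF norm_triangle_ineq]) auto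
          also have "\<dots> \<le> 2 * k * (((2 * L + 1) * \<eta>) * (2 * Kx) + 1 * (2 * Kx * \<eta>))"
          proof (intro mult_left_mono add_mono mult_mono)
            have "\<bar>decay \<tau> - decay t\<bar> \<le> (2 * L + 1) * (t - \<tau>)" using \<tau> t by (intro declip) auto
            also have "\<dots> \<le> (2 * L + 1) * \<eta>" using tt nonneg by (intro mult_left_mono) auto
            finally show "\<bar>decay \<tau> - decay t\<bar> \<le> (2 * L + 1) * \<eta>" .
          qed (use gb gd dec1[OF t0(1)] k \<eta> nonneg in auto)
          also have "\<dots> = e1 * \<eta>" by (simp add: e1_def algebra_simps)
          finally show ?thesis .
        qed
        have zb: "norm z \<le> 2 * k * decay t * norm g + e1 * \<eta>"
        proof -
          have "z = (2 * k * decay t) *\<^sub>R g + \<zeta>" by (simp add: \<zeta>_def)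
          then have "norm z \<le> norm ((2 * k * decay t) *\<^sub>R g) + norm \<zeta>" by (metis norm_triangle_ineq)
          then show ?thesis using \<zeta> k dec0[of t] by simp
        qed
        have dFeq: "dF t = (X - X') \<bullet> \<zeta> + (H t (x' t) (y' t) z - H t (x t) (y t) z) + k * (2 * L + 1) * decay t * (norm g)\<^sup>2"
          unfolding dF_def \<zeta>_def X_def[symmetric] X'_def[symmetric] g_def[symmetric]
          by (simp add: inner_diff_left inner_diff_right inner_commute algebra_simps)
        have t1: "(X - X') \<bullet> \<zeta> \<ge> - (2 * Kx * (e1 * \<eta>))"
        proof -
          have "\<bar>(X - X') \<bullet> \<zeta>\<bar> \<le> norm (X - X') * norm \<zeta>" by (rule Cauchy_Schwarz_ineq2)
          also have "\<dots> \<le> 2 * Kx * (e1 * \<eta>)"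
            using \<zeta> Xb norm_triangle_ineq4[of X X'] Kx0 by (intro mult_mono) auto
          finally show ?thesis by linarith
        qed
        have t2: "H t (x' t) (y' t) z - H t (x' t) (y t) z \<ge> - (2 * La * Ky * \<eta>)"
        proof (cases "y' t \<le> y t")
          case True
          have "2 * La * Ky * \<eta> \<ge> 0" using nonneg Ky0 \<eta> by simp
          with H_antimono[OF True, of t "x' t" z] show ?thesis by linarith
        next
          case False
          have ly: "\<bar>y t - y \<tau>\<bar> \<le> Ky * \<eta>" "\<bar>y' t - y' \<tau>\<bar> \<le> Ky * \<eta>"
            using lipschitz_on_normD[OF yl(1) tT] lipschitz_on_normD[OF yl(2) tT] mult_left_mono[OF tt Ky0] by auto
          have "\<bar>y' t - y t\<bar> \<le> 2 * (Ky * \<eta>)"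
            using ly False P(2) P'(2) y0 by linarith
          then have "La * \<bar>y' t - y t\<bar> \<le> La * (2 * (Ky * \<eta>))" using nonneg by (intro mult_left_mono) auto
          moreover have "\<bar>H t (x' t) (y' t) z - H t (x' t) (y t) z\<bar> \<le> La * \<bar>y' t - y t\<bar>"
            using H_Lipschitz[of t "x' t" "y' t" z "x' t" "y t"] by simp
          ultimately show ?thesis by (simp add: mult_ac abs_le_iff)
        qed
        have t3: "H t (x' t) (y t) z - H t (x t) (y t) z \<ge>
           - (L * (1 + M) * norm g) - 2 * L * k * decay t * (norm g)\<^sup>2 - 2 * Kx * L * (e1 * \<eta>)"
        proof -
          have "\<bar>H t (x t) (y t) z - H t (x' t) (y t) z\<bar> \<le> L * (1 + norm z + \<bar>y t\<bar>) * norm g"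
            using H_Lipschitz[of t "x t" "y t" z "x' t" "y t"] by (simp add: g_def)
          also have "\<dots> \<le> L * (1 + (2 * k * decay t * norm g + e1 * \<eta>) + M) * norm g"
            using zb yb[of t] t nonneg by (intro mult_right_mono mult_left_mono add_mono) auto
          also have "\<dots> = L * (1 + M) * norm g + 2 * L * k * decay t * (norm g)\<^sup>2 + L * (e1 * \<eta>) * norm g"
            by (simp add: algebra_simps power2_eq_square)
          also have "L * (e1 * \<eta>) * norm g \<le> L * (e1 * \<eta>) * (2 * Kx)"
            using gb nonneg e10 \<eta> by (intro mult_left_mono) auto
          finally show ?thesis by (simp add: mult_ac abs_le_iff)
        qed
        have t4: "k * decay t * (norm g)\<^sup>2 - L * (1 + M) * norm g \<ge> - ((L * (1 + M))\<^sup>2 / (4 * decay T) / k)"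
        proof -
          have "(L * (1 + M))\<^sup>2 / (4 * (k * decay t)) \<le> (L * (1 + M))\<^sup>2 / (4 * (k * decay T))"
            using decmono[OF t0(2)] dec0 k by (intro divide_left_mono mult_left_mono mult_pos_pos) auto
          also have "\<dots> = (L * (1 + M))\<^sup>2 / (4 * decay T) / k" by (simp add: mult_ac)
          finally show ?thesis using quadratic_lower_bound[of "k * decay t" "L * (1 + M)" "norm g"] k dec0[of t] by simp
        qed
        have "k * (2 * L + 1) * decay t * (norm g)\<^sup>2 = k * decay t * (norm g)\<^sup>2 + 2 * L * k * decay t * (norm g)\<^sup>2"
          by (simp add: algebra_simps)
        moreover have "m = (L * (1 + M))\<^sup>2 / (4 * decay T) / k + (2 * La * Ky * \<eta> + 2 * Kx * (e1 * \<eta>) + 2 * Kx * L * (e1 * \<eta>))"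
          by (simp add: m_def \<eta>_def algebra_simps)
        ultimately show "- m \<le> dF t" unfolding dFeq using t1 t2 t3 t4 by linarith
      qed
    qed
  qed
  then show ?thesis using P(2,3) P'(2,3) by (simp add: F_def algebra_simps)
qed

text \<open>
  Assume a positive gap at the starting point. The penalty constant \<open>k\<close> is chosen first, so large
  that the error \<open>c T / k\<close> of the steps and the terminal error \<open>L\<^sup>2 / (4 k decay T)\<close> are each at most
  a quarter of the gap. The step \<open>\<eta>\<close> is chosen afterwards, depending on \<open>k\<close>, so that the errors of
  second order in \<open>\<eta>\<close> cost another quarter. Then half the gap would survive until time \<open>T\<close>, which is
  too much.
\<close>

theorem minimax_comparison:
  assumes sub: "minimax_subsolution T H h C w" and super: "minimax_supersolution T H h C u"
    and wc: "continuous_on ({0..T} \<times> UNIV) (\<lambda>(t, \<xi>). w t \<xi>)"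
    and uc: "continuous_on ({0..T} \<times> UNIV) (\<lambda>(t, \<xi>). u t \<xi>)"
    and s: "s \<in> {0..T}"
  shows "w s \<xi> \<le> u s \<xi>"
proof (cases "s = T")
  case True
  have "w T \<xi> \<le> h \<xi>" "h \<xi> \<le> u T \<xi>"
    using sub super unfolding minimax_subsolution_def minimax_supersolution_def by auto
  then show ?thesis using True by simp
next
  case False
  then have s0: "0 \<le> s" "s < T" using s by auto
  show ?thesis
  proof (rule ccontr)
    define gap where "gap = w s \<xi> - u s \<xi>"
    assume "\<not> w s \<xi> \<le> u s \<xi>"
    then have gap: "gap > 0" by (simp add: gap_def)
    define R where "R = (1 + norm \<xi>) * exp (C * (T - s))"
    have R0: "R \<ge> 0" by (simp add: R_def)
    have expR: "(1 + norm \<xi>) * exp (C * (t - s)) \<le> R" if "t \<le> T" for t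
      unfolding R_def using that nonneg by (intro mult_left_mono) (auto intro!: mult_left_mono)
    have cpt: "compact ({0..T} \<times> cball (0::'a) R)" by (intro compact_Times) auto
    have "bounded ((\<lambda>(t, \<xi>). w t \<xi>) ` ({0..T} \<times> cball 0 R))" "bounded ((\<lambda>(t, \<xi>). u t \<xi>) ` ({0..T} \<times> cball 0 R))"
      by (intro compact_imp_bounded compact_continuous_image cpt continuous_on_subset[OF wc] continuous_on_subset[OF uc]; auto)+
    then obtain M1 M2 where M12: "\<forall>q\<in>(\<lambda>(t, \<xi>). w t \<xi>) ` ({0..T} \<times> cball 0 R). norm q \<le> M1"
      "\<forall>q\<in>(\<lambda>(t, \<xi>). u t \<xi>) ` ({0..T} \<times> cball 0 R). norm q \<le> M2" by (auto simp: bounded_iff)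
    define M where "M = max \<bar>M1\<bar> \<bar>M2\<bar>"
    have M: "\<bar>w t q\<bar> \<le> M" "\<bar>u t q\<bar> \<le> M" if "t \<in> {0..T}" "norm q \<le> R" for t q
    proof -
      have tq: "(t, q) \<in> {0..T} \<times> cball 0 R" using that by simp
      from M12(1)[rule_format, OF imageI[OF tq]] show "\<bar>w t q\<bar> \<le> M" by (simp add: M_def)
      from M12(2)[rule_format, OF imageI[OF tq]] show "\<bar>u t q\<bar> \<le> M" by (simp add: M_def)
    qed
    have M0: "M \<ge> 0" by (simp add: M_def)
    define Kx where "Kx = R + C * R"
    have Kx: "R \<le> Kx" "C * R \<le> Kx" using R0 nonneg by (auto simp: Kx_def)
    have dec0: "0 < decay t" for t by (simp add: decay_def)
    have dec1: "decay t \<le> 1" if "t \<ge> 0" for t unfolding decay_def using that nonneg by (auto intro!: mult_nonpos_nonneg)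
    have decT: "decay T \<le> decay t" if "t \<le> T" for t
      unfolding decay_def using that nonneg by (auto intro!: mult_left_mono_neg)
    define c where "c = (L * (1 + (M + 1)))\<^sup>2 / (4 * decay T)"
    have c0: "c \<ge> 0" using dec0[of T] by (simp add: c_def)
    define k where "k = (4 * c * T + L\<^sup>2 / decay T) / gap + 1"
    have "4 * c * T + L\<^sup>2 / decay T \<ge> 0" using c0 T_pos dec0[of T] by simp
    then have k: "k > 0" "4 * c * T + L\<^sup>2 / decay T < k * gap" using gap by (auto simp: k_def field_simps add_pos_nonneg)
    have k1: "c / k * T \<le> gap / 4" "L\<^sup>2 / (4 * (k * decay T)) < gap / 4"
    proof -
      have "0 \<le> L\<^sup>2 / decay T" using dec0[of T] by simp
      then have "4 * c * T \<le> k * gap" using k(2) by linarith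
      then show "c / k * T \<le> gap / 4" using k(1) by (simp add: field_simps)
      have "L\<^sup>2 / decay T < k * gap" using k(2) c0 T_pos mult_nonneg_nonneg[of c T] by linarith
      then show "L\<^sup>2 / (4 * (k * decay T)) < gap / 4" using k(1) dec0[of T] by (simp add: field_simps)
    qed
    obtain Ky where Ky: "Ky \<ge> 0" "\<And>\<tau> \<xi> y0 z x y. \<tau> \<in> {0..T} \<Longrightarrow> norm \<xi> \<le> R \<Longrightarrow> \<bar>y0\<bar> \<le> M \<Longrightarrow> norm z \<le> 4 * k * R \<Longrightarrow>
      (x, y) \<in> path_pair_set T H C \<tau> \<xi> y0 z \<Longrightarrow> Ky-lipschitz_on {\<tau>..T} y"
      using path_pair_uniform_bounds[of R M "4 * k * R"] by blast
    define c' where "c' = 2 * La * Ky + (2 * Kx + 2 * Kx * L) * (4 * k * Kx * (2 * L + 2))"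
    have c'0: "c' \<ge> 0" using nonneg Ky k Kx R0 by (simp add: c'_def)
    \<comment> \<open>the first bound keeps \<open>y\<close> within \<open>1\<close> of \<open>w\<close> during a step, hence below \<open>M + 1\<close>\<close>
    define \<eta>0 where "\<eta>0 = min (1 / (Ky + 1)) (gap / (4 * (c' * T + 1)))"
    have \<eta>00: "\<eta>0 > 0" using Ky gap c'0 T_pos by (simp add: \<eta>0_def add_nonneg_pos)
    obtain N :: nat where N: "(T - s) / \<eta>0 < N" using reals_Archimedean2 by blast
    have N0: "N > 0"
    proof (rule ccontr)
      assume "\<not> N > 0"
      then have "(T - s) / \<eta>0 < 0" using N by simp
      then show False using s0 \<eta>00 by (simp add: divide_less_0_iff)
    qed
    define \<eta> where "\<eta> = (T - s) / N"
    have \<eta>: "\<eta> > 0" "\<eta> \<le> \<eta>0" "real N * \<eta> = T - s"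
      using N0 N s0 \<eta>00 by (auto simp: \<eta>_def field_simps)
    have \<eta>1: "Ky * \<eta> \<le> 1"
    proof -
      have "Ky * \<eta> \<le> Ky * (1 / (Ky + 1))" using \<eta>(2) Ky(1) by (intro mult_left_mono) (auto simp: \<eta>0_def)
      also have "\<dots> \<le> 1" using Ky(1) by (simp add: field_simps)
      finally show ?thesis .
    qed
    have \<eta>2: "c' * \<eta> * T \<le> gap / 4"
    proof -
      have "c' * \<eta> * T = (c' * T) * \<eta>" by simp
      also have "\<dots> \<le> (c' * T) * (gap / (4 * (c' * T + 1)))"
        using \<eta>(2) c'0 T_pos by (intro mult_left_mono) (auto simp: \<eta>0_def)
      also have "\<dots> \<le> gap / 4"
      proof -
        have p: "c' * T \<ge> 0" using c'0 T_pos by simp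
        then have "(c' * T) * gap \<le> (c' * T + 1) * gap" using gap by (intro mult_right_mono) auto
        then have "(c' * T) * gap / (4 * (c' * T + 1)) \<le> (c' * T + 1) * gap / (4 * (c' * T + 1))"
          using p by (intro divide_right_mono) auto
        also have "\<dots> = (c' * T + 1) * gap / ((c' * T + 1) * 4)" by (simp only: mult.commute[of 4])
        also have "\<dots> = gap / 4"
          by (rule nonzero_mult_divide_mult_cancel_left) (use p in linarith)
        finally show ?thesis by simp
      qed
      finally show ?thesis .
    qed
    define m where "m = c / k + c' * \<eta>"
    have m0: "m \<ge> 0" using c0 k c'0 \<eta> by (simp add: m_def)
    have mT: "m * T \<le> gap / 2" using k1(1) \<eta>2 unfolding m_def distrib_right by linarith
    define \<Phi> where "\<Phi> t q q' = w t q - u t q' - k * decay t * (norm (q - q'))\<^sup>2" for t and q q' :: 'a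
    have pen: "k * decay t * (norm (q - q'))\<^sup>2 \<ge> 0" for t and q q' :: 'a using k dec0[of t] by simp
    have "\<exists>q q'. 1 + norm q \<le> (1 + norm \<xi>) * exp (C * (real i * \<eta>)) \<and> 1 + norm q' \<le> (1 + norm \<xi>) * exp (C * (real i * \<eta>))
       \<and> \<Phi> (s + real i * \<eta>) q q' \<ge> gap - m * (real i * \<eta>)" if "i \<le> N" for i
      using that
    proof (induction i)
      case 0
      show ?case by (intro exI[of _ \<xi>]) (simp add: \<Phi>_def gap_def)
    next
      case (Suc i)
      then obtain q q' where q: "1 + norm q \<le> (1 + norm \<xi>) * exp (C * (real i * \<eta>))" "1 + norm q' \<le> (1 + norm \<xi>) * exp (C * (real i * \<eta>))"
        and \<Phi>: "\<Phi> (s + real i * \<eta>) q q' \<ge> gap - m * (real i * \<eta>)" by auto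
      define \<tau> where "\<tau> = s + real i * \<eta>"
      define \<tau>' where "\<tau>' = s + real (Suc i) * \<eta>"
      have "real (Suc i) * \<eta> \<le> real N * \<eta>" using Suc.prems \<eta>(1) by (intro mult_right_mono) auto
      then have \<tau>'T: "\<tau>' \<le> T" using \<eta>(3) by (simp add: \<tau>'_def)
      have \<tau>\<tau>': "\<tau>' - \<tau> = \<eta>" by (simp add: \<tau>_def \<tau>'_def algebra_simps)
      then have "\<tau> < T" using \<tau>'T \<eta>(1) by linarith
      moreover have "\<tau> \<ge> s" using \<eta>(1) by (simp add: \<tau>_def)
      ultimately have \<tau>: "\<tau> \<in> {0..<T}" "\<tau> \<in> {0..T}" "s \<le> \<tau>" "\<tau> \<le> T" "\<tau> \<le> \<tau>'" "\<tau> - s = real i * \<eta>" "\<tau>' - s = real (Suc i) * \<eta>"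
        using s0 \<tau>\<tau>' \<eta>(1) by (auto simp: \<tau>_def \<tau>'_def)
      have qR: "norm q \<le> R" "norm q' \<le> R"
        using q expR[OF \<tau>(4)] unfolding \<tau>(6) by linarith+
      define z where "z = (2 * k * decay \<tau>) *\<^sub>R (q - q')"
      have zb: "norm z \<le> 4 * k * R"
      proof -
        have "norm z = 2 * k * decay \<tau> * norm (q - q')" using k dec0[of \<tau>] by (simp add: z_def)
        also have "\<dots> \<le> 2 * k * 1 * (2 * R)"
          using k dec0[of \<tau>] dec1[of \<tau>] \<tau> qR norm_triangle_ineq4[of q q'] R0 by (intro mult_mono) auto
        finally show ?thesis by simp
      qed
      obtain x y where xy: "(x, y) \<in> path_pair_set T H C \<tau> q (w \<tau> q) z" "\<forall>t\<in>{\<tau>..T}. y t \<le> w t (x t)"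
        using sub \<tau>(1) unfolding minimax_subsolution_def by blast
      obtain x' y' where xy': "(x', y') \<in> path_pair_set T H C \<tau> q' (u \<tau> q') z" "\<forall>t\<in>{\<tau>..T}. u t (x' t) \<le> y' t"
        using super \<tau>(1) unfolding minimax_supersolution_def by blast
      have growth_x: "Kx-lipschitz_on {\<tau>..T} x" "\<And>t. t \<in> {\<tau>..T} \<Longrightarrow> 1 + norm (x t) \<le> (1 + norm \<xi>) * exp (C * (t - s))"
        if x: "x \<in> path_set T C \<tau> p" and p: "1 + norm p \<le> (1 + norm \<xi>) * exp (C * (real i * \<eta>))" for x and p :: 'a
      proof -
        have e: "(1 + norm p) * exp (C * (t - \<tau>)) \<le> (1 + norm \<xi>) * exp (C * (t - s))" for t
        proof -
          have "(1 + norm p) * exp (C * (t - \<tau>)) \<le> (1 + norm \<xi>) * exp (C * (\<tau> - s)) * exp (C * (t - \<tau>))"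
            using p unfolding \<tau>(6) by (intro mult_right_mono) auto
          also have "\<dots> = (1 + norm \<xi>) * exp (C * (t - s))" by (simp add: mult.assoc mult_exp_exp algebra_simps)
          finally show ?thesis .
        qed
        show "1 + norm (x t) \<le> (1 + norm \<xi>) * exp (C * (t - s))" if "t \<in> {\<tau>..T}" for t
          using order_trans[OF path_set_properties(1)[OF x nonneg(1) \<tau>(4) that] e] .
        have "C * ((1 + norm p) * exp (C * (T - \<tau>))) \<le> C * R"
          using e[of T] nonneg unfolding R_def by (intro mult_left_mono)
        then show "Kx-lipschitz_on {\<tau>..T} x"
          using Kx(2) by (intro lipschitz_on_le[OF path_set_properties(3)[OF x nonneg(1) \<tau>(4)]]) auto
      qed
      have xs: "x \<in> path_set T C \<tau> q" "x' \<in> path_set T C \<tau> q'" using path_pairD(1)[OF \<tau>(2) xy(1)] path_pairD(1)[OF \<tau>(2) xy'(1)] .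
      note X = growth_x[OF xs(1) q(1)] and X' = growth_x[OF xs(2) q(2)]
      have xKx: "norm (x t) \<le> Kx" "norm (x' t) \<le> Kx" if "t \<in> {\<tau>..T}" for t
        using X(2)[OF that] X'(2)[OF that] expR[of t] that Kx(1) by auto
      have yl: "Ky-lipschitz_on {\<tau>..T} y" "Ky-lipschitz_on {\<tau>..T} y'"
        using Ky(2)[OF \<tau>(2) qR(1) M(1)[OF \<tau>(2) qR(1)] zb xy(1)] Ky(2)[OF \<tau>(2) qR(2) M(2)[OF \<tau>(2) qR(2)] zb xy'(1)] .
      have yb: "\<bar>y t\<bar> \<le> M + 1" if t: "t \<in> {\<tau>..\<tau>'}" for t
      proof -
        have "\<bar>y t - y \<tau>\<bar> \<le> Ky * \<bar>t - \<tau>\<bar>" using lipschitz_on_normD[OF yl(1), of t \<tau>] t \<tau>'T \<tau> by auto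
        also have "\<dots> \<le> Ky * \<eta>" using t \<tau>\<tau>' Ky(1) by (intro mult_left_mono) auto
        also have "\<dots> \<le> 1" by (rule \<eta>1)
        finally show ?thesis using path_pairD(2)[OF \<tau>(2) xy(1)] M(1)[OF \<tau>(2) qR(1)] by linarith
      qed
      have mi: "m * (real i * \<eta>) \<le> gap / 2"
      proof -
        have "m * (real i * \<eta>) \<le> m * T" using \<tau>(4,6) s0 m0 by (intro mult_left_mono) auto
        then show ?thesis using mT by linarith
      qed
      \<comment> \<open>the surviving gap provides the order of the initial values that the next step requires\<close>
      have wu: "u \<tau> q' \<le> w \<tau> q"
        using \<Phi> mi gap pen[of \<tau> q q'] unfolding \<Phi>_def \<tau>_def[symmetric] by linarith
      have "(w \<tau> q - u \<tau> q' - k * decay \<tau> * (norm (q - q'))\<^sup>2) - m * \<eta>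
         \<le> y \<tau>' - y' \<tau>' - k * decay \<tau>' * (norm (x \<tau>' - x' \<tau>'))\<^sup>2"
        using doubled_characteristics_step[OF \<tau>(2,5) \<tau>'T k(1) xy(1) xy'(1) z_def wu X(1) X'(1) xKx yl yb]
        unfolding \<tau>\<tau>' m_def c_def c'_def by simp
      moreover have "y \<tau>' \<le> w \<tau>' (x \<tau>')" "u \<tau>' (x' \<tau>') \<le> y' \<tau>'" using xy(2) xy'(2) \<tau> \<tau>'T by auto
      ultimately have "\<Phi> \<tau>' (x \<tau>') (x' \<tau>') \<ge> gap - m * (real i * \<eta>) - m * \<eta>"
        using \<Phi> unfolding \<Phi>_def \<tau>_def[symmetric] by linarith
      moreover have "gap - m * (real i * \<eta>) - m * \<eta> = gap - m * (real (Suc i) * \<eta>)" by (simp add: algebra_simps)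
      moreover have "1 + norm (x \<tau>') \<le> (1 + norm \<xi>) * exp (C * (real (Suc i) * \<eta>))" "1 + norm (x' \<tau>') \<le> (1 + norm \<xi>) * exp (C * (real (Suc i) * \<eta>))"
        using X(2)[of \<tau>'] X'(2)[of \<tau>'] \<tau> \<tau>'T by auto
      ultimately show ?case unfolding \<tau>'_def by (metis (no_types))
    qed
    from this[of N] obtain q q' where \<Phi>: "\<Phi> (s + real N * \<eta>) q q' \<ge> gap - m * (real N * \<eta>)" by auto
    have sN: "s + real N * \<eta> = T" using \<eta>(3) by simp
    have "m * (real N * \<eta>) \<le> m * T" using \<eta>(3) s0 m0 by (intro mult_left_mono) auto
    then have "gap / 2 \<le> \<Phi> T q q'" using \<Phi> mT unfolding sN by linarith
    also have "\<Phi> T q q' \<le> L * norm (q - q') - k * decay T * (norm (q - q'))\<^sup>2"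
    proof -
      have "w T q \<le> h q" "h q' \<le> u T q'"
        using sub super unfolding minimax_subsolution_def minimax_supersolution_def by auto
      then show ?thesis using h_lip[of q q'] unfolding \<Phi>_def by linarith
    qed
    also have "\<dots> \<le> L\<^sup>2 / (4 * (k * decay T))"
      using quadratic_lower_bound[of "k * decay T" L "norm (q - q')"] k dec0[of T] by simp
    finally show False using k1(2) gap by linarith
  qed
qed

end

section \<open>Data regular at almost every time\<close>

text \<open>
  Lebesgue measure is complete, so measurability itself is insensitive to changes on a null set;
  the integrals below may therefore be compared without knowing that the integrands are measurable.
\<close>

lemma borel_measurable_lebesgue_AE_cong:
  fixes f g :: "real \<Rightarrow> 'b::topological_space"
  assumes ae: "AE x in lebesgue. f x = g x" and f: "f \<in> borel_measurable lebesgue"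
  shows "g \<in> borel_measurable lebesgue"
proof (rule measurableI)
  fix B :: "'b set" assume B: "B \<in> sets borel"
  have neg: "negligible {x. f x \<noteq> g x}" using ae by (simp add: AE_lebesgue_iff_negligible)
  have "g -` B = (f -` B - {x. f x \<noteq> g x}) \<union> (g -` B \<inter> {x. f x \<noteq> g x})" by auto
  moreover have "f -` B \<in> sets lebesgue" using measurable_sets[OF f B] by simp
  moreover have "{x. f x \<noteq> g x} \<in> sets lebesgue" using neg by (simp add: negligible_iff_null_sets null_setsD2)
  moreover have "g -` B \<inter> {x. f x \<noteq> g x} \<in> sets lebesgue"
    using negligible_subset[OF neg, of "g -` B \<inter> {x. f x \<noteq> g x}"] by (simp add: negligible_iff_null_sets null_setsD2)
  ultimately have "g -` B \<in> sets lebesgue" by (metis sets.Un sets.Diff)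
  then show "g -` B \<inter> space lebesgue \<in> sets lebesgue" by simp
qed simp

lemma integrable_lebesgue_AE_cong:
  fixes f g :: "real \<Rightarrow> 'b::{banach, second_countable_topology}"
  assumes ae: "AE x in lebesgue. f x = g x"
  shows "integrable lebesgue f \<longleftrightarrow> integrable lebesgue g" "integral\<^sup>L lebesgue f = integral\<^sup>L lebesgue g"
proof -
  have ae': "AE x in lebesgue. g x = f x" using ae by eventually_elim simp
  have m: "f \<in> borel_measurable lebesgue \<longleftrightarrow> g \<in> borel_measurable lebesgue"
    using borel_measurable_lebesgue_AE_cong[OF ae] borel_measurable_lebesgue_AE_cong[OF ae'] by blast
  show i: "integrable lebesgue f \<longleftrightarrow> integrable lebesgue g"
  proof (cases "f \<in> borel_measurable lebesgue")
    case True
    then show ?thesis using m ae by (intro integrable_cong_AE) auto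
  next
    case False
    then show ?thesis using m by (auto dest: borel_measurable_integrable)
  qed
  show "integral\<^sup>L lebesgue f = integral\<^sup>L lebesgue g"
  proof (cases "f \<in> borel_measurable lebesgue")
    case True
    then show ?thesis using m ae by (intro integral_cong_AE) auto
  next
    case False
    then have "\<not> integrable lebesgue f" by (auto dest: borel_measurable_integrable)
    then show ?thesis using i by (simp add: not_integrable_integral_eq)
  qed
qed

lemma set_integral_lebesgue_AE_cong:
  fixes f g :: "real \<Rightarrow> 'b::{banach, second_countable_topology}"
  assumes ae: "AE x in lebesgue. x \<in> S \<longrightarrow> f x = g x"
  shows "set_integrable lebesgue S f \<longleftrightarrow> set_integrable lebesgue S g"
    "(LINT x:S|lebesgue. f x) = (LINT x:S|lebesgue. g x)"
proof -
  have "AE x in lebesgue. indicator S x *\<^sub>R f x = indicator S x *\<^sub>R g x"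
    using ae by eventually_elim (auto simp: indicator_def)
  from integrable_lebesgue_AE_cong[OF this]
  show "set_integrable lebesgue S f \<longleftrightarrow> set_integrable lebesgue S g"
    "(LINT x:S|lebesgue. f x) = (LINT x:S|lebesgue. g x)"
    by (simp_all add: set_integrable_def set_lebesgue_integral_def)
qed

lemma AE_imp_cong:
  assumes "AE x in M. P x \<longrightarrow> (Q x \<longleftrightarrow> R x)"
  shows "(AE x in M. P x \<longrightarrow> Q x) \<longleftrightarrow> (AE x in M. P x \<longrightarrow> R x)"
proof
  assume "AE x in M. P x \<longrightarrow> Q x" with assms show "AE x in M. P x \<longrightarrow> R x" by eventually_elim auto
next
  assume "AE x in M. P x \<longrightarrow> R x" with assms show "AE x in M. P x \<longrightarrow> Q x" by eventually_elim auto
qed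

lemma cost_AE_cong:
  assumes ae: "AE t in lebesgue. t \<in> {0..T} \<longrightarrow> f t = f' t \<and> lam t = lam' t \<and> ell t = ell' t" and s: "s \<in> {0..T}"
  shows "cost T f lam ell h s \<xi> a = cost T f' lam' ell' h s \<xi> a"
proof -
  have aeU: "AE t in lebesgue. t \<in> U \<longrightarrow> f t = f' t \<and> lam t = lam' t \<and> ell t = ell' t" if "U \<subseteq> {0..T}" for U
    using ae by eventually_elim (use that in auto)
  have "(AE t in lebesgue. t \<in> {s<..<T} \<longrightarrow> (x has_vector_derivative f t (x t) (a t)) (at t))
    \<longleftrightarrow> (AE t in lebesgue. t \<in> {s<..<T} \<longrightarrow> (x has_vector_derivative f' t (x t) (a t)) (at t))" for x
  proof (rule AE_imp_cong)
    have "{s<..<T} \<subseteq> {0..T}" using s by auto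
    from aeU[OF this]
    show "AE t in lebesgue. t \<in> {s<..<T} \<longrightarrow> ((x has_vector_derivative f t (x t) (a t)) (at t) \<longleftrightarrow>
       (x has_vector_derivative f' t (x t) (a t)) (at t))" by eventually_elim auto
  qed
  then have traj: "trajectory T f s \<xi> a = trajectory T f' s \<xi> a" by (simp add: trajectory_def)
  define x where "x = trajectory T f s \<xi> a"
  have disc: "discount lam x a s t = discount lam' x a s t" if "t \<in> {s..T}" for t
  proof -
    have "{s..t} \<subseteq> {0..T}" using s that by auto
    from aeU[OF this] have "AE r in lebesgue. r \<in> {s..t} \<longrightarrow> lam r (x r) (a r) = lam' r (x r) (a r)"
      by eventually_elim auto
    from set_integral_lebesgue_AE_cong(2)[OF this] show ?thesis by (simp add: discount_def)
  qed
  have "{s..T} \<subseteq> {0..T}" using s by auto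
  from aeU[OF this] have "AE t in lebesgue. t \<in> {s..T} \<longrightarrow> discount lam x a s t * ell t (x t) (a t) = discount lam' x a s t * ell' t (x t) (a t)"
    by eventually_elim (use disc in auto)
  from set_integral_lebesgue_AE_cong(2)[OF this]
  show ?thesis
    using disc[of T] s unfolding cost_def Let_def traj[symmetric] x_def[symmetric] by simp
qed

lemma path_pair_set_AE_cong:
  assumes ae: "AE t in lebesgue. t \<in> {0..T} \<longrightarrow> H t = H' t" and "0 \<le> s0"
  shows "path_pair_set T H K s0 \<xi> y0 z = path_pair_set T H' K s0 \<xi> y0 z"
proof -
  have *: "AE s in lebesgue. s \<in> {s0..t} \<longrightarrow> vector_derivative x (at s) \<bullet> z - H s (x s) (y s) z = vector_derivative x (at s) \<bullet> z - H' s (x s) (y s) z"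
    if "t \<le> T" for t x y
    using ae by eventually_elim (use that \<open>0 \<le> s0\<close> in auto)
  show ?thesis
    unfolding path_pair_set_def
    using set_integral_lebesgue_AE_cong[OF *[OF order_refl]] set_integral_lebesgue_AE_cong(2)[OF *] by auto
qed

text \<open>
  A minimax solution is tested on \<open>[0, T]\<close>, and the Hamiltonian enters through integrals over
  time alone.
\<close>

lemma minimax_solution_cong:
  assumes ae: "AE t in lebesgue. t \<in> {0..T} \<longrightarrow> H t = H' t" and "T > 0"
    and u: "\<And>t \<xi>. t \<in> {0..T} \<Longrightarrow> u t \<xi> = u' t \<xi>"
    and sol: "minimax_solution T H h K u"
  shows "minimax_solution T H' h K u'"
proof -
  note PP = path_pair_set_AE_cong[OF ae]
  have ev: "eventually (\<lambda>q. P (case q of (t, \<xi>) \<Rightarrow> u' t \<xi>)) (at p within {0..T} \<times> UNIV)"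
    if "eventually (\<lambda>q. P (case q of (t, \<xi>) \<Rightarrow> u t \<xi>)) (at p within {0..T} \<times> UNIV)" for P p
  proof -
    have "eventually (\<lambda>q. q \<in> {0..T} \<times> UNIV) (at p within {0..T} \<times> UNIV)" by (simp add: eventually_at_filter)
    with that show ?thesis by eventually_elim (auto simp: u)
  qed
  have sub: "minimax_subsolution T H h K u" and super: "minimax_supersolution T H h K u"
    using sol by (auto simp: minimax_solution_def)
  have uT: "u' T \<xi> = u T \<xi>" for \<xi> using u[of T \<xi>] \<open>T > 0\<close> by simp
  have "minimax_supersolution T H' h K u'"
    unfolding minimax_supersolution_def
  proof (intro conjI ballI allI impI)
    show "lower_semicontinuous_on ({0..T} \<times> UNIV) (\<lambda>(t, \<xi>). u' t \<xi>)"
      unfolding lower_semicontinuous_on_def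
    proof (intro ballI allI impI ev)
      fix p c assume "p \<in> {0..T} \<times> UNIV" "c < (case p of (t, \<xi>) \<Rightarrow> u' t \<xi>)"
      then show "eventually (\<lambda>q. c < (case q of (t, \<xi>) \<Rightarrow> u t \<xi>)) (at p within {0..T} \<times> UNIV)"
        using super unfolding minimax_supersolution_def lower_semicontinuous_on_def by (auto simp: u)
    qed
    show "h \<xi> \<le> u' T \<xi>" for \<xi> using super unfolding uT minimax_supersolution_def by auto
    fix s0 \<xi> z y0 assume s0: "s0 \<in> {0..<T}" and y0: "u' s0 \<xi> \<le> y0"
    then have "u s0 \<xi> \<le> y0" using u by simp
    then obtain x y where "(x, y) \<in> path_pair_set T H K s0 \<xi> y0 z" "\<forall>t\<in>{s0..T}. u t (x t) \<le> y t"
      using super s0 unfolding minimax_supersolution_def by blast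
    then show "\<exists>(x, y)\<in>path_pair_set T H' K s0 \<xi> y0 z. \<forall>t\<in>{s0..T}. u' t (x t) \<le> y t"
      using s0 u by (intro bexI[of _ "(x, y)"]) (auto simp: PP)
  qed
  moreover have "minimax_subsolution T H' h K u'"
    unfolding minimax_subsolution_def
  proof (intro conjI ballI allI impI)
    show "upper_semicontinuous_on ({0..T} \<times> UNIV) (\<lambda>(t, \<xi>). u' t \<xi>)"
      unfolding upper_semicontinuous_on_def
    proof (intro ballI allI impI ev)
      fix p c assume "p \<in> {0..T} \<times> UNIV" "(case p of (t, \<xi>) \<Rightarrow> u' t \<xi>) < c"
      then show "eventually (\<lambda>q. (case q of (t, \<xi>) \<Rightarrow> u t \<xi>) < c) (at p within {0..T} \<times> UNIV)"
        using sub unfolding minimax_subsolution_def upper_semicontinuous_on_def by (auto simp: u)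
    qed
    show "u' T \<xi> \<le> h \<xi>" for \<xi> using sub unfolding uT minimax_subsolution_def by auto
    fix s0 \<xi> z y0 assume s0: "s0 \<in> {0..<T}" and y0: "y0 \<le> u' s0 \<xi>"
    then have "y0 \<le> u s0 \<xi>" using u by simp
    then obtain x y where "(x, y) \<in> path_pair_set T H K s0 \<xi> y0 z" "\<forall>t\<in>{s0..T}. y t \<le> u t (x t)"
      using sub s0 unfolding minimax_subsolution_def by blast
    then show "\<exists>(x, y)\<in>path_pair_set T H' K s0 \<xi> y0 z. \<forall>t\<in>{s0..T}. y t \<le> u' t (x t)"
      using s0 u by (intro bexI[of _ "(x, y)"]) (auto simp: PP)
  qed
  ultimately show ?thesis by (simp add: minimax_solution_def)
qed

theorem (in control_data) value_unique_minimax_solution: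
  assumes u: "minimax_solution T H h C u" and t: "t \<in> {0..T}"
  shows "u t \<xi> = v t \<xi>"
proof (rule antisym)
  have uc: "continuous_on ({0..T} \<times> UNIV) (\<lambda>(t, \<xi>). u t \<xi>)"
    using u unfolding minimax_solution_def minimax_supersolution_def minimax_subsolution_def
    by (blast intro: semicontinuous_imp_continuous_on)
  show "u t \<xi> \<le> v t \<xi>" "v t \<xi> \<le> u t \<xi>"
    using u value_minimax_solution t unfolding minimax_solution_def
    by (auto intro: minimax_comparison[OF _ _ uc value_continuous] minimax_comparison[OF _ _ value_continuous uc])
qed

theorem theorem8p6:
  fixes T Cf Clam Lf :: real
    and A :: "'p::polish_space set"
    and f :: "real \<Rightarrow> real ^ 'n \<Rightarrow> 'p \<Rightarrow> real ^ 'n"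
    and lam ell :: "real \<Rightarrow> real ^ 'n \<Rightarrow> 'p \<Rightarrow> real"
    and h :: "real ^ 'n \<Rightarrow> real"
  assumes T_pos: "T > 0"
    and A_nonempty: "A \<noteq> {}"
    and A_sigma_compact: "\<exists>\<K>. countable \<K> \<and> (\<forall>K\<in>\<K>. compact K) \<and> A = \<Union>\<K>"
    and lam_nonneg: "\<forall>t\<in>{0..T}. \<forall>\<xi>. \<forall>a\<in>A. lam t \<xi> a \<ge> 0"
    and data_continuous: "AE t in lebesgue. t \<in> {0..T} \<longrightarrow>
      continuous_on (UNIV \<times> A) (\<lambda>(\<xi>, a). (f t \<xi> a, lam t \<xi> a, ell t \<xi> a))"
    and data_measurable: "\<forall>\<xi>. \<forall>a\<in>A.
      (\<lambda>t. (f t \<xi> a, lam t \<xi> a, ell t \<xi> a)) \<in> borel_measurable (restrict_space borel {0..T})"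
    and constants_nonneg: "Cf \<ge> 0" "Clam \<ge> 0" "Lf \<ge> 0"
    and data_growth: "AE t in lebesgue. t \<in> {0<..<T} \<longrightarrow>
      (\<forall>\<xi>. (\<forall>a\<in>A. norm (f t \<xi> a) + \<bar>ell t \<xi> a\<bar> \<le> Cf * (1 + norm \<xi>)) \<and>
           (\<forall>a\<in>A. \<bar>lam t \<xi> a\<bar> \<le> Clam))"
    and data_Lipschitz: "AE t in lebesgue. t \<in> {0<..<T} \<longrightarrow>
      (\<forall>\<xi> \<xi>'. \<forall>a\<in>A.
         (norm (f t \<xi> a - f t \<xi>' a) + \<bar>ell t \<xi> a - ell t \<xi>' a\<bar> + \<bar>lam t \<xi> a - lam t \<xi>' a\<bar>)
         + \<bar>h \<xi> - h \<xi>'\<bar> \<le> Lf * norm (\<xi> - \<xi>'))"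
  shows "minimax_solution T (hamiltonian A f lam ell) h Cf (value_function T A f lam ell h) \<and>
    (\<forall>u. minimax_solution T (hamiltonian A f lam ell) h Cf u \<longrightarrow>
      (\<forall>t\<in>{0..T}. \<forall>\<xi>. u t \<xi> = value_function T A f lam ell h t \<xi>))"
proof -
  define good where "good t \<longleftrightarrow> continuous_on (UNIV \<times> A) (\<lambda>(\<xi>, a). (f t \<xi> a, lam t \<xi> a, ell t \<xi> a)) \<and>
      (\<forall>\<xi>. (\<forall>a\<in>A. norm (f t \<xi> a) + \<bar>ell t \<xi> a\<bar> \<le> Cf * (1 + norm \<xi>)) \<and>
           (\<forall>a\<in>A. \<bar>lam t \<xi> a\<bar> \<le> Clam)) \<and>
      (\<forall>\<xi> \<xi>'. \<forall>a\<in>A.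
         (norm (f t \<xi> a - f t \<xi>' a) + \<bar>ell t \<xi> a - ell t \<xi>' a\<bar> + \<bar>lam t \<xi> a - lam t \<xi>' a\<bar>)
         + \<bar>h \<xi> - h \<xi>'\<bar> \<le> Lf * norm (\<xi> - \<xi>'))" for t
  have "AE t in lebesgue. t \<in> {0<..<T} \<longrightarrow> good t"
    using data_continuous data_growth data_Lipschitz by eventually_elim (simp add: good_def)
  then have "AE t in lborel. t \<in> {0<..<T} \<longrightarrow> good t" by (simp add: AE_completion_iff)
  then obtain N where N: "N \<in> null_sets lborel" "{t. \<not> (t \<in> {0<..<T} \<longrightarrow> good t)} \<subseteq> N"
    unfolding eventually_ae_filter by auto
  \<comment> \<open>a Borel set of good times, so that the data set to \<open>0\<close> elsewhere remain Borel measurable\<close>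
  define G where "G = {0<..<T} - N"
  have Gb: "G \<in> sets borel" using N(1) by (auto simp: G_def null_sets_def)
  have G: "good t" "t \<in> {0..T}" if "t \<in> G" for t using that N(2) by (auto simp: G_def)
  \<comment> \<open>the Lipschitz bound for \<open>h\<close> is part of the hypothesis at a single good time\<close>
  have "G \<noteq> {}"
  proof
    assume "G = {}"
    then have "{0<..<T} \<in> null_sets lborel" using N(1) by (intro null_sets_subset[OF N(1)]) (auto simp: G_def)
    then show False using T_pos by (simp add: null_sets_def)
  qed
  then obtain t0 where t0: "t0 \<in> G" by blast
  define f' where "f' t = (if t \<in> G then f t else (\<lambda>\<xi> a. 0))" for t
  define lam' where "lam' t = (if t \<in> G then lam t else (\<lambda>\<xi> a. 0))" for t
  define ell' where "ell' t = (if t \<in> G then ell t else (\<lambda>\<xi> a. 0))" for t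
  interpret control_data T Cf Clam Lf A f' lam' ell' h
  proof
    show "continuous_on (UNIV \<times> A) (\<lambda>(\<xi>, a). (f' t \<xi> a, lam' t \<xi> a, ell' t \<xi> a))" for t
      using G(1)[of t] by (cases "t \<in> G") (auto simp: f'_def lam'_def ell'_def good_def split_beta intro!: continuous_intros)
    show "(\<lambda>t. (f' t \<xi> a, lam' t \<xi> a, ell' t \<xi> a)) \<in> borel_measurable borel" if a: "a \<in> A" for \<xi> a
    proof -
      have "(\<lambda>t. (f t \<xi> a, lam t \<xi> a, ell t \<xi> a)) \<in> borel_measurable (restrict_space borel G)"
        by (rule measurable_restrict_mono[OF data_measurable[rule_format, OF a]]) (use G(2) in auto)
      then have "(\<lambda>t. if t \<in> G then (f t \<xi> a, lam t \<xi> a, ell t \<xi> a) else (0, 0, 0)) \<in> borel_measurable borel"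
        using Gb by (subst measurable_If_restrict_space_iff) auto
      moreover have "(\<lambda>t. if t \<in> G then (f t \<xi> a, lam t \<xi> a, ell t \<xi> a) else (0, 0, 0)) = (\<lambda>t. (f' t \<xi> a, lam' t \<xi> a, ell' t \<xi> a))"
        by (auto simp: f'_def lam'_def ell'_def)
      ultimately show ?thesis by simp
    qed
    show "0 \<le> lam' t \<xi> a" if "a \<in> A" for t \<xi> a using that lam_nonneg G(2) by (auto simp: lam'_def)
    show "norm (f' t \<xi> a) + \<bar>ell' t \<xi> a\<bar> \<le> Cf * (1 + norm \<xi>)" if "a \<in> A" for t \<xi> a
      using that G(1)[of t] constants_nonneg by (auto simp: f'_def ell'_def good_def)
    show "lam' t \<xi> a \<le> Clam" if "a \<in> A" for t \<xi> a
      using that G(1)[of t] constants_nonneg by (auto simp: lam'_def good_def abs_le_iff)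
    show "norm (f' t \<xi> a - f' t \<xi>' a) + \<bar>ell' t \<xi> a - ell' t \<xi>' a\<bar> + \<bar>lam' t \<xi> a - lam' t \<xi>' a\<bar> \<le> Lf * norm (\<xi> - \<xi>')"
      if a: "a \<in> A" for t \<xi> \<xi>' a
    proof (cases "t \<in> G")
      case True
      then have "(norm (f t \<xi> a - f t \<xi>' a) + \<bar>ell t \<xi> a - ell t \<xi>' a\<bar> + \<bar>lam t \<xi> a - lam t \<xi>' a\<bar>)
         + \<bar>h \<xi> - h \<xi>'\<bar> \<le> Lf * norm (\<xi> - \<xi>')" using G(1)[of t] a unfolding good_def by blast
      then show ?thesis using True unfolding f'_def lam'_def ell'_def by simp
    qed (use constants_nonneg in \<open>simp add: f'_def lam'_def ell'_def\<close>)
    show "\<bar>h \<xi> - h \<xi>'\<bar> \<le> Lf * norm (\<xi> - \<xi>')" for \<xi> \<xi>'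
    proof -
      obtain a where "a \<in> A" using A_nonempty by blast
      then have "(norm (f t0 \<xi> a - f t0 \<xi>' a) + \<bar>ell t0 \<xi> a - ell t0 \<xi>' a\<bar> + \<bar>lam t0 \<xi> a - lam t0 \<xi>' a\<bar>)
         + \<bar>h \<xi> - h \<xi>'\<bar> \<le> Lf * norm (\<xi> - \<xi>')" using G(1)[OF t0] unfolding good_def by blast
      then show ?thesis using norm_ge_zero[of "f t0 \<xi> a - f t0 \<xi>' a"] by linarith
    qed
  qed (use T_pos A_nonempty constants_nonneg in auto)
  have ae: "AE t in lebesgue. t \<in> {0..T} \<longrightarrow> f t = f' t \<and> lam t = lam' t \<and> ell t = ell' t"
  proof -
    have "AE t in lborel. t \<notin> N \<union> {0, T}"
      using N(1) by (intro AE_not_in null_sets.Un) (auto simp: finite_imp_null_set_lborel)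
    then have "AE t in lebesgue. t \<notin> N \<union> {0, T}" by (rule AE_completion)
    then show ?thesis by eventually_elim (auto simp: G_def f'_def lam'_def ell'_def)
  qed
  have aeH: "AE t in lebesgue. t \<in> {0..T} \<longrightarrow> hamiltonian A f lam ell t = H t"
    using ae by eventually_elim (auto simp: hamiltonian_def fun_eq_iff)
  have aeH': "AE t in lebesgue. t \<in> {0..T} \<longrightarrow> H t = hamiltonian A f lam ell t"
    using aeH by eventually_elim auto
  have veq: "value_function T A f lam ell h t \<xi> = v t \<xi>" if "t \<in> {0..T}" for t \<xi>
    unfolding value_function_def using cost_AE_cong[OF ae that] by simp
  show ?thesis
  proof (intro conjI allI impI ballI)
    show "minimax_solution T (hamiltonian A f lam ell) h Cf (value_function T A f lam ell h)"
      by (rule minimax_solution_cong[OF aeH' T_pos _ value_minimax_solution]) (simp add: veq)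
    fix u t \<xi> assume u: "minimax_solution T (hamiltonian A f lam ell) h Cf u" and t: "t \<in> {0..T}"
    have "minimax_solution T H h Cf u"
      by (rule minimax_solution_cong[OF aeH T_pos _ u]) simp
    from value_unique_minimax_solution[OF this t] show "u t \<xi> = value_function T A f lam ell h t \<xi>"
      by (simp add: veq[OF t])
  qed
qed

end
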